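(* Let $d\ge 2$, $\alpha\ge 0$, $\rho>0$ and $\nu\in\mathcal V_\alpha^+\cup\mathcal V_\alpha$. Then, if $\beta>0$ is large enough, $$\zeta_c(\beta,\rho,\nu)=\Big(\frac{\lambda_c^*(\alpha)}{\rho}\Big)^{\frac1{\alpha+1+d}}(\beta C_\nu)^{\frac{\alpha+1}{\alpha+1+d}},\qquad c_c(\beta,\rho,\nu)=\exp\Big\{-\Big(\frac{\lambda_c^*(\alpha)}{\rho}\Big)^{\frac1{\alpha+1+d}}(\beta C_\nu)^{\frac{\alpha+1}{\alpha+1+d}}\Big\}.$$ More precisely, both identities hold for every $\beta>0$ such that $(\lambda_c^*(\alpha)/\rho)^{\frac1{\alpha+1+d}}(\beta C_\nu)^{\frac{\alpha+1}{\alpha+1+d}}<\min\{C_\nu,\varepsilon_\nu\}\,\beta$.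
   Context: $\Omega$ is the space of sets $\omega=\{(x_i,E_{x_i})\}\subset\mathbb R^d\times\mathbb R$ such that $\widehat\omega:=\{x_i\}$ is a locally finite subset of $\mathbb R^d$ (each $x\in\widehat\omega$ carries exactly one mark $E_x$). $\mathrm{PPP}[\rho,\nu]$ denotes the homogeneous Poisson point process on $\mathbb R^d$ with intensity $\rho$ whose points are marked by i.i.d. real random variables with common law $\nu$ (independent of the points); the same symbol denotes its law on $\Omega$. Graph $\mathcal G[\zeta,\beta](\omega)$: for $\omega\in\Omega$, $\zeta,\beta>0$, it has vertex set $\widehat\omega$ and an edge $\{x,y\}$ for each $x\neq y$ in $\widehat\omega$ with $|x-y|+\beta(|E_x|+|E_y|+|E_x-E_y|)\le\zeta$ ($|\cdot|$ on $\mathbb R^d$ is the Euclidean norm). It percolates if it has an unbounded connected component. Critical threshold and conductance: $\theta(\zeta,\beta,\rho,\nu):=\mathrm{PPP}[\rho,\nu](\mathcal G[\zeta,\beta]\text{ percolates})\in\{0,1\}$; $\zeta_c(\beta,\rho,\nu)\in(0,+\infty)$ is the value such that $\theta(\zeta,\beta,\rho,\nu)=1$ for $\zeta>\zeta_c(\beta,\rho,\nu)$ and $\theta(\zeta,\beta,\rho,\nu)=0$ for $\zeta<\zeta_c(\beta,\rho,\nu)$ (it exists for $d\ge2$); $c_c(\beta,\rho,\nu):=\exp\{-\zeta_c(\beta,\rho,\nu)\}$. For $C>0$, $\alpha\ge0$: $\nu^+_{C,\alpha}(dE)=\frac{\alpha+1}{C^{\alpha+1}}E^\alpha\mathbf 1_{[0,C]}(E)\,dE$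 and $\nu_{C,\alpha}(dE)=\frac{\alpha+1}{2C^{\alpha+1}}|E|^\alpha\mathbf 1_{[-C,C]}(E)\,dE$. Classes: $\nu\in\mathcal V_\alpha^+$ (resp. $\nu\in\mathcal V_\alpha$) if $\nu$ is a probability measure on $\mathbb R$ and there are $\varepsilon_\nu,C_\nu>0$ with $\nu(B)=\nu^+_{C_\nu,\alpha}(B)$ (resp. $\nu(B)=\nu_{C_\nu,\alpha}(B)$) for every Borel $B\subset[-\varepsilon_\nu,\varepsilon_\nu]$; such constants are fixed (if $\nu=\nu^+_{C,\alpha}$ or $\nu=\nu_{C,\alpha}$ one takes $\varepsilon_\nu=C_\nu=C$). Critical intensities: $\lambda_c^+(\alpha)\in(0,+\infty)$ is the value such that $\mathcal G[1,1]$ under $\mathrm{PPP}[\lambda,\nu^+_{1,\alpha}]$ a.s. percolates if $\lambda>\lambda_c^+(\alpha)$ and a.s. does not percolate if $\lambda<\lambda_c^+(\alpha)$; $\lambda_c(\alpha)\in(0,+\infty)$ is defined in the same way with $\nu_{1,\alpha}$ in place of $\nu^+_{1,\alpha}$. Set $\lambda_c^*(\alpha):=\lambda_c^+(\alpha)$ if $\nu\in\mathcal V_\alpha^+$ and $\lambda_c^*(\alpha):=\lambda_c(\alpha)$ if $\nu\in\mathcal V_\alpha$. *)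

theory Defs
  imports "HOL-Probability.Probability"
begin

text \<open>The space \<open>\<real>\<^sup>d\<close> is an arbitrary type \<open>'a :: euclidean_space\<close>, with \<open>d = DIM('a)\<close>. Constants
  whose value depends on \<open>d\<close> but whose arguments do not determine it take an additional argument
  of type \<open>'a itself\<close>.\<close>

subsection \<open>Marked configurations\<close>

definition locally_finite_set :: "'a::metric_space set \<Rightarrow> bool" where
  "locally_finite_set S \<longleftrightarrow> (\<forall>K. bounded K \<longrightarrow> finite (S \<inter> K))"

text \<open>The set \<open>\<Omega>\<close>; the unmarked configuration of \<open>\<omega>\<close> is \<open>fst ` \<omega>\<close>.\<close>

definition configs :: "('a::euclidean_space \<times> real) set set" where
  "configs = {\<omega>. locally_finite_set (fst ` \<omega>) \<and>
                 (\<forall>x e e'. (x, e) \<in> \<omega> \<longrightarrow> (x, e') \<in> \<omega> \<longrightarrow> e = e')}"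

text \<open>\<open>\<Omega>\<close> carries the usual sigma-algebra generated by the counting variables. Only sets \<open>B\<close> over
  a bounded region are used, so that all the counts are finite.\<close>

definition config_space :: "('a::euclidean_space \<times> real) set measure" where
  "config_space = sigma configs
     {{\<omega> \<in> configs. card (\<omega> \<inter> B) = k} | B k. B \<in> sets borel \<and> bounded (fst ` B)}"

subsection \<open>Marked Poisson point processes\<close>

text \<open>Enumerations \<open>x\<^sub>0, x\<^sub>1, \<dots>\<close> without repetition of an infinite locally finite set of points. A
  homogeneous Poisson point process of positive intensity almost surely has infinitely many
  points, so it can be represented by such a random sequence.\<close>

definition point_seq_space :: "(nat \<Rightarrow> 'a::euclidean_space) measure" where
  "point_seq_space =
     restrict_space (\<Pi>\<^sub>M n\<in>UNIV. borel) {x. inj x \<and> locally_finite_set (range x)}"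

text \<open>\<open>\<mu>\<close> is the law of an enumeration of the points of a homogeneous Poisson point process with
  intensity \<open>\<rho>\<close>. The Poisson weights are written out because \<open>poisson_pmf\<close> is only specified for
  positive rates, while \<open>A\<close> may be a null set.\<close>

definition poisson_enumeration :: "real \<Rightarrow> (nat \<Rightarrow> 'a::euclidean_space) measure \<Rightarrow> bool" where
  "poisson_enumeration \<rho> \<mu> \<longleftrightarrow>
     prob_space \<mu> \<and> sets \<mu> = sets point_seq_space \<and>
     (\<forall>A k. A \<in> sets borel \<longrightarrow> bounded A \<longrightarrow>
        measure \<mu> {x \<in> space \<mu>. card (range x \<inter> A) = k} =
          exp (- (\<rho> * measure lborel A)) * (\<rho> * measure lborel A) ^ k / fact k) \<and>
     (\<forall>A :: nat \<Rightarrow> 'a set. disjoint_family A \<longrightarrow> (\<forall>i. A i \<in> sets borel \<and> bounded (A i)) \<longrightarrow>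
        prob_space.indep_vars \<mu> (\<lambda>_. count_space UNIV) (\<lambda>i x. card (range x \<inter> A i)) UNIV)"

text \<open>The law of \<open>{(x\<^sub>n, e\<^sub>n) | n}\<close>, where \<open>(x\<^sub>n)\<close> enumerates a Poisson point process and \<open>(e\<^sub>n)\<close> is an
  i.i.d. sequence with law \<open>\<nu>\<close> that is independent of \<open>(x\<^sub>n)\<close>. The law does not depend on the
  choice of the enumeration.\<close>

definition PPP :: "real \<Rightarrow> real measure \<Rightarrow> ('a::euclidean_space \<times> real) set measure" where
  "PPP \<rho> \<nu> = (THE M. \<exists>\<mu>. poisson_enumeration \<rho> \<mu> \<and>
     M = distr (\<mu> \<Otimes>\<^sub>M (\<Pi>\<^sub>M n\<in>UNIV. \<nu>)) config_space (\<lambda>(x, e). range (\<lambda>n. (x n, e n))))"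

subsection \<open>The graph\<close>

text \<open>The vertex set is \<open>fst ` \<omega>\<close>. Edges are given as a symmetric set of ordered pairs.\<close>

definition graph_edges ::
    "real \<Rightarrow> real \<Rightarrow> ('a::euclidean_space \<times> real) set \<Rightarrow> ('a \<times> 'a) set" where
  "graph_edges \<zeta> \<beta> \<omega> = {(x, y). x \<noteq> y \<and> (\<exists>e f. (x, e) \<in> \<omega> \<and> (y, f) \<in> \<omega> \<and>
     norm (x - y) + \<beta> * (\<bar>e\<bar> + \<bar>f\<bar> + \<bar>e - f\<bar>) \<le> \<zeta>)}"

definition percolates :: "real \<Rightarrow> real \<Rightarrow> ('a::euclidean_space \<times> real) set \<Rightarrow> bool" where
  "percolates \<zeta> \<beta> \<omega> \<longleftrightarrow>
     (\<exists>x \<in> fst ` \<omega>. \<not> bounded {y. (x, y) \<in> (graph_edges \<zeta> \<beta> \<omega>)\<^sup>*})"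

subsection \<open>Critical threshold and critical conductance\<close>

definition theta :: "'a::euclidean_space itself \<Rightarrow> real \<Rightarrow> real \<Rightarrow> real \<Rightarrow> real measure \<Rightarrow> real" where
  "theta _ \<zeta> \<beta> \<rho> \<nu> = measure (PPP \<rho> \<nu> :: ('a \<times> real) set measure)
     {\<omega> \<in> space (PPP \<rho> \<nu>). percolates \<zeta> \<beta> \<omega>}"

definition zeta_c :: "'a::euclidean_space itself \<Rightarrow> real \<Rightarrow> real \<Rightarrow> real measure \<Rightarrow> real" where
  "zeta_c a \<beta> \<rho> \<nu> = (THE z. 0 < z \<and> (\<forall>\<zeta>. z < \<zeta> \<longrightarrow> theta a \<zeta> \<beta> \<rho> \<nu> = 1) \<and>
     (\<forall>\<zeta>. 0 < \<zeta> \<and> \<zeta> < z \<longrightarrow> theta a \<zeta> \<beta> \<rho> \<nu> = 0))"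

definition c_c :: "'a::euclidean_space itself \<Rightarrow> real \<Rightarrow> real \<Rightarrow> real measure \<Rightarrow> real" where
  "c_c a \<beta> \<rho> \<nu> = exp (- zeta_c a \<beta> \<rho> \<nu>)"

subsection \<open>Mark distributions\<close>

text \<open>For \<open>\<alpha> = 0\<close> the convention \<open>0 powr 0 = 0\<close> changes the densities only at the point \<open>0\<close>, hence
  does not affect the measures.\<close>

definition nu_plus :: "real \<Rightarrow> real \<Rightarrow> real measure" where
  "nu_plus C \<alpha> = density lborel
     (\<lambda>E. ennreal ((\<alpha> + 1) / C powr (\<alpha> + 1) * E powr \<alpha> * indicator {0..C} E))"

definition nu_sym :: "real \<Rightarrow> real \<Rightarrow> real measure" where
  "nu_sym C \<alpha> = density lborel
     (\<lambda>E. ennreal ((\<alpha> + 1) / (2 * C powr (\<alpha> + 1)) * \<bar>E\<bar> powr \<alpha> * indicator {-C..C} E))"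

text \<open>Membership in the classes \<open>\<V>\<^sub>\<alpha>\<^sup>+\<close> and \<open>\<V>\<^sub>\<alpha>\<close>, with explicit constants
  \<open>\<epsilon> = \<epsilon>\<^sub>\<nu>\<close> and \<open>C = C\<^sub>\<nu>\<close>. The locale predicate \<open>real_distribution\<close> says that \<open>\<nu>\<close> is a Borel
  probability measure on the real line.\<close>

definition V_plus_with :: "real \<Rightarrow> real measure \<Rightarrow> real \<Rightarrow> real \<Rightarrow> bool" where
  "V_plus_with \<alpha> \<nu> \<epsilon> C \<longleftrightarrow> real_distribution \<nu> \<and> 0 < \<epsilon> \<and> 0 < C \<and>
     (\<forall>B \<in> sets borel. B \<subseteq> {-\<epsilon>..\<epsilon>} \<longrightarrow> emeasure \<nu> B = emeasure (nu_plus C \<alpha>) B)"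

definition V_sym_with :: "real \<Rightarrow> real measure \<Rightarrow> real \<Rightarrow> real \<Rightarrow> bool" where
  "V_sym_with \<alpha> \<nu> \<epsilon> C \<longleftrightarrow> real_distribution \<nu> \<and> 0 < \<epsilon> \<and> 0 < C \<and>
     (\<forall>B \<in> sets borel. B \<subseteq> {-\<epsilon>..\<epsilon>} \<longrightarrow> emeasure \<nu> B = emeasure (nu_sym C \<alpha>) B)"

definition V_plus :: "real \<Rightarrow> real measure set" where
  "V_plus \<alpha> = {\<nu>. \<exists>\<epsilon> C. V_plus_with \<alpha> \<nu> \<epsilon> C}"

definition V_sym :: "real \<Rightarrow> real measure set" where
  "V_sym \<alpha> = {\<nu>. \<exists>\<epsilon> C. V_sym_with \<alpha> \<nu> \<epsilon> C}"

subsection \<open>Critical intensities\<close>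

definition critical_intensity :: "'a::euclidean_space itself \<Rightarrow> real measure \<Rightarrow> real" where
  "critical_intensity _ \<nu> = (THE l. 0 < l \<and>
     (\<forall>r. l < r \<longrightarrow> (AE \<omega> in (PPP r \<nu> :: ('a \<times> real) set measure). percolates 1 1 \<omega>)) \<and>
     (\<forall>r. 0 < r \<and> r < l \<longrightarrow>
        (AE \<omega> in (PPP r \<nu> :: ('a \<times> real) set measure). \<not> percolates 1 1 \<omega>)))"

definition lambda_c_plus :: "'a::euclidean_space itself \<Rightarrow> real \<Rightarrow> real" where
  "lambda_c_plus a \<alpha> = critical_intensity a (nu_plus 1 \<alpha>)"

definition lambda_c :: "'a::euclidean_space itself \<Rightarrow> real \<Rightarrow> real" where
  "lambda_c a \<alpha> = critical_intensity a (nu_sym 1 \<alpha>)"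

text \<open>The classes \<open>\<V>\<^sub>\<alpha>\<^sup>+\<close> and \<open>\<V>\<^sub>\<alpha>\<close> are disjoint, since measures in the former have no
  mass on small negative intervals. Outside their union the value is irrelevant.\<close>

definition lambda_c_star :: "'a::euclidean_space itself \<Rightarrow> real \<Rightarrow> real measure \<Rightarrow> real" where
  "lambda_c_star a \<alpha> \<nu> = (if \<nu> \<in> V_plus \<alpha> then lambda_c_plus a \<alpha> else lambda_c a \<alpha>)"

end

theory Submission
  imports Defs
begin

text \<open>An edge of the graph with threshold \<open>\<zeta>\<close> only joins points whose marks are at most \<open>\<zeta> / \<beta>\<close> in
  absolute value. As long as \<open>\<zeta> / \<beta>\<close> is below \<open>C\<close> and \<open>\<epsilon>\<close>, discarding the other points, dividing positions
  by \<open>\<zeta>\<close> and marks by \<open>\<zeta> / \<beta>\<close> turns the process into a Poisson process of intensity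
  \<open>\<rho> * \<zeta> ^ d * (\<zeta> / (\<beta> * C)) powr (\<alpha> + 1)\<close> with the power-law marks of \<open>C = 1\<close>, and the graph into the one
  with \<open>\<zeta> = \<beta> = 1\<close>. The critical threshold is where this intensity equals the critical one. The same
  identity makes percolation monotone in the intensity, because it is monotone in the threshold.

  Laws of marked processes are compared through the probabilities of avoiding a region, which determine
  them (Renyi). The critical intensity is well defined by the zero-one law, a path-counting bound at low
  intensity, and a hierarchical block construction at high intensity.\<close>

subsection \<open>Marked configurations and avoidance probabilities\<close>

text \<open>\<open>PPP\<close>, \<open>critical_intensity\<close> and \<open>zeta_c\<close> are
  definite descriptions, so each says nothing until existence and uniqueness are proved. For
  \<open>PPP\<close> this means that all enumerations lead to one law and that an enumeration
  exists; a predicate on avoidance probabilities then takes the place of the description. Avoidance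
  suits the rescaling: discarding points and dividing coordinates merely pulls a region back to
  another region, so the image law is read off from the measure of the preimage. In the effective
  intensity the factor \<open>\<zeta> ^ d\<close> comes from volume and the power
  \<open>\<alpha> + 1\<close> from the mass of the marks that survive; solving an equation of degree
  \<open>\<alpha> + 1 + d\<close> in \<open>\<zeta>\<close> produces the exponents of the theorem.
  The hypothesis d \<ge> 2 enters through the high-intensity argument, whose blocks lie in a
  coordinate plane. Percolation must also be shown measurable over a sigma-algebra that only knows
  counts, without a measurable enumeration of the points at hand.\<close>

lemma card_ge_measurable:
  fixes T :: "'c \<Rightarrow> 'b::{second_countable_topology,t1_space} set"
  assumes fin: "\<And>w. w \<in> space M \<Longrightarrow> finite (T w \<inter> B)"
    and void: "\<And>B'. B' \<in> sets borel \<Longrightarrow> B' \<subseteq> B \<Longrightarrow> {w \<in> space M. T w \<inter> B' = {}} \<in> sets M"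
    and "B \<in> sets borel"
  shows "{w \<in> space M. k \<le> card (T w \<inter> B)} \<in> sets M"
  using assms
proof (induction k arbitrary: B)
  case 0
  then show ?case by simp
next
  case (Suc k)
  obtain D :: "'b set set" where D: "countable D" "topological_basis D"
    using ex_countable_basis by blast
  have Db: "d \<in> sets borel" if "d \<in> D" for d
    using D(2) that by (auto simp: topological_basis_open)
  \<comment> \<open>Splitting off one point by a basic open set leaves at least k points in the
    rest. The basis is countable, so counts reduce to avoidance; avoidance is assumed for all Borel
    subsets of \<open>B\<close> so that the induction can pass to \<open>B - d\<close>.\<close>
  have eq: "{w \<in> space M. Suc k \<le> card (T w \<inter> B)} =
      (\<Union>d\<in>D. (space M - {w \<in> space M. T w \<inter> (B \<inter> d) = {}}) \<inter> {w \<in> space M. k \<le> card (T w \<inter> (B - d))})"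
    (is "?L = ?R")
  proof (intro set_eqI iffI)
    fix w assume w: "w \<in> ?L"
    then have "w \<in> space M" and c: "Suc k \<le> card (T w \<inter> B)" by auto
    have f: "finite (T w \<inter> B)" using Suc.prems(1) \<open>w \<in> space M\<close> by blast
    from c have "T w \<inter> B \<noteq> {}" by force
    then obtain p where p: "p \<in> T w \<inter> B" by blast
    \<comment> \<open>\<open>V\<close> separates \<open>p\<close> from the finitely many other
      points in \<open>B\<close>, so a basic set inside \<open>V\<close> removes exactly
      \<open>p\<close>.\<close>
    define V where "V = - (T w \<inter> B - {p})"
    have "open V" unfolding V_def using f by (intro open_Compl finite_imp_closed) auto
    moreover have "p \<in> V" by (auto simp: V_def)
    ultimately obtain d where d: "d \<in> D" "p \<in> d" "d \<subseteq> V"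
      using D(2) by (meson topological_basisE)
    have "T w \<inter> (B - d) = T w \<inter> B - {p}" using d p by (auto simp: V_def)
    then have "k \<le> card (T w \<inter> (B - d))" using c f p by (simp add: card_Diff_singleton)
    moreover have "T w \<inter> (B \<inter> d) \<noteq> {}" using p d by auto
    ultimately show "w \<in> ?R" using d \<open>w \<in> space M\<close> by auto
  next
    fix w assume "w \<in> ?R"
    then obtain d where d: "d \<in> D" "w \<in> space M" "T w \<inter> (B \<inter> d) \<noteq> {}" "k \<le> card (T w \<inter> (B - d))" by auto
    have f: "finite (T w \<inter> B)" using Suc.prems(1) d by blast
    have "T w \<inter> (B - d) \<subset> T w \<inter> B" using d by auto
    then have "card (T w \<inter> (B - d)) < card (T w \<inter> B)" using f by (simp add: psubset_card_mono)
    then show "w \<in> ?L" using d by auto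
  qed
  have "{w \<in> space M. k \<le> card (T w \<inter> (B - d))} \<in> sets M" if "d \<in> D" for d
  proof (rule Suc.IH)
    show "finite (T w \<inter> (B - d))" if "w \<in> space M" for w
      using Suc.prems(1)[OF that] by (rule rev_finite_subset) auto
    show "{w \<in> space M. T w \<inter> B' = {}} \<in> sets M" if "B' \<in> sets borel" "B' \<subseteq> B - d" for B'
      using Suc.prems(2) that by blast
    show "B - d \<in> sets borel" using Suc.prems(3) Db that by blast
  qed
  moreover have "{w \<in> space M. T w \<inter> (B \<inter> d) = {}} \<in> sets M" if "d \<in> D" for d
    using Suc.prems Db[OF that] by auto
  ultimately show ?case unfolding eq using D(1)
    by (intro sets.countable_UN') auto
qed

lemma card_eq_measurable:
  fixes T :: "'c \<Rightarrow> 'b::{second_countable_topology,t1_space} set"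
  assumes "\<And>w. w \<in> space M \<Longrightarrow> finite (T w \<inter> B)"
    and "\<And>B'. B' \<in> sets borel \<Longrightarrow> B' \<subseteq> B \<Longrightarrow> {w \<in> space M. T w \<inter> B' = {}} \<in> sets M"
    and "B \<in> sets borel"
  shows "{w \<in> space M. card (T w \<inter> B) = k} \<in> sets M"
proof -
  have "{w \<in> space M. card (T w \<inter> B) = k} =
    {w \<in> space M. k \<le> card (T w \<inter> B)} - {w \<in> space M. Suc k \<le> card (T w \<inter> B)}" by auto
  then show ?thesis using card_ge_measurable[OF assms] by auto
qed

text \<open>Boundedness concerns positions only; marks range over the whole line, as in the
  generators of \<open>config_space\<close>.\<close>

definition bounded_region :: "('a::euclidean_space \<times> real) set \<Rightarrow> bool" where
  "bounded_region B \<longleftrightarrow> B \<in> sets borel \<and> bounded (fst ` B)"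

definition avoid :: "('a::euclidean_space \<times> real) set \<Rightarrow> ('a \<times> real) set set" where
  "avoid B = {\<omega> \<in> configs. \<omega> \<inter> B = {}}"

lemma bounded_region_empty [simp]: "bounded_region {}"
  by (simp add: bounded_region_def)

lemma bounded_region_Un: "bounded_region A \<Longrightarrow> bounded_region B \<Longrightarrow> bounded_region (A \<union> B)"
  by (auto simp: bounded_region_def image_Un)

lemma bounded_region_UN:
  "finite I \<Longrightarrow> (\<And>i. i \<in> I \<Longrightarrow> bounded_region (B i)) \<Longrightarrow> bounded_region (\<Union>i\<in>I. B i)"
  by (induction I rule: finite_induct) (auto intro!: bounded_region_Un)

lemma bounded_region_subset:
  "bounded_region B \<Longrightarrow> A \<subseteq> B \<Longrightarrow> A \<in> sets borel \<Longrightarrow> bounded_region A"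
  unfolding bounded_region_def by (meson bounded_subset image_mono)

lemma borel_Times_sets:
  fixes A :: "'a::euclidean_space set" and J :: "real set"
  shows "A \<in> sets borel \<Longrightarrow> J \<in> sets borel \<Longrightarrow> A \<times> J \<in> sets borel"
  by (metis borel_prod pair_measureI)

lemma bounded_region_Times:
  assumes "A \<in> sets borel" "bounded A" "J \<in> sets borel"
  shows "bounded_region (A \<times> J)"
proof -
  have "fst ` (A \<times> J) \<subseteq> A" by auto
  then show ?thesis
    using assms bounded_subset unfolding bounded_region_def
    by (auto simp: borel_Times_sets)
qed

lemma config_finite:
  assumes "\<omega> \<in> configs" "bounded (fst ` B)"
  shows "finite (\<omega> \<inter> B)"
proof -
  have "finite (fst ` \<omega> \<inter> fst ` B)"
    using assms by (auto simp: configs_def locally_finite_set_def)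
  then have "finite (fst ` (\<omega> \<inter> B))" by (rule rev_finite_subset) auto
  moreover have "inj_on fst (\<omega> \<inter> B)"
    using assms(1) by (auto simp: configs_def inj_on_def)
  ultimately show ?thesis by (simp add: finite_image_iff)
qed

lemma space_config_space [simp]: "space config_space = configs"
  unfolding config_space_def by (intro space_measure_of) auto

lemma avoid_sets [measurable]: "bounded_region B \<Longrightarrow> avoid B \<in> sets config_space"
proof -
  assume B: "bounded_region B"
  have "avoid B = {\<omega> \<in> configs. card (\<omega> \<inter> B) = 0}"
    using B config_finite by (fastforce simp: avoid_def bounded_region_def)
  also have "\<dots> \<in> sets config_space"
    unfolding config_space_def using B
    by (subst sets_measure_of) (auto simp: bounded_region_def)
  finally show ?thesis .
qed

lemma avoid_in_configs: "avoid B \<subseteq> configs"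
  by (auto simp: avoid_def)

lemma avoid_Int: "avoid A \<inter> avoid B = avoid (A \<union> B)"
  by (auto simp: avoid_def)

lemma avoid_UN: "I \<noteq> {} \<Longrightarrow> (\<Inter>i\<in>I. avoid (B i)) = avoid (\<Union>i\<in>I. B i)"
  by (auto simp: avoid_def)

text \<open>Counts are measurable over the avoidance events by \<open>card_eq_measurable\<close>, so
  these generate the same sigma-algebra. Unlike the counting events they are closed under
  intersection.\<close>

lemma sets_config_space:
  "sets (config_space :: ('a::euclidean_space \<times> real) set measure) =
     sigma_sets configs {avoid B | B. bounded_region B}"
proof
  let ?G = "{avoid B | B. bounded_region (B :: ('a \<times> real) set)}"
  let ?S = "sigma configs ?G"
  have sub: "?G \<subseteq> Pow configs" by (auto simp: avoid_def)
  have sp: "space ?S = configs" using sub by (rule space_measure_of)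
  have st: "sets ?S = sigma_sets configs ?G" using sub by (rule sets_measure_of)
  have "{\<omega> \<in> configs. card (\<omega> \<inter> B) = k} \<in> sets ?S"
    if B: "B \<in> sets borel" "bounded (fst ` B)" for B k
  proof -
    have "{\<omega> \<in> space ?S. card (\<omega> \<inter> B) = k} \<in> sets ?S"
    proof (rule card_eq_measurable[where T="\<lambda>w. w"])
      show "finite (w \<inter> B)" if "w \<in> space ?S" for w
        using config_finite B(2) that by (simp add: sp)
      show "{w \<in> space ?S. w \<inter> B' = {}} \<in> sets ?S" if "B' \<in> sets borel" "B' \<subseteq> B" for B'
      proof -
        have "bounded_region B'"
          using bounded_region_subset[of B B'] B that unfolding bounded_region_def by auto
        then have "avoid B' \<in> sigma_sets configs ?G" by (intro sigma_sets.Basic) auto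
        then show ?thesis unfolding sp st by (simp add: avoid_def[of B'])
      qed
    qed (use B in auto)
    then show ?thesis by (simp add: sp)
  qed
  then show "sets (config_space :: ('a \<times> real) set measure) \<subseteq> sigma_sets configs ?G"
    unfolding config_space_def st
    by (subst sets_measure_of; force intro!: sigma_sets_mono simp: st)
  show "sigma_sets configs ?G \<subseteq> sets (config_space :: ('a \<times> real) set measure)"
    by (rule sets.sigma_sets_subset[where M="config_space :: ('a \<times> real) set measure",
          unfolded space_config_space]) (auto intro: avoid_sets)
qed

lemma measurable_config_spaceI:
  assumes "\<And>w. w \<in> space M \<Longrightarrow> T w \<in> configs"
    and "\<And>B. bounded_region B \<Longrightarrow> {w \<in> space M. T w \<inter> B = {}} \<in> sets M"
  shows "T \<in> measurable M (config_space :: ('a::euclidean_space \<times> real) set measure)"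
proof (rule measurable_sigma_sets[OF sets_config_space])
  show "{avoid B |B. bounded_region (B :: ('a \<times> real) set)} \<subseteq> Pow configs" by (auto simp: avoid_def)
  show "T \<in> space M \<rightarrow> configs" using assms(1) by auto
  fix y assume "y \<in> {avoid B |B. bounded_region (B :: ('a \<times> real) set)}"
  then obtain B where B: "bounded_region B" "y = avoid B" by auto
  have "T -` y \<inter> space M = {w \<in> space M. T w \<inter> B = {}}"
    using assms(1) B by (auto simp: avoid_def)
  then show "T -` y \<inter> space M \<in> sets M" using assms(2) B by simp
qed

text \<open>Renyi's characterisation: the avoidance function fixes the law of the marked process,
  and independence over disjoint regions follows from it.\<close>

definition poisson_law :: "real \<Rightarrow> real measure \<Rightarrow> ('a::euclidean_space \<times> real) set measure \<Rightarrow> bool" where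
  "poisson_law \<rho> \<nu> M \<longleftrightarrow> prob_space M \<and> sets M = sets config_space \<and>
     (\<forall>B. bounded_region B \<longrightarrow> measure M (avoid B) = exp (- (\<rho> * measure (lborel \<Otimes>\<^sub>M \<nu>) B)))"

lemma poisson_law_prob_space: "poisson_law \<rho> \<nu> M \<Longrightarrow> prob_space M"
  and poisson_law_sets: "poisson_law \<rho> \<nu> M \<Longrightarrow> sets M = sets config_space"
  and poisson_law_avoid: "poisson_law \<rho> \<nu> M \<Longrightarrow> bounded_region B \<Longrightarrow>
     measure M (avoid B) = exp (- (\<rho> * measure (lborel \<Otimes>\<^sub>M \<nu>) B))"
  by (auto simp: poisson_law_def)

lemma poisson_law_space: "poisson_law \<rho> \<nu> M \<Longrightarrow> space M = configs"
  by (metis poisson_law_sets sets_eq_imp_space_eq space_config_space)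

text \<open>Avoiding \<open>A\<close> and \<open>B\<close> is avoiding \<open>A \<union> B\<close>,
  so avoidance events form a pi-system and equality on them extends to the generated
  sigma-algebra.\<close>

lemma poisson_law_unique:
  assumes "poisson_law \<rho> \<nu> M" "poisson_law \<rho> \<nu> M'"
  shows "M = (M' :: ('a::euclidean_space \<times> real) set measure)"
proof (rule measure_eqI_generator_eq[where \<Omega>=configs and A="\<lambda>_. configs"])
  interpret M: prob_space M using assms by (auto simp: poisson_law_def)
  interpret M': prob_space M' using assms by (auto simp: poisson_law_def)
  let ?G = "{avoid B | B. bounded_region (B :: ('a \<times> real) set)}"
  show "Int_stable ?G"
    unfolding Int_stable_def by (auto simp: avoid_Int) (metis bounded_region_Un)
  show "?G \<subseteq> Pow configs" by (auto simp: avoid_def)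
  show "emeasure M X = emeasure M' X" if "X \<in> ?G" for X
    using that assms by (auto simp: M.emeasure_eq_measure M'.emeasure_eq_measure poisson_law_def)
  show "sets M = sigma_sets configs ?G" "sets M' = sigma_sets configs ?G"
    using assms sets_config_space by (auto simp: poisson_law_def)
  have "configs = avoid ({} :: ('a \<times> real) set)" by (auto simp: avoid_def)
  then show "range (\<lambda>_. configs) \<subseteq> ?G" by (auto intro!: exI[of _ "{}"])
  show "emeasure M configs \<noteq> \<infinity>" by (simp add: M.emeasure_eq_measure)
qed auto

lemma bounded_region_finite_measure:
  assumes "real_distribution \<nu>" "bounded_region (B :: ('a::euclidean_space \<times> real) set)"
  shows "B \<in> fmeasurable (lborel \<Otimes>\<^sub>M \<nu>)"
proof -
  interpret real_distribution \<nu> by fact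
  obtain r where r: "fst ` B \<subseteq> ball 0 r"
    using assms(2) bounded_subset_ballD unfolding bounded_region_def by blast
  have "sets (lborel \<Otimes>\<^sub>M \<nu>) = sets (borel :: ('a \<times> real) measure)"
    by (metis borel_prod events_eq_borel sets_lborel sets_pair_measure_cong)
  then have *: "B \<in> sets (lborel \<Otimes>\<^sub>M \<nu>)" using assms(2) by (simp add: bounded_region_def)
  have "emeasure (lborel \<Otimes>\<^sub>M \<nu>) B \<le> emeasure (lborel \<Otimes>\<^sub>M \<nu>) (ball (0::'a) r \<times> UNIV)"
  proof (rule emeasure_mono)
    show "B \<subseteq> ball 0 r \<times> UNIV" using r by (auto simp: image_subset_iff)
  qed (auto simp: events_eq_borel)
  also have "\<dots> = emeasure lborel (ball (0::'a) r) * emeasure \<nu> UNIV"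
    by (intro emeasure_pair_measure_Times) (auto simp: events_eq_borel)
  also have "\<dots> < \<infinity>"
    using emeasure_lborel_ball_finite[of "0::'a" r] emeasure_space_1
    by (simp add: ennreal_mult_less_top)
  finally show ?thesis using * by (intro fmeasurableI) auto
qed

text \<open>Independence of disjoint regions is the exponential law: the measure in the exponent is
  additive.\<close>

lemma poisson_law_avoid_Un:
  assumes P: "poisson_law \<rho> \<nu> M" "real_distribution \<nu>"
    and "bounded_region A" "bounded_region B" "A \<inter> B = {}"
  shows "measure M (avoid (A \<union> B)) = measure M (avoid A) * measure M (avoid B)"
proof -
  have "measure (lborel \<Otimes>\<^sub>M \<nu>) (A \<union> B) = measure (lborel \<Otimes>\<^sub>M \<nu>) A + measure (lborel \<Otimes>\<^sub>M \<nu>) B"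
    using bounded_region_finite_measure[OF P(2)] assms(3-5)
    by (intro measure_Un2[THEN trans]) (auto simp: Diff_triv Int_commute intro!: arg_cong2[where f=measure])
  then show ?thesis
    using assms by (simp add: poisson_law_avoid bounded_region_Un distrib_left flip: exp_add)
qed

lemma poisson_law_avoid_UN:
  assumes P: "poisson_law \<rho> \<nu> M" "real_distribution \<nu>"
    and "finite I" "\<And>i. i \<in> I \<Longrightarrow> bounded_region (B i)" "disjoint_family_on B I"
  shows "measure M (avoid (\<Union>i\<in>I. B i)) = (\<Prod>i\<in>I. measure M (avoid (B i)))"
  using assms(3-5)
proof (induction I rule: finite_induct)
  case empty
  then show ?case using poisson_law_avoid[OF P(1) bounded_region_empty] by simp
next
  case (insert i I)
  have "B i \<inter> (\<Union>i\<in>I. B i) = {}" using insert.prems(2) insert.hyps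
    by (force simp: disjoint_family_on_def)
  moreover have "disjoint_family_on B I" using insert.prems(2)
    by (auto simp: disjoint_family_on_def)
  ultimately show ?case
    using insert by (simp add: poisson_law_avoid_Un[OF P] bounded_region_UN)
qed

text \<open>The avoided region \<open>A\<close> is carried along for the sake of the induction; the
  application to occupied cells takes it empty.\<close>

lemma poisson_law_occupied:
  assumes P: "poisson_law \<rho> \<nu> M" "real_distribution \<nu>"
    and "finite I" "\<And>i. i \<in> I \<Longrightarrow> bounded_region (B i)" "disjoint_family_on B I"
    and "bounded_region A" "\<And>i. i \<in> I \<Longrightarrow> A \<inter> B i = {}"
  shows "measure M {\<omega> \<in> avoid A. \<forall>i\<in>I. \<omega> \<inter> B i \<noteq> {}} =
     measure M (avoid A) * (\<Prod>i\<in>I. 1 - measure M (avoid (B i)))"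
  using assms(3-)
proof (induction I arbitrary: A rule: finite_induct)
  case empty
  then show ?case by simp
next
  case (insert i I)
  interpret prob_space M using P(1) by (rule poisson_law_prob_space)
  let ?E = "\<lambda>A I. {\<omega> \<in> avoid A. \<forall>i\<in>I. \<omega> \<inter> B i \<noteq> {}}"
  have ms: "?E A I \<in> sets M" if "bounded_region A" "I \<subseteq> insert i J" "finite J"
      "\<And>j. j \<in> insert i J \<Longrightarrow> bounded_region (B j)" for A I J
  proof -
    have "finite I" using that finite_subset by auto
    moreover have "?E A I = avoid A - (\<Union>i\<in>I. avoid (B i))" by (auto simp: avoid_def)
    moreover have "avoid A \<in> sets M" "\<And>j. j \<in> I \<Longrightarrow> avoid (B j) \<in> sets M"
      using that poisson_law_sets[OF P(1)] avoid_sets by (auto simp: subset_iff)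
    ultimately show ?thesis by (simp only:) (intro sets.Diff sets.finite_UN)
  qed
  have dI: "disjoint_family_on B I" using insert.prems(2) by (auto simp: disjoint_family_on_def)
  have di: "B i \<inter> B j = {}" if "j \<in> I" for j
    using insert.prems(2) insert.hyps that by (auto simp: disjoint_family_on_def)
  \<comment> \<open>One step of inclusion-exclusion: failing to occupy \<open>B i\<close> means
    avoiding it, which enlarges \<open>A\<close>.\<close>
  have "?E A (insert i I) = ?E A I - ?E (A \<union> B i) I" by (auto simp: avoid_def)
  then have "measure M (?E A (insert i I)) = measure M (?E A I) - measure M (?E (A \<union> B i) I)"
    using insert.prems insert.hyps bounded_region_Un[of A "B i"]
    by (simp add: finite_measure_Diff ms[of _ _ I] subset_insertI) 
       (subst finite_measure_Diff; (intro ms[of _ _ I])?; auto simp: avoid_def)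
  also have "measure M (?E A I) = measure M (avoid A) * (\<Prod>i\<in>I. 1 - measure M (avoid (B i)))"
    using insert dI by auto
  also have "measure M (?E (A \<union> B i) I) = measure M (avoid (A \<union> B i)) * (\<Prod>i\<in>I. 1 - measure M (avoid (B i)))"
  proof (rule insert.IH)
    show "(A \<union> B i) \<inter> B j = {}" if "j \<in> I" for j
      using insert.prems(4)[of j] di that by auto
  qed (use insert.prems dI in \<open>auto intro!: bounded_region_Un\<close>)
  also have "measure M (avoid (A \<union> B i)) = measure M (avoid A) * measure M (avoid (B i))"
    using insert.prems by (intro poisson_law_avoid_Un[OF P]) auto
  finally show ?case using insert.hyps by (simp add: algebra_simps)
qed

subsection \<open>Independent marking\<close>

lemma (in prob_space) nn_integral_nat_rv:
  fixes N :: "'a \<Rightarrow> nat" and f :: "nat \<Rightarrow> ennreal"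
  assumes [measurable]: "N \<in> measurable M (count_space UNIV)"
  shows "(\<integral>\<^sup>+x. f (N x) \<partial>M) = (\<Sum>k. f k * emeasure M {x \<in> space M. N x = k})"
proof -
  have "(\<integral>\<^sup>+x. f (N x) \<partial>M) = (\<integral>\<^sup>+x. (\<Sum>k. f k * indicator {x \<in> space M. N x = k} x) \<partial>M)"
  proof (rule nn_integral_cong)
    fix x assume "x \<in> space M"
    have "(\<Sum>k. f k * indicator {x \<in> space M. N x = k} x) =
        (\<Sum>k\<in>{N x}. f k * indicator {x \<in> space M. N x = k} x)"
      by (rule suminf_finite) (auto simp: indicator_def)
    then show "f (N x) = (\<Sum>k. f k * indicator {x \<in> space M. N x = k} x)"
      using \<open>x \<in> space M\<close> by simp
  qed
  also have "\<dots> = (\<Sum>k. \<integral>\<^sup>+x. f k * indicator {x \<in> space M. N x = k} x \<partial>M)"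
    by (rule nn_integral_suminf) simp
  also have "\<dots> = (\<Sum>k. f k * emeasure M {x \<in> space M. N x = k})"
    by (intro suminf_cong nn_integral_cmult_indicator) simp
  finally show ?thesis .
qed

lemma poisson_pgf:
  fixes c r :: real
  assumes "0 \<le> c" "0 \<le> r"
  shows "(\<Sum>k. ennreal c ^ k * ennreal (exp (- r) * r ^ k / fact k)) = ennreal (exp (- (r * (1 - c))))"
proof -
  have "(\<lambda>k. (c * r) ^ k /\<^sub>R fact k) sums exp (c * r)" by (rule exp_converges)
  then have "(\<lambda>k. exp (- r) * ((c * r) ^ k /\<^sub>R fact k)) sums (exp (- r) * exp (c * r))"
    by (rule sums_mult)
  also have "exp (- r) * exp (c * r) = exp (- (r * (1 - c)))"
    by (simp add: algebra_simps flip: exp_add)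
  also have "(\<lambda>k. exp (- r) * ((c * r) ^ k /\<^sub>R fact k)) = (\<lambda>k. c ^ k * (exp (- r) * r ^ k / fact k))"
    by (auto simp: power_mult_distrib field_simps)
  finally have s: "(\<lambda>k. c ^ k * (exp (- r) * r ^ k / fact k)) sums exp (- (r * (1 - c)))" .
  have "(\<Sum>k. ennreal c ^ k * ennreal (exp (- r) * r ^ k / fact k)) =
      (\<Sum>k. ennreal (c ^ k * (exp (- r) * r ^ k / fact k)))"
    using assms by (intro suminf_cong) (simp add: ennreal_power flip: ennreal_mult)
  also have "\<dots> = ennreal (exp (- (r * (1 - c))))"
    using s assms by (intro suminf_ennreal_eq) auto
  finally show ?thesis .
qed

lemma locally_finite_index:
  assumes "inj x" "locally_finite_set (range x)" "bounded K"
  shows "finite {n. x n \<in> K}" "card {n. x n \<in> A \<inter> K} = card (range x \<inter> (A \<inter> K))"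
proof -
  have "x ` {n. x n \<in> K} = range x \<inter> K" for K by auto
  moreover have "inj_on x {n. x n \<in> K}" for K using assms(1) by (rule inj_on_subset) auto
  moreover have "finite (range x \<inter> K)" using assms by (auto simp: locally_finite_set_def)
  ultimately show "finite {n. x n \<in> K}" "card {n. x n \<in> A \<inter> K} = card (range x \<inter> (A \<inter> K))"
    by (metis finite_imageD, metis card_image)
qed

lemma point_seq_space_space:
  "space point_seq_space = {x. inj x \<and> locally_finite_set (range x)}"
  by (auto simp: point_seq_space_def space_restrict_space space_PiM)

lemma point_seq_component: "(\<lambda>x. x n) \<in> measurable point_seq_space borel"
  unfolding point_seq_space_def by (intro measurable_restrict_space1) simp

lemma poisson_enumeration_space:
  "poisson_enumeration \<rho> \<mu> \<Longrightarrow> space \<mu> = {x. inj x \<and> locally_finite_set (range x)}"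
  unfolding poisson_enumeration_def by (metis sets_eq_imp_space_eq point_seq_space_space)

lemma poisson_enumeration_measurable:
  "poisson_enumeration \<rho> \<mu> \<Longrightarrow> measurable \<mu> N = measurable point_seq_space N"
  by (rule measurable_cong_sets) (simp_all add: poisson_enumeration_def)

lemma poisson_enumeration_component:
  "poisson_enumeration \<rho> \<mu> \<Longrightarrow> (\<lambda>x. x n) \<in> measurable \<mu> borel"
  using point_seq_component poisson_enumeration_measurable by blast

lemma nat_measurable_count:
  fixes f :: "'c \<Rightarrow> nat"
  assumes "\<And>k. {w \<in> space M. f w = k} \<in> sets M"
  shows "f \<in> measurable M (count_space UNIV)"
  using assms by (subst measurable_count_space_eq2_countable) (auto simp: vimage_def Int_def conj_commute)

lemma point_seq_count_measurable:
  assumes "A \<in> sets borel" "bounded A"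
  shows "(\<lambda>x. card (range x \<inter> A)) \<in> measurable point_seq_space (count_space UNIV)"
proof (rule nat_measurable_count, rule card_eq_measurable)
  show "finite (range w \<inter> A)" if "w \<in> space point_seq_space" for w
    using that assms by (auto simp: point_seq_space_space locally_finite_set_def)
  fix B :: "'a set" assume [measurable]: "B \<in> sets borel"
  have [measurable]: "Measurable.pred point_seq_space (\<lambda>w. w n \<in> B)" for n
    by (rule measurable_compose[OF point_seq_component]) simp
  have "{w \<in> space point_seq_space. range w \<inter> B = {}} = {w \<in> space point_seq_space. \<forall>n. w n \<notin> B}"
    by auto
  also have "\<dots> \<in> sets point_seq_space" by measurable
  finally show "{w \<in> space point_seq_space. range w \<inter> B = {}} \<in> sets point_seq_space" .
qed fact

text \<open>The generating functional for weights that are constant on disjoint sets: the counts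
  there are independent Poisson variables, so the expectation factors into ordinary generating
  functions.\<close>

lemma poisson_enumeration_step_pgfl:
  fixes \<mu> :: "(nat \<Rightarrow> 'a::euclidean_space) measure" and A :: "nat \<Rightarrow> 'a set"
  assumes pe: "poisson_enumeration \<rho> \<mu>" and "0 \<le> \<rho>"
    and A: "disjoint_family A" "\<And>i. A i \<in> sets borel" "\<And>i. bounded (A i)"
    and c: "\<And>i. 0 \<le> c i" and "finite I"
  shows "(\<integral>\<^sup>+x. (\<Prod>i\<in>I. ennreal (c i) ^ card (range x \<inter> A i)) \<partial>\<mu>) =
    ennreal (exp (- (\<rho> * (\<Sum>i\<in>I. measure lborel (A i) * (1 - c i)))))"
proof -
  interpret prob_space \<mu> using pe by (simp add: poisson_enumeration_def)
  let ?N = "\<lambda>i x. card (range x \<inter> A i)"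
  have ms: "?N i \<in> measurable \<mu> (count_space UNIV)" for i
    unfolding poisson_enumeration_measurable[OF pe] by (rule point_seq_count_measurable[OF A(2,3)])
  have ind: "indep_vars (\<lambda>_. count_space UNIV) ?N UNIV"
  proof -
    have "\<forall>A :: nat \<Rightarrow> 'a set. disjoint_family A \<longrightarrow> (\<forall>i. A i \<in> sets borel \<and> bounded (A i)) \<longrightarrow>
        indep_vars (\<lambda>_. count_space UNIV) (\<lambda>i x. card (range x \<inter> A i)) UNIV"
      using pe unfolding poisson_enumeration_def by (elim conjE)
    then show ?thesis using A by (auto dest!: spec[of _ A])
  qed
  have "indep_vars (\<lambda>_. borel) (\<lambda>i x. ennreal (c i) ^ ?N i x) UNIV"
    by (rule indep_vars_compose2[OF ind]) simp
  then have "indep_vars (\<lambda>_. borel) (\<lambda>i x. ennreal (c i) ^ ?N i x) I"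
    by (rule indep_vars_subset) simp
  then have "(\<integral>\<^sup>+x. (\<Prod>i\<in>I. ennreal (c i) ^ ?N i x) \<partial>\<mu>) = (\<Prod>i\<in>I. \<integral>\<^sup>+x. ennreal (c i) ^ ?N i x \<partial>\<mu>)"
    using \<open>finite I\<close> by (intro indep_vars_nn_integral) auto
  also have "\<dots> = (\<Prod>i\<in>I. ennreal (exp (- (\<rho> * measure lborel (A i) * (1 - c i)))))"
  proof (rule prod.cong[OF refl])
    fix i
    have "emeasure \<mu> {x \<in> space \<mu>. ?N i x = k} =
        ennreal (exp (- (\<rho> * measure lborel (A i))) * (\<rho> * measure lborel (A i)) ^ k / fact k)" for k
      using pe A by (simp add: emeasure_eq_measure poisson_enumeration_def)
    then have "(\<integral>\<^sup>+x. ennreal (c i) ^ ?N i x \<partial>\<mu>) = (\<Sum>k. ennreal (c i) ^ k *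
        ennreal (exp (- (\<rho> * measure lborel (A i))) * (\<rho> * measure lborel (A i)) ^ k / fact k))"
      using ms by (subst nn_integral_nat_rv) auto
    also have "\<dots> = ennreal (exp (- (\<rho> * measure lborel (A i) * (1 - c i))))"
      using c \<open>0 \<le> \<rho>\<close> by (intro poisson_pgf) auto
    finally show "(\<integral>\<^sup>+x. ennreal (c i) ^ ?N i x \<partial>\<mu>) = \<dots>" .
  qed
  also have "\<dots> = ennreal (exp (- (\<rho> * (\<Sum>i\<in>I. measure lborel (A i) * (1 - c i)))))"
    using \<open>finite I\<close> by (simp add: prod_ennreal sum_distrib_left sum_negf mult.assoc flip: exp_sum)
  finally show ?thesis .
qed

lemma floor_step_approx:
  fixes g K :: real
  assumes "0 \<le> g" "0 < K"
  shows "real (nat \<lfloor>K * g\<rfloor>) / K \<le> g"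
    and "g - 1 / K \<le> real (nat \<lfloor>K * g\<rfloor>) / K"
proof -
  define n where "n = nat \<lfloor>K * g\<rfloor>"
  have "real n = of_int \<lfloor>K * g\<rfloor>" using assms by (simp add: n_def)
  then have "real n \<le> K * g" "K * g - 1 \<le> real n"
    by linarith+
  then have "real n / K \<le> g" "(K * g - 1) / K \<le> real n / K"
    using assms(2) by (simp_all add: pos_divide_le_eq mult.commute divide_right_mono)
  moreover have "(K * g - 1) / K = g - 1 / K" using assms(2) by (simp add: diff_divide_distrib)
  ultimately have "real n / K \<le> g" "g - 1 / K \<le> real n / K" by simp_all
  then show "real (nat \<lfloor>K * g\<rfloor>) / K \<le> g" "g - 1 / K \<le> real (nat \<lfloor>K * g\<rfloor>) / K"
    by (simp_all add: n_def)
qed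

text \<open>Passes from step weights to measurable ones by rounding \<open>g\<close> down and using
  dominated convergence on both sides. The bounded support \<open>K\<close> keeps the products
  finite and the limit integrable.\<close>

lemma poisson_enumeration_pgfl:
  fixes \<mu> :: "(nat \<Rightarrow> 'a::euclidean_space) measure" and g :: "'a \<Rightarrow> real"
  assumes pe: "poisson_enumeration \<rho> \<mu>" and "0 \<le> \<rho>"
    and g [measurable]: "g \<in> borel_measurable borel" and g01: "\<And>y. 0 \<le> g y" "\<And>y. g y \<le> 1"
    and K [measurable]: "K \<in> sets borel" and "bounded K" and g0: "\<And>y. y \<notin> K \<Longrightarrow> g y = 0"
  shows "(\<integral>x. (\<Prod>n | x n \<in> K. 1 - g (x n)) \<partial>\<mu>) = exp (- (\<rho> * (\<integral>y. g y \<partial>lborel)))"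
    and "(\<lambda>x. \<Prod>n | x n \<in> K. 1 - g (x n)) \<in> borel_measurable \<mu>"
proof -
  interpret prob_space \<mu> using pe by (simp add: poisson_enumeration_def)
  \<comment> \<open>\<open>G m\<close> rounds \<open>g\<close> down to multiples of 1/(m+1), and
    \<open>A m i\<close> is the part of \<open>K\<close> where it takes the value i/(m+1).\<close>
  define G where "G m y = real (nat \<lfloor>real (Suc m) * g y\<rfloor>) / real (Suc m)" for m y
  define A where "A m i = {y. nat \<lfloor>real (Suc m) * g y\<rfloor> = i} \<inter> K" for m i
  define F where "F m x = (\<Prod>n | x n \<in> K. 1 - G m (x n))" for m and x :: "nat \<Rightarrow> 'a"
  have Gg: "G m y \<le> g y" "g y - 1 / real (Suc m) \<le> G m y" "0 \<le> G m y" for m y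
    unfolding G_def using floor_step_approx[of "g y" "real (Suc m)"] g01 by auto
  have G1: "G m y \<le> 1" for m y using Gg(1)[of m y] g01(2)[of y] by linarith
  have Am [measurable]: "A m i \<in> sets borel" for m i unfolding A_def by measurable
  have Ab: "bounded (A m i)" for m i using \<open>bounded K\<close> unfolding A_def by (rule bounded_subset) auto
  have Ad: "disjoint_family (A m)" for m by (auto simp: disjoint_family_on_def A_def)
  have lim1: "(\<lambda>m. G m y) \<longlonglongrightarrow> g y" for y
  proof (rule real_tendsto_sandwich[of "\<lambda>m. g y - 1 / real (Suc m)" _ _ "\<lambda>_. g y"])
    have "(\<lambda>m. g y - 1 / real (Suc m)) \<longlonglongrightarrow> g y - 0"
      by (intro tendsto_diff tendsto_const LIMSEQ_Suc[OF lim_1_over_n])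
    then show "(\<lambda>m. g y - 1 / real (Suc m)) \<longlonglongrightarrow> g y" by simp
  qed (use Gg in auto)
  \<comment> \<open>The factors are grouped by level. Levels stop at \<open>Suc m\<close> because
    \<open>g \<le> 1\<close>.\<close>
  have Feq: "F m x = (\<Prod>i\<le>Suc m. (1 - real i / real (Suc m)) ^ card (range x \<inter> A m i))"
    if x: "x \<in> space \<mu>" for m x
  proof -
    have x': "inj x" "locally_finite_set (range x)" using x poisson_enumeration_space[OF pe] by auto
    let ?k = "\<lambda>n. nat \<lfloor>real (Suc m) * g (x n)\<rfloor>"
    have fin: "finite {n. x n \<in> K}" using locally_finite_index(1)[OF x' \<open>bounded K\<close>] .
    have "?k n \<le> Suc m" for n
    proof -
      have "real (Suc m) * g (x n) \<le> real (Suc m) * 1" using g01(2) by (intro mult_left_mono) auto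
      then have "\<lfloor>real (Suc m) * g (x n)\<rfloor> \<le> \<lfloor>real (Suc m)\<rfloor>" by (intro floor_mono) simp
      then show ?thesis by (simp only: nat_le_iff floor_of_nat)
    qed
    then have "F m x = (\<Prod>i\<le>Suc m. \<Prod>n\<in>{n \<in> {n. x n \<in> K}. ?k n = i}. 1 - G m (x n))"
      unfolding F_def using fin by (subst prod.group) auto
    also have "\<dots> = (\<Prod>i\<le>Suc m. (1 - real i / real (Suc m)) ^ card (range x \<inter> A m i))"
    proof (rule prod.cong[OF refl])
      fix i
      have "(\<Prod>n\<in>{n \<in> {n. x n \<in> K}. ?k n = i}. 1 - G m (x n)) =
          (\<Prod>n\<in>{n \<in> {n. x n \<in> K}. ?k n = i}. 1 - real i / real (Suc m))"
        by (rule prod.cong) (auto simp: G_def)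
      also have "\<dots> = (1 - real i / real (Suc m)) ^ card {n. x n \<in> A m i}"
        by (simp add: A_def conj_commute)
      also have "card {n. x n \<in> A m i} = card (range x \<inter> A m i)"
        unfolding A_def by (rule locally_finite_index(2)[OF x' \<open>bounded K\<close>])
      finally show "(\<Prod>n\<in>{n \<in> {n. x n \<in> K}. ?k n = i}. 1 - G m (x n)) =
        (1 - real i / real (Suc m)) ^ card (range x \<inter> A m i)" .
    qed
    finally show ?thesis .
  qed
  have cnt: "(\<lambda>x. card (range x \<inter> A m i)) \<in> measurable \<mu> (count_space UNIV)" for m i
    unfolding poisson_enumeration_measurable[OF pe] by (rule point_seq_count_measurable[OF Am Ab])
  have Fm: "F m \<in> borel_measurable \<mu>" for m
  proof -
    have "(\<lambda>x. \<Prod>i\<le>Suc m. (1 - real i / real (Suc m)) ^ card (range x \<inter> A m i)) \<in> borel_measurable \<mu>"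
      by (intro borel_measurable_prod measurable_compose[OF cnt]) simp
    then show ?thesis using Feq by (subst measurable_cong[of _ _ "\<lambda>x. \<Prod>i\<le>Suc m. (1 - real i / real (Suc m)) ^ card (range x \<inter> A m i)"]) auto
  qed
  have F01: "0 \<le> F m x" "F m x \<le> 1" for m x
    unfolding F_def using Gg G1 by (auto intro!: prod_nonneg prod_le_1)
  have limF: "(\<lambda>m. F m x) \<longlonglongrightarrow> (\<Prod>n | x n \<in> K. 1 - g (x n))" for x
    unfolding F_def by (intro tendsto_prod tendsto_diff tendsto_const lim1)
  show meas: "(\<lambda>x. \<Prod>n | x n \<in> K. 1 - g (x n)) \<in> borel_measurable \<mu>"
    by (rule borel_measurable_LIMSEQ_real[OF limF Fm])
  have intK: "integrable lborel (indicator K :: 'a \<Rightarrow> real)"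
    using emeasure_bounded_finite[OF \<open>bounded K\<close>] by (intro integrable_real_indicator) auto
  have Gm: "G m \<in> borel_measurable borel" for m unfolding G_def by measurable
  have G0: "G m y = 0" if "y \<notin> K" for m y using g0[OF that] by (simp add: G_def)
  have limG: "(\<lambda>m. \<integral>y. G m y \<partial>lborel) \<longlonglongrightarrow> (\<integral>y. g y \<partial>lborel)"
    by (rule integral_dominated_convergence[where w="indicator K"])
      (use intK lim1 Gm G1 Gg G0 in \<open>auto simp: indicator_def\<close>)
  have EF: "(\<integral>x. F m x \<partial>\<mu>) = exp (- (\<rho> * (\<integral>y. G m y \<partial>lborel)))" for m
  proof -
    have "ennreal (\<integral>x. F m x \<partial>\<mu>) = (\<integral>\<^sup>+x. ennreal (F m x) \<partial>\<mu>)"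
      using F01 Fm by (intro nn_integral_eq_integral[symmetric] integrable_const_bound[where B=1]) auto
    also have "\<dots> = (\<integral>\<^sup>+x. (\<Prod>i\<le>Suc m. ennreal (1 - real i / real (Suc m)) ^ card (range x \<inter> A m i)) \<partial>\<mu>)"
    proof (rule nn_integral_cong)
      fix x assume "x \<in> space \<mu>"
      have nn: "0 \<le> 1 - real i / real (Suc m)" if "i \<in> {..Suc m}" for i
        using that by (simp add: field_simps)
      have "ennreal (F m x) = (\<Prod>i\<le>Suc m. ennreal ((1 - real i / real (Suc m)) ^ card (range x \<inter> A m i)))"
        unfolding Feq[OF \<open>x \<in> space \<mu>\<close>] using nn by (intro prod_ennreal[symmetric] zero_le_power)
      also have "\<dots> = (\<Prod>i\<le>Suc m. ennreal (1 - real i / real (Suc m)) ^ card (range x \<inter> A m i))"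
        using nn by (intro prod.cong refl ennreal_power[symmetric])
      finally show "ennreal (F m x) = \<dots>" .
    qed
    \<comment> \<open>The step version wants nonnegative weights at every index, so they are
      truncated at 0; for indices up to \<open>Suc m\<close> this changes nothing.\<close>
    also have "\<dots> = (\<integral>\<^sup>+x. (\<Prod>i\<le>Suc m. ennreal (max 0 (1 - real i / real (Suc m))) ^ card (range x \<inter> A m i)) \<partial>\<mu>)"
      by (simp add: ennreal_max_0)
    also have "\<dots> = ennreal (exp (- (\<rho> * (\<Sum>i\<le>Suc m. measure lborel (A m i) * (1 - max 0 (1 - real i / real (Suc m)))))))"
      by (rule poisson_enumeration_step_pgfl[OF pe \<open>0 \<le> \<rho>\<close> Ad Am Ab]) auto
    also have "(\<Sum>i\<le>Suc m. measure lborel (A m i) * (1 - max 0 (1 - real i / real (Suc m)))) =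
        (\<Sum>i\<le>Suc m. \<integral>y. real i / real (Suc m) * indicator (A m i) y \<partial>lborel)"
    proof (rule sum.cong[OF refl])
      fix i assume "i \<in> {..Suc m}"
      then have "max 0 (1 - real i / real (Suc m)) = 1 - real i / real (Suc m)" by (simp add: field_simps)
      then show "measure lborel (A m i) * (1 - max 0 (1 - real i / real (Suc m))) =
        (\<integral>y. real i / real (Suc m) * indicator (A m i) y \<partial>lborel)" by simp
    qed
    also have "\<dots> = (\<integral>y. (\<Sum>i\<le>Suc m. real i / real (Suc m) * indicator (A m i) y) \<partial>lborel)"
    proof (rule Bochner_Integration.integral_sum[symmetric])
      show "integrable lborel (\<lambda>y. real i / real (Suc m) * indicator (A m i) y)" for i
        using emeasure_bounded_finite[OF Ab] by (intro integrable_mult_right integrable_real_indicator) auto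
    qed
    also have "\<dots> = (\<integral>y. G m y \<partial>lborel)"
    proof (rule Bochner_Integration.integral_cong[OF refl])
      fix y
      have "(\<Sum>i\<le>Suc m. real i / real (Suc m) * indicator (A m i) y) =
          (\<Sum>i\<in>{nat \<lfloor>real (Suc m) * g y\<rfloor>}. real i / real (Suc m) * indicator (A m i) y)"
      proof (rule sum.mono_neutral_right)
        have "real (Suc m) * g y \<le> real (Suc m) * 1" using g01(2) by (intro mult_left_mono) auto
        then have "\<lfloor>real (Suc m) * g y\<rfloor> \<le> \<lfloor>real (Suc m)\<rfloor>" by (intro floor_mono) simp
        then have "nat \<lfloor>real (Suc m) * g y\<rfloor> \<le> Suc m" by (simp only: nat_le_iff floor_of_nat)
        then show "{nat \<lfloor>real (Suc m) * g y\<rfloor>} \<subseteq> {..Suc m}" by (simp only: insert_subset atMost_iff empty_subsetI simp_thms)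
      qed (auto simp: A_def indicator_def)
      also have "\<dots> = G m y" using G0 by (auto simp: A_def indicator_def G_def)
      finally show "(\<Sum>i\<le>Suc m. real i / real (Suc m) * indicator (A m i) y) = G m y" .
    qed
    finally show ?thesis using F01 by (subst (asm) ennreal_inj) auto
  qed
  have "(\<lambda>m. \<integral>x. F m x \<partial>\<mu>) \<longlonglongrightarrow> (\<integral>x. (\<Prod>n | x n \<in> K. 1 - g (x n)) \<partial>\<mu>)"
    by (rule integral_dominated_convergence[where w="\<lambda>_. 1"])
      (use meas Fm F01 limF in auto)
  moreover have "(\<lambda>m. \<integral>x. F m x \<partial>\<mu>) \<longlonglongrightarrow> exp (- (\<rho> * (\<integral>y. g y \<partial>lborel)))"
    unfolding EF by (intro tendsto_intros limG)
  ultimately show "(\<integral>x. (\<Prod>n | x n \<in> K. 1 - g (x n)) \<partial>\<mu>) = exp (- (\<rho> * (\<integral>y. g y \<partial>lborel)))"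
    by (rule LIMSEQ_unique)
qed

definition attach_marks :: "(nat \<Rightarrow> 'a) \<times> (nat \<Rightarrow> real) \<Rightarrow> ('a \<times> real) set" where
  "attach_marks = (\<lambda>(x, e). range (\<lambda>n. (x n, e n)))"

lemma attach_marks_measurable:
  fixes \<mu> :: "(nat \<Rightarrow> 'a::euclidean_space) measure"
  assumes pe: "poisson_enumeration \<rho> \<mu>" and \<nu>: "real_distribution \<nu>"
  shows "attach_marks \<in> measurable (\<mu> \<Otimes>\<^sub>M (\<Pi>\<^sub>M n\<in>UNIV. \<nu>)) config_space"
proof (rule measurable_config_spaceI)
  interpret real_distribution \<nu> by fact
  fix w assume "w \<in> space (\<mu> \<Otimes>\<^sub>M (\<Pi>\<^sub>M n\<in>(UNIV::nat set). \<nu>))"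
  then have "fst w \<in> space \<mu>" by (auto simp: space_pair_measure)
  then have "inj (fst w)" "locally_finite_set (range (fst w))"
    by (simp_all add: poisson_enumeration_space[OF pe])
  moreover have "fst ` attach_marks w = range (fst w)"
    by (simp add: attach_marks_def split_beta image_image)
  moreover have "e = e'" if "inj (fst w)" "(x, e) \<in> attach_marks w" "(x, e') \<in> attach_marks w" for x e e'
    using that by (auto simp: attach_marks_def split_beta inj_eq)
  ultimately show "attach_marks w \<in> configs"
    by (simp add: configs_def)
next
  interpret real_distribution \<nu> by fact
  fix B :: "('a \<times> real) set" assume "bounded_region B"
  then have "B \<in> sets (borel \<Otimes>\<^sub>M borel)" unfolding bounded_region_def borel_prod by blast
  moreover have "(\<lambda>w. (fst w n, snd w n)) \<in> measurable (\<mu> \<Otimes>\<^sub>M (\<Pi>\<^sub>M n\<in>UNIV. \<nu>)) (borel \<Otimes>\<^sub>M borel)" for n :: nat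
  proof (rule measurable_Pair)
    show "(\<lambda>w. fst w n) \<in> borel_measurable (\<mu> \<Otimes>\<^sub>M (\<Pi>\<^sub>M n\<in>UNIV. \<nu>))"
      by (rule measurable_compose[OF measurable_fst poisson_enumeration_component[OF pe]])
    have "(\<lambda>e. e n) \<in> measurable (\<Pi>\<^sub>M n\<in>UNIV. \<nu>) \<nu>"
      by (rule measurable_component_singleton) simp
    then have "(\<lambda>e. e n) \<in> borel_measurable (\<Pi>\<^sub>M n\<in>UNIV. \<nu>)"
      by (simp add: measurable_cong_sets[OF refl events_eq_borel])
    then show "(\<lambda>w. snd w n) \<in> borel_measurable (\<mu> \<Otimes>\<^sub>M (\<Pi>\<^sub>M n\<in>UNIV. \<nu>))"
      by (rule measurable_compose[OF measurable_snd])
  qed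
  ultimately have [measurable]:
    "Measurable.pred (\<mu> \<Otimes>\<^sub>M (\<Pi>\<^sub>M n\<in>UNIV. \<nu>)) (\<lambda>w. (fst w n, snd w n) \<in> B)" for n
    by (intro pred_sets2[where N="borel \<Otimes>\<^sub>M borel"]) auto
  have "{w \<in> space (\<mu> \<Otimes>\<^sub>M (\<Pi>\<^sub>M n\<in>UNIV. \<nu>)). attach_marks w \<inter> B = {}} =
     {w \<in> space (\<mu> \<Otimes>\<^sub>M (\<Pi>\<^sub>M n\<in>UNIV. \<nu>)). \<forall>n. (fst w n, snd w n) \<notin> B}"
    by (auto simp: attach_marks_def split_beta)
  also have "\<dots> \<in> sets (\<mu> \<Otimes>\<^sub>M (\<Pi>\<^sub>M n\<in>UNIV. \<nu>))" by measurable
  finally show "{w \<in> space (\<mu> \<Otimes>\<^sub>M (\<Pi>\<^sub>M n\<in>UNIV. \<nu>)). attach_marks w \<inter> B = {}} \<in> \<dots>" .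
qed

text \<open>Given the positions, the marks are independent, and a point at y stays out of
  \<open>B\<close> with probability \<open>1 - g y\<close>. Fubini leaves the generating functional
  of the positions, from which the choice of the enumeration has disappeared.\<close>

lemma poisson_law_of_enumeration:
  fixes \<mu> :: "(nat \<Rightarrow> 'a::euclidean_space) measure"
  assumes pe: "poisson_enumeration \<rho> \<mu>" and "0 \<le> \<rho>" and \<nu>: "real_distribution \<nu>"
  shows "poisson_law \<rho> \<nu> (distr (\<mu> \<Otimes>\<^sub>M (\<Pi>\<^sub>M n\<in>UNIV. \<nu>)) config_space attach_marks)"
  unfolding poisson_law_def
proof (intro conjI allI impI)
  interpret \<nu>: real_distribution \<nu> by fact
  interpret \<mu>: prob_space \<mu> using pe by (simp add: poisson_enumeration_def)
  interpret E: product_prob_space "\<lambda>_::nat. \<nu>" UNIV by unfold_locales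
  interpret P: pair_prob_space \<mu> "\<Pi>\<^sub>M n\<in>(UNIV::nat set). \<nu>" by unfold_locales
  let ?E = "\<Pi>\<^sub>M n\<in>(UNIV::nat set). \<nu>"
  note T = attach_marks_measurable[OF pe \<nu>]
  show "prob_space (distr (\<mu> \<Otimes>\<^sub>M ?E) config_space attach_marks)"
    by (rule P.prob_space_distr[OF T])
  fix B :: "('a \<times> real) set" assume B: "bounded_region B"
  then obtain r where r: "fst ` B \<subseteq> ball 0 r"
    using bounded_subset_ballD unfolding bounded_region_def by blast
  have Bm: "B \<in> sets (lborel \<Otimes>\<^sub>M \<nu>)"
    using bounded_region_finite_measure[OF \<nu> B] by auto
  have sec: "Pair y -` B \<in> sets \<nu>" for y using Bm by (rule sets_Pair1)
  define g where "g y = measure \<nu> (Pair y -` B)" for y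
  have "(\<lambda>y. emeasure \<nu> (Pair y -` B)) \<in> borel_measurable lborel"
    by (rule \<nu>.measurable_emeasure_Pair[OF Bm])
  then have gm: "g \<in> borel_measurable borel"
    unfolding g_def measure_def by (simp add: borel_measurable_enn2real)
  have g01: "0 \<le> g y" "g y \<le> 1" for y by (auto simp: g_def)
  have g0: "g y = 0" if "y \<notin> ball 0 r" for y
  proof -
    have "Pair y -` B = {}" using r that by (auto simp: image_subset_iff)
    then show ?thesis by (simp add: g_def)
  qed
  have "emeasure (lborel \<Otimes>\<^sub>M \<nu>) B = (\<integral>\<^sup>+y. emeasure \<nu> (Pair y -` B) \<partial>lborel)"
    by (rule \<nu>.emeasure_pair_measure_alt[OF Bm])
  also have "\<dots> = (\<integral>\<^sup>+y. ennreal (g y) \<partial>lborel)"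
    by (simp add: g_def \<nu>.emeasure_eq_measure)
  finally have "measure (lborel \<Otimes>\<^sub>M \<nu>) B = (\<integral>y. g y \<partial>lborel)"
    using gm g01 by (simp add: measure_def integral_eq_nn_integral)
  note gint = this
  have pgfl: "(\<integral>x. (\<Prod>n | x n \<in> ball 0 r. 1 - g (x n)) \<partial>\<mu>) = exp (- (\<rho> * (\<integral>y. g y \<partial>lborel)))"
    "(\<lambda>x. \<Prod>n | x n \<in> ball 0 r. 1 - g (x n)) \<in> borel_measurable \<mu>"
    by (rule poisson_enumeration_pgfl[OF pe \<open>0 \<le> \<rho>\<close> gm g01]; use g0 in simp)+
  let ?V = "{w \<in> space (\<mu> \<Otimes>\<^sub>M ?E). attach_marks w \<inter> B = {}}"
  have Veq: "?V = attach_marks -` avoid B \<inter> space (\<mu> \<Otimes>\<^sub>M ?E)"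
    using measurable_space[OF T] by (auto simp: avoid_def)
  have Vs: "?V \<in> sets (\<mu> \<Otimes>\<^sub>M ?E)"
    unfolding Veq by (rule measurable_sets[OF T avoid_sets[OF B]])
  have "emeasure (distr (\<mu> \<Otimes>\<^sub>M ?E) config_space attach_marks) (avoid B) = emeasure (\<mu> \<Otimes>\<^sub>M ?E) ?V"
    unfolding Veq by (rule emeasure_distr[OF T avoid_sets[OF B]])
  also have "\<dots> = (\<integral>\<^sup>+x. emeasure ?E (Pair x -` ?V) \<partial>\<mu>)"
    by (rule E.P.emeasure_pair_measure_alt[OF Vs])
  also have "\<dots> = (\<integral>\<^sup>+x. ennreal (\<Prod>n | x n \<in> ball 0 r. 1 - g (x n)) \<partial>\<mu>)"
  proof (rule nn_integral_cong)
    fix x assume x: "x \<in> space \<mu>"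
    then have x': "inj x" "locally_finite_set (range x)" using poisson_enumeration_space[OF pe] by auto
    let ?J = "{n. x n \<in> ball 0 r}"
    have fin: "finite ?J" by (rule locally_finite_index(1)[OF x']) simp
    \<comment> \<open>Points outside the ball cannot lie in \<open>B\<close>, so the infinitely many
      conditions reduce to finitely many independent ones.\<close>
    have "Pair x -` ?V = {e \<in> space ?E. \<forall>n\<in>?J. e n \<in> UNIV - Pair (x n) -` B}"
    proof (intro set_eqI iffI)
      fix e assume "e \<in> {e \<in> space ?E. \<forall>n\<in>?J. e n \<in> UNIV - Pair (x n) -` B}"
      then have e: "e \<in> space ?E" "\<And>n. x n \<in> ball 0 r \<Longrightarrow> (x n, e n) \<notin> B" by auto
      have "(x n, e n) \<notin> B" for n
        using e(2)[of n] r by (auto simp: image_subset_iff)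
      then show "e \<in> Pair x -` ?V" using x e(1)
        by (auto simp: space_pair_measure attach_marks_def)
    qed (auto simp: space_pair_measure attach_marks_def)
    also have "emeasure ?E \<dots> = (\<Prod>n\<in>?J. emeasure \<nu> (UNIV - Pair (x n) -` B))"
      using fin sec \<nu>.space_eq_univ sets.compl_sets[OF sec]
      by (intro E.emeasure_PiM_Collect) auto
    also have "\<dots> = (\<Prod>n\<in>?J. ennreal (1 - g (x n)))"
      using sec \<nu>.prob_compl[OF sec] \<nu>.space_eq_univ by (simp add: \<nu>.emeasure_eq_measure g_def)
    also have "\<dots> = ennreal (\<Prod>n\<in>?J. 1 - g (x n))"
      using g01 by (intro prod_ennreal) auto
    finally show "emeasure ?E (Pair x -` ?V) = ennreal (\<Prod>n\<in>?J. 1 - g (x n))" .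
  qed
  also have "\<dots> = ennreal (\<integral>x. (\<Prod>n | x n \<in> ball 0 r. 1 - g (x n)) \<partial>\<mu>)"
  proof (rule nn_integral_eq_integral)
    show "integrable \<mu> (\<lambda>x. \<Prod>n | x n \<in> ball 0 r. 1 - g (x n))"
    proof (rule \<mu>.integrable_const_bound[where B=1])
      have "norm (\<Prod>n | x n \<in> ball 0 r. 1 - g (x n)) \<le> 1" for x
        unfolding real_norm_def abs_prod using g01 by (intro prod_le_1) auto
      then show "AE x in \<mu>. norm (\<Prod>n | x n \<in> ball 0 r. 1 - g (x n)) \<le> 1" by (intro AE_I2)
    qed (rule pgfl(2))
    show "AE x in \<mu>. 0 \<le> (\<Prod>n | x n \<in> ball 0 r. 1 - g (x n))"
      using g01 by (intro AE_I2 prod_nonneg) simp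
  qed
  also have "\<dots> = ennreal (exp (- (\<rho> * measure (lborel \<Otimes>\<^sub>M \<nu>) B)))"
    unfolding gint pgfl(1) ..
  finally show "measure (distr (\<mu> \<Otimes>\<^sub>M ?E) config_space attach_marks) (avoid B) =
      exp (- (\<rho> * measure (lborel \<Otimes>\<^sub>M \<nu>) B))"
    by (intro measure_eq_emeasure_eq_ennreal) auto
qed simp

subsection \<open>Recognising Poisson enumerations\<close>

text \<open>Only the sums on (0,1) are known, so coefficients are killed one at a time: once the
  lower ones vanish, divide by \<open>s ^ m\<close> and let s tend to 0 from the right.\<close>

lemma power_series_zero:
  fixes d :: "nat \<Rightarrow> real"
  assumes "\<And>s. 0 < s \<Longrightarrow> s < 1 \<Longrightarrow> (\<lambda>k. d k * s ^ k) sums 0"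
  shows "d m = 0"
proof (induction m rule: less_induct)
  case (less m)
  have summ: "summable (\<lambda>n. d n * x ^ n)" if "norm x < 1" for x :: real
  proof -
    obtain s where s: "norm x < s" "s < 1" using \<open>norm x < 1\<close> dense by blast
    then have "0 < s" by (meson norm_ge_zero order_le_less_trans)
    have "summable (\<lambda>n. d n * s ^ n)" by (rule sums_summable[OF assms[OF \<open>0 < s\<close> s(2)]])
    from powser_inside[OF this, of x] show ?thesis using s \<open>0 < s\<close> by simp
  qed
  define g where "g x = (\<Sum>n. d (n + m) * x ^ n)" for x :: real
  have gsums: "(\<lambda>n. d (n + m) * x ^ n) sums g x" if "norm x < 1" for x
  proof (cases "x = 0")
    case False
    have "summable (\<lambda>n. d (n + m) * x ^ (n + m))"
      using summ[OF that] by (subst summable_iff_shift)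
    then have "summable (\<lambda>n. inverse (x ^ m) * (d (n + m) * x ^ (n + m)))" by (rule summable_mult)
    also have "(\<lambda>n. inverse (x ^ m) * (d (n + m) * x ^ (n + m))) = (\<lambda>n. d (n + m) * x ^ n)"
      using False by (auto simp: power_add field_simps)
    finally show ?thesis unfolding g_def by (rule summable_sums)
  qed (auto simp: g_def intro: summable_sums)
  have g0: "g x = 0" if "0 < x" "x < 1" for x
  proof -
    have "(\<lambda>n. d (n + m) * x ^ (n + m)) sums 0"
      using assms[OF that] less by (subst sums_zero_iff_shift) auto
    then have "(\<lambda>n. inverse (x ^ m) * (d (n + m) * x ^ (n + m))) sums (inverse (x ^ m) * 0)"
      by (rule sums_mult)
    also have "(\<lambda>n. inverse (x ^ m) * (d (n + m) * x ^ (n + m))) = (\<lambda>n. d (n + m) * x ^ n)"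
      using that by (auto simp: power_add field_simps)
    finally have "(\<lambda>n. d (n + m) * x ^ n) sums 0" by simp
    then show ?thesis using gsums[of x] that by (intro sums_unique2[of _ "g x" 0]) auto
  qed
  have "(g \<longlongrightarrow> d (0 + m)) (at 0)"
    using gsums by (intro powser_limit_0[where s=1]) auto
  then have "(g \<longlongrightarrow> d m) (at_right 0)" by (simp add: filterlim_at_split)
  moreover have "eventually (\<lambda>x. g x = 0) (at_right (0::real))"
    unfolding eventually_at_right_field by (rule exI[of _ 1]) (auto simp: g0)
  then have "(g \<longlongrightarrow> 0) (at_right 0)" by (rule tendsto_eventually)
  ultimately show ?case by (intro tendsto_unique[of "at_right (0::real)" g]) auto
qed

lemma (in prob_space) poisson_if_pgf:
  fixes N :: "'a \<Rightarrow> nat"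
  assumes N [measurable]: "N \<in> measurable M (count_space UNIV)" and "0 \<le> r"
    and pgf: "\<And>s. 0 \<le> s \<Longrightarrow> s < 1 \<Longrightarrow> (\<integral>\<^sup>+x. ennreal s ^ N x \<partial>M) = ennreal (exp (- (r * (1 - s))))"
  shows "prob {x \<in> space M. N x = k} = exp (- r) * r ^ k / fact k"
proof -
  let ?p = "\<lambda>k. prob {x \<in> space M. N x = k}"
  have "(\<lambda>k. (?p k - exp (- r) * r ^ k / fact k) * s ^ k) sums 0" if s: "0 < s" "s < 1" for s
  proof -
    have sm: "summable (\<lambda>k. s ^ k * ?p k)"
    proof (rule summable_comparison_test'[where g="\<lambda>k. s ^ k" and N=0])
      show "summable (\<lambda>k. s ^ k)" using s by (simp add: summable_geometric)
      show "norm (s ^ k * ?p k) \<le> s ^ k" for k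
        using s by (simp add: abs_mult mult_left_le)
    qed
    have "ennreal (\<Sum>k. s ^ k * ?p k) = (\<Sum>k. ennreal (s ^ k * ?p k))"
      using s sm by (intro suminf_ennreal2[symmetric]) auto
    also have "\<dots> = (\<integral>\<^sup>+x. ennreal s ^ N x \<partial>M)"
      unfolding nn_integral_nat_rv[OF N, of "\<lambda>k. ennreal s ^ k"] using s
      by (intro suminf_cong) (simp add: emeasure_eq_measure ennreal_power ennreal_mult)
    also have "\<dots> = ennreal (exp (- (r * (1 - s))))" using s by (intro pgf) auto
    finally have "(\<Sum>k. s ^ k * ?p k) = exp (- (r * (1 - s)))"
      using s by (subst (asm) ennreal_inj) (auto intro!: suminf_nonneg sm)
    then have 1: "(\<lambda>k. s ^ k * ?p k) sums exp (- (r * (1 - s)))" using sm by (simp add: sums_iff)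
    have "(\<lambda>k. (s * r) ^ k /\<^sub>R fact k) sums exp (s * r)" by (rule exp_converges)
    then have "(\<lambda>k. exp (- r) * ((s * r) ^ k /\<^sub>R fact k)) sums (exp (- r) * exp (s * r))"
      by (rule sums_mult)
    also have "exp (- r) * exp (s * r) = exp (- (r * (1 - s)))"
      by (simp add: algebra_simps flip: exp_add)
    finally have "(\<lambda>k. s ^ k * ?p k - exp (- r) * ((s * r) ^ k /\<^sub>R fact k)) sums
      (exp (- (r * (1 - s))) - exp (- (r * (1 - s))))" by (rule sums_diff[OF 1])
    then show ?thesis by (simp add: power_mult_distrib field_simps)
  qed
  from power_series_zero[OF this, of k] show ?thesis by simp
qed

text \<open>Generating functions of single counts suffice. They determine the avoidance
  probabilities, these multiply over disjoint sets because volume is additive, and avoidance events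
  generate the sigma-algebras of the counts.\<close>

lemma poisson_enumerationI:
  fixes \<mu> :: "(nat \<Rightarrow> 'a::euclidean_space) measure"
  assumes "prob_space \<mu>" and sets: "sets \<mu> = sets point_seq_space" and "0 \<le> \<rho>"
    and pgf: "\<And>A s. A \<in> sets borel \<Longrightarrow> bounded A \<Longrightarrow> 0 \<le> s \<Longrightarrow> s < 1 \<Longrightarrow>
      (\<integral>\<^sup>+x. ennreal s ^ card (range x \<inter> A) \<partial>\<mu>) = ennreal (exp (- (\<rho> * measure lborel A * (1 - s))))"
  shows "poisson_enumeration \<rho> \<mu>"
proof -
  interpret prob_space \<mu> by fact
  have sp: "space \<mu> = {x. inj x \<and> locally_finite_set (range x)}"
    using sets_eq_imp_space_eq[OF sets] by (simp add: point_seq_space_space)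
  have cnt: "(\<lambda>x. card (range x \<inter> A)) \<in> measurable \<mu> (count_space UNIV)"
    if "A \<in> sets borel" "bounded A" for A :: "'a set"
    using point_seq_count_measurable[OF that] measurable_cong_sets[OF sets refl] by blast
  have pois: "prob {x \<in> space \<mu>. card (range x \<inter> A) = k} =
      exp (- (\<rho> * measure lborel A)) * (\<rho> * measure lborel A) ^ k / fact k"
    if "A \<in> sets borel" "bounded A" for A k
    using that \<open>0 \<le> \<rho>\<close> by (intro poisson_if_pgf cnt pgf) auto
  define V where "V B = {x \<in> space \<mu>. range x \<inter> B = {}}" for B :: "'a set"
  have fin: "finite (range x \<inter> A)" if "x \<in> space \<mu>" "bounded A" for x and A :: "'a set"
    using that by (simp add: sp locally_finite_set_def)
  have V0: "V A = {x \<in> space \<mu>. card (range x \<inter> A) = 0}" if "bounded A" for A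
    unfolding V_def using fin[OF _ that] by (intro Collect_cong conj_cong refl) simp
  have Vev: "V A \<in> events" if "A \<in> sets borel" "bounded A" for A
    unfolding V0[OF that(2)] using cnt[OF that] by measurable
  have Vprob: "prob (V A) = exp (- (\<rho> * measure lborel A))" if "A \<in> sets borel" "bounded A" for A
    unfolding V0[OF that(2)] pois[OF that] by simp
  have Vprob_UN: "prob (\<Inter>j\<in>J. V (B j)) = (\<Prod>j\<in>J. prob (V (B j)))"
    if "finite J" "J \<noteq> {}" "disjoint_family_on B J"
      and B: "\<And>j. j \<in> J \<Longrightarrow> B j \<in> sets borel \<and> bounded (B j)" for B and J :: "nat set"
  proof -
    have U: "(\<Union>j\<in>J. B j) \<in> sets borel" "bounded (\<Union>j\<in>J. B j)"
      using that by (auto intro!: bounded_UN)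
    have "(\<Inter>j\<in>J. V (B j)) = V (\<Union>j\<in>J. B j)" using \<open>J \<noteq> {}\<close> by (auto simp: V_def)
    moreover have "measure lborel (\<Union>j\<in>J. B j) = (\<Sum>j\<in>J. measure lborel (B j))"
    proof (rule measure_finite_Union)
      show "emeasure lborel (B j) \<noteq> \<infinity>" if "j \<in> J" for j
        using emeasure_bounded_finite[of "B j"] B[OF that] by auto
    qed (use that in auto)
    ultimately show ?thesis using B \<open>finite J\<close>
      by (simp add: Vprob U sum_distrib_left exp_sum flip: sum_negf)
  qed
  have indep: "indep_vars (\<lambda>_. count_space UNIV) (\<lambda>i x. card (range x \<inter> A i)) UNIV"
    if A: "disjoint_family A" "\<And>i. A i \<in> sets borel" "\<And>i. bounded (A i)" for A :: "nat \<Rightarrow> 'a set"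
  proof -
    \<comment> \<open>A pi-system of avoidance events inside \<open>A i\<close>. The count on
      \<open>A i\<close> is measurable over what it generates, so independence of these systems
      carries over to the counts.\<close>
    define G where "G i = {V B | B. B \<in> sets borel \<and> B \<subseteq> A i}" for i
    have bd: "bounded B" if "B \<subseteq> A i" for B i using A(3) that bounded_subset by blast
    have "indep_sets G UNIV"
    proof (rule indep_setsI)
      show "G i \<subseteq> events" for i using Vev bd by (auto simp: G_def)
      fix E and J :: "nat set" assume J: "J \<noteq> {}" "J \<subseteq> UNIV" "finite J" "\<forall>j\<in>J. E j \<in> G j"
      then have "\<forall>j\<in>J. \<exists>B. E j = V B \<and> B \<in> sets borel \<and> B \<subseteq> A j" by (auto simp: G_def)
      then obtain B where B: "\<And>j. j \<in> J \<Longrightarrow> E j = V (B j) \<and> B j \<in> sets borel \<and> B j \<subseteq> A j"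
        by metis
      have "disjoint_family_on B J"
        using A(1) B unfolding disjoint_family_on_def by blast
      then have "prob (\<Inter>j\<in>J. V (B j)) = (\<Prod>j\<in>J. prob (V (B j)))"
      proof (intro Vprob_UN)
        show "B j \<in> sets borel \<and> bounded (B j)" if "j \<in> J" for j
          using B[OF that] bd[of "B j" j] by blast
      qed (use J in auto)
      then show "prob (\<Inter>j\<in>J. E j) = (\<Prod>j\<in>J. prob (E j))" using B by simp
    qed
    moreover have "Int_stable (G i)" for i
    proof (rule Int_stableI)
      fix a b assume "a \<in> G i" "b \<in> G i"
      then obtain B C where "a = V B" "b = V C" "B \<union> C \<in> sets borel" "B \<union> C \<subseteq> A i"
        by (auto simp: G_def)
      moreover have "V B \<inter> V C = V (B \<union> C)" by (auto simp: V_def)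
      ultimately show "a \<inter> b \<in> G i" unfolding G_def by blast
    qed
    ultimately have ind: "indep_sets (\<lambda>i. sigma_sets (space \<mu>) (G i)) UNIV"
      by (intro indep_sets_sigma) auto
    have "{(\<lambda>x. card (range x \<inter> A i)) -` S \<inter> space \<mu> |S. S \<in> sets (count_space UNIV)}
        \<subseteq> sigma_sets (space \<mu>) (G i)" for i
    proof -
      let ?S = "sigma (space \<mu>) (G i)"
      have Gs: "G i \<subseteq> Pow (space \<mu>)" by (auto simp: G_def V_def)
      have "(\<lambda>x. card (range x \<inter> A i)) \<in> measurable ?S (count_space UNIV)"
      proof (rule nat_measurable_count, rule card_eq_measurable)
        show "finite (range w \<inter> A i)" if "w \<in> space ?S" for w
          using that fin A(3) by (simp add: space_measure_of[OF Gs])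
        show "{w \<in> space ?S. range w \<inter> B' = {}} \<in> sets ?S" if "B' \<in> sets borel" "B' \<subseteq> A i" for B'
        proof -
          have "V B' \<in> sigma_sets (space \<mu>) (G i)"
            using that by (intro sigma_sets.Basic) (auto simp: G_def)
          then show ?thesis
            by (simp add: space_measure_of[OF Gs] sets_measure_of[OF Gs] V_def[of B'])
        qed
      qed (rule A(2))
      from measurable_sets[OF this] show ?thesis
        by (auto simp: space_measure_of[OF Gs] sets_measure_of[OF Gs])
    qed
    then show ?thesis
      unfolding indep_vars_def2 using cnt A by (intro conjI ballI indep_sets_mono_sets[OF ind]) auto
  qed
  show ?thesis
    unfolding poisson_enumeration_def using assms(1,2) pois indep by blast
qed

subsection \<open>Existence of Poisson processes\<close>

lemma (in product_prob_space) nn_integral_PiM_prod_subset: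
  assumes J: "finite J" "J \<subseteq> I" and f: "\<And>i. i \<in> J \<Longrightarrow> f i \<in> borel_measurable (M i)"
  shows "(\<integral>\<^sup>+x. (\<Prod>i\<in>J. f i (x i)) \<partial>PiM I M) = (\<Prod>i\<in>J. \<integral>\<^sup>+x. f i x \<partial>M i)"
proof -
  have r: "(\<lambda>x. restrict x J) \<in> measurable (PiM I M) (PiM J M)"
    by (rule measurable_restrict_subset[OF J(2)])
  have fm: "(\<lambda>x. \<Prod>i\<in>J. f i (x i)) \<in> borel_measurable (PiM J M)"
    using f by (intro borel_measurable_prod_ennreal measurable_compose[OF measurable_component_singleton]) auto
  have "(\<Prod>i\<in>J. \<integral>\<^sup>+x. f i x \<partial>M i) = (\<integral>\<^sup>+x. (\<Prod>i\<in>J. f i (x i)) \<partial>PiM J M)"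
    using J f by (intro product_nn_integral_prod[symmetric]) auto
  also have "\<dots> = (\<integral>\<^sup>+x. (\<Prod>i\<in>J. f i (x i)) \<partial>distr (PiM I M) (PiM J M) (\<lambda>x. restrict x J))"
    by (simp only: distr_PiM_restrict_finite[OF J])
  also have "\<dots> = (\<integral>\<^sup>+x. (\<Prod>i\<in>J. f i (restrict x J i)) \<partial>PiM I M)"
    using fm by (subst nn_integral_distr[OF r]) simp_all
  also have "\<dots> = (\<integral>\<^sup>+x. (\<Prod>i\<in>J. f i (x i)) \<partial>PiM I M)"
    by (intro nn_integral_cong prod.cong) auto
  finally show ?thesis by simp
qed

text \<open>The pair of components has the product law, under which the diagonal is null because
  \<open>M j\<close> has no atoms.\<close>

lemma AE_PiM_components_neq:
  fixes M :: "'i \<Rightarrow> 'b::{second_countable_topology,t2_space} measure"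
  assumes prob: "\<And>i. prob_space (M i)" and ij: "i \<in> I" "j \<in> I" "i \<noteq> j"
    and s: "sets (M i) = sets borel" "sets (M j) = sets borel"
    and null: "\<And>y. emeasure (M j) {y} = 0"
  shows "AE x in PiM I M. x i \<noteq> x j"
proof -
  interpret prob_space "M k" for k by (rule prob)
  interpret product_prob_space M I ..
  interpret IJ: pair_sigma_finite "M i" "M j" ..
  have m: "(\<lambda>x. (x i, x j)) \<in> measurable (PiM I M) (M i \<Otimes>\<^sub>M M j)"
    using measurable_component_singleton[of i I M] measurable_component_singleton[of j I M] ij
    by (intro measurable_Pair) auto
  have eq: "M i \<Otimes>\<^sub>M M j = distr (PiM I M) (M i \<Otimes>\<^sub>M M j) (\<lambda>x. (x i, x j))"
  proof (rule pair_measure_eqI)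
    fix A B assume AB: "A \<in> sets (M i)" "B \<in> sets (M j)"
    have "emeasure (distr (PiM I M) (M i \<Otimes>\<^sub>M M j) (\<lambda>x. (x i, x j))) (A \<times> B) =
        emeasure (PiM I M) ((\<lambda>x. (x i, x j)) -` (A \<times> B) \<inter> space (PiM I M))"
      using AB by (intro emeasure_distr[OF m]) auto
    also have "(\<lambda>x. (x i, x j)) -` (A \<times> B) \<inter> space (PiM I M) =
        {x \<in> space (PiM I M). \<forall>k\<in>{i, j}. x k \<in> (if k = i then A else B)}"
      using \<open>i \<noteq> j\<close> by auto
    also have "emeasure (PiM I M) \<dots> = (\<Prod>k\<in>{i, j}. emeasure (M k) (if k = i then A else B))"
      using ij AB by (intro emeasure_PiM_Collect) auto
    also have "\<dots> = emeasure (M i) A * emeasure (M j) B" using \<open>i \<noteq> j\<close> by simp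
    finally show "emeasure (M i) A * emeasure (M j) B =
        emeasure (distr (PiM I M) (M i \<Otimes>\<^sub>M M j) (\<lambda>x. (x i, x j))) (A \<times> B)" by simp
  qed (use prob in \<open>auto intro: prob_space_imp_sigma_finite\<close>)
  have ae: "AE p in M i \<Otimes>\<^sub>M M j. fst p \<noteq> snd p"
  proof (rule IJ.AE_pair_measure)
    have "{p \<in> space (borel \<Otimes>\<^sub>M (borel :: 'b measure)). fst p \<noteq> snd p} \<in> sets (borel \<Otimes>\<^sub>M borel)"
      by measurable
    then show "{p \<in> space (M i \<Otimes>\<^sub>M M j). fst p \<noteq> snd p} \<in> sets (M i \<Otimes>\<^sub>M M j)"
      using s by (simp add: space_pair_measure sets_eq_imp_space_eq[OF s(1)] sets_eq_imp_space_eq[OF s(2)]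
          cong: sets_pair_measure_cong)
    show "AE x in M i. AE y in M j. fst (x, y) \<noteq> snd (x, y)"
    proof (rule AE_I2)
      fix x show "AE y in M j. fst (x, y) \<noteq> snd (x, y)"
        by (rule AE_I[of _ _ "{x}"]) (auto simp: null s)
    qed
  qed
  have "AE p in distr (PiM I M) (M i \<Otimes>\<^sub>M M j) (\<lambda>x. (x i, x j)). fst p \<noteq> snd p"
    by (rule subst[OF eq, of "\<lambda>K. AE p in K. fst p \<noteq> snd p", OF ae])
  from AE_distrD[OF m this] show ?thesis by simp
qed

section \<open>Annuli and uniform laws on them\<close>

definition annulus :: "nat \<Rightarrow> 'a::euclidean_space set" where
  "annulus i = ball 0 (real (Suc i)) - ball 0 (real i)"

lemma annulus_borel [measurable]: "annulus i \<in> sets borel"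
  by (simp add: annulus_def)

lemma annulus_bounded: "bounded (annulus i)"
  unfolding annulus_def by (rule bounded_diff) simp

lemma annulus_iff: "y \<in> annulus i \<longleftrightarrow> nat \<lfloor>norm y\<rfloor> = i"
proof -
  have "nat \<lfloor>norm y\<rfloor> = i \<longleftrightarrow> \<lfloor>norm y\<rfloor> = int i"
    using zero_le_floor[of "norm y"] norm_ge_zero[of y] by linarith
  also have "\<dots> \<longleftrightarrow> y \<in> annulus i"
    by (auto simp: annulus_def floor_eq_iff algebra_simps)
  finally show ?thesis by simp
qed

text \<open>Relative to the unit ball, annulus i has volume (i+1)^d - i^d \<ge> 1. This bound,
  uniform in i, is what makes infinitely many annuli occupied.\<close>

lemma annulus_measure_ge:
  "measure lborel (ball 0 1 :: 'a::euclidean_space set) \<le> measure lborel (annulus i :: 'a set)"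
proof -
  obtain k where k: "DIM('a) = Suc k" using DIM_positive[where 'a='a] gr0_conv_Suc by blast
  have b: "measure lborel (ball (0::'a) (real n)) = real n ^ DIM('a) * measure lborel (ball (0::'a) 1)" for n
    by (rule content_ball_conv_unit_ball) simp
  have "real i ^ k \<le> real (Suc i) ^ k" "1 \<le> real (Suc i) ^ k"
    by (auto intro!: power_mono one_le_power)
  then have "real i * real i ^ k + 1 \<le> real i * real (Suc i) ^ k + real (Suc i) ^ k"
    by (intro add_mono mult_left_mono) auto
  then have "1 \<le> real (Suc i) ^ DIM('a) - real i ^ DIM('a)"
    unfolding k by (simp add: algebra_simps)
  then have "1 * measure lborel (ball (0::'a) 1) \<le>
      (real (Suc i) ^ DIM('a) - real i ^ DIM('a)) * measure lborel (ball (0::'a) 1)"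
    by (intro mult_right_mono) auto
  also have "\<dots> = measure lborel (ball (0::'a) (real (Suc i))) - measure lborel (ball (0::'a) (real i))"
    unfolding b by (simp add: algebra_simps)
  also have "\<dots> = measure lborel (annulus i :: 'a set)"
    unfolding annulus_def
    using emeasure_lborel_ball_finite[of "0::'a" "real (Suc i)"]
    by (intro measure_Diff[symmetric]) (auto simp: less_top)
  finally show ?thesis by simp
qed

lemma annulus_measure_pos: "0 < measure lborel (annulus i :: 'a::euclidean_space set)"
  using annulus_measure_ge[where 'a='a, of i] content_ball_pos[of 1 "0::'a"] by linarith

abbreviation annulus_law :: "nat \<Rightarrow> 'a::euclidean_space measure" where
  "annulus_law i \<equiv> uniform_measure lborel (annulus i)"

lemma annulus_emeasure: "emeasure lborel (annulus i :: 'a::euclidean_space set) = ennreal (measure lborel (annulus i :: 'a set))"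
  using emeasure_bounded_finite[OF annulus_bounded[where 'a='a], of i] by (intro emeasure_eq_ennreal_measure) simp

lemma annulus_law_prob: "prob_space (annulus_law i :: 'a::euclidean_space measure)"
  using annulus_measure_pos[where 'a='a, of i] by (intro prob_space_uniform_measure) (auto simp: annulus_emeasure)

lemma annulus_law_measure:
  fixes A :: "'a::euclidean_space set"
  assumes "A \<in> sets borel"
  shows "measure (annulus_law i) A = measure lborel (annulus i \<inter> A) / measure lborel (annulus i :: 'a set)"
  using assms annulus_measure_pos[where 'a='a, of i]
  by (intro measure_uniform_measure) (auto simp: annulus_emeasure)

text \<open>The recursion of \<open>enumerate\<close> changes the set; this one keeps
  \<open>S\<close> fixed, so measurability in a random set follows by induction on the
  index.\<close>

primrec enum_nat :: "nat set \<Rightarrow> nat \<Rightarrow> nat" where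
  "enum_nat S 0 = (LEAST k. k \<in> S)"
| "enum_nat S (Suc n) = (LEAST k. k \<in> S \<and> enum_nat S n < k)"

lemma enum_nat_eq_enumerate: "infinite S \<Longrightarrow> enum_nat S n = enumerate S n"
  by (induction n) (simp_all add: enumerate_0 enumerate_Suc'')

text \<open>The classical construction: a Poisson number of independent uniform points in each
  annulus. An infinite array \<open>U (i, j)\<close> is drawn and the entries with
  \<open>j < N i\<close> are kept, so that numbers and positions live on a plain product
  space.\<close>

locale poisson_construction =
  fixes \<rho> :: real and d :: "'a::euclidean_space itself"
  assumes \<rho>: "0 < \<rho>"
begin

definition rate :: "nat \<Rightarrow> real" where
  "rate i = \<rho> * measure lborel (annulus i :: 'a set)"

definition counts :: "(nat \<Rightarrow> nat) measure" where
  "counts = (\<Pi>\<^sub>M i\<in>UNIV. measure_pmf (poisson_pmf (rate i)))"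

definition points :: "(nat \<times> nat \<Rightarrow> 'a) measure" where
  "points = (\<Pi>\<^sub>M p\<in>UNIV. annulus_law (fst p))"

lemma rate_pos: "0 < rate i"
  using \<rho> annulus_measure_pos[where 'a='a, of i] by (simp add: rate_def)

lemma annulus_product: "product_prob_space (\<lambda>p :: nat \<times> nat. annulus_law (fst p) :: 'a measure)"
  by (simp add: product_prob_space_def product_prob_space_axioms_def product_sigma_finite_def
      annulus_law_prob prob_space_imp_sigma_finite)

sublocale N: product_prob_space "\<lambda>i. measure_pmf (poisson_pmf (rate i))" "UNIV :: nat set"
  by unfold_locales

sublocale U: product_prob_space "\<lambda>p :: nat \<times> nat. annulus_law (fst p) :: 'a measure" "UNIV :: (nat \<times> nat) set"
  by (rule annulus_product)

sublocale base: pair_prob_space counts points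
  unfolding counts_def points_def ..

lemma space_points [simp]: "space points = UNIV" and space_counts [simp]: "space counts = UNIV"
  by (auto simp: points_def counts_def space_PiM)

lemma points_component [measurable]: "(\<lambda>U. U p) \<in> borel_measurable points"
proof -
  have "(\<lambda>U. U p) \<in> measurable points (annulus_law (fst p))"
    unfolding points_def by (rule measurable_component_singleton) simp
  then show ?thesis by (simp add: measurable_cong_sets[OF refl sets_uniform_measure])
qed

lemma counts_component [measurable]: "(\<lambda>N. N i) \<in> measurable counts (count_space UNIV)"
proof -
  have "(\<lambda>N. N i) \<in> measurable counts (measure_pmf (poisson_pmf (rate i)))"
    unfolding counts_def by (rule measurable_component_singleton) simp
  then show ?thesis by (simp add: measurable_cong_sets[OF refl sets_measure_pmf_count_space])
qed

lemma nn_integral_points: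
  fixes g :: "'a \<Rightarrow> ennreal"
  assumes "finite J" and g: "g \<in> borel_measurable borel"
  shows "(\<integral>\<^sup>+U. (\<Prod>p\<in>J. g (U p)) \<partial>points) = (\<Prod>p\<in>J. \<integral>\<^sup>+y. g y \<partial>annulus_law (fst p))"
  unfolding points_def using assms(1) g
  by (intro U.nn_integral_PiM_prod_subset[where f="\<lambda>_. g"]) (simp_all add: measurable_cong_sets[OF sets_uniform_measure refl])

lemma nn_integral_counts:
  assumes "finite J" "\<And>i. i \<in> J \<Longrightarrow> 0 \<le> c i"
  shows "(\<integral>\<^sup>+N. (\<Prod>i\<in>J. ennreal (c i) ^ N i) \<partial>counts) = (\<Prod>i\<in>J. ennreal (exp (- (rate i * (1 - c i)))))"
proof -
  have "(\<integral>\<^sup>+N. (\<Prod>i\<in>J. ennreal (c i) ^ N i) \<partial>counts) =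
      (\<Prod>i\<in>J. \<integral>\<^sup>+n. ennreal (c i) ^ n \<partial>measure_pmf (poisson_pmf (rate i)))"
    unfolding counts_def using assms
    by (intro N.nn_integral_PiM_prod_subset[where f="\<lambda>i n. ennreal (c i) ^ n"]) simp_all
  also have "\<dots> = (\<Prod>i\<in>J. ennreal (exp (- (rate i * (1 - c i)))))"
  proof (rule prod.cong[OF refl])
    fix i assume "i \<in> J"
    have "(\<integral>\<^sup>+n. ennreal (c i) ^ n \<partial>measure_pmf (poisson_pmf (rate i))) =
        (\<Sum>n. ennreal (pmf (poisson_pmf (rate i)) n) * ennreal (c i) ^ n)"
      by (simp add: nn_integral_measure_pmf nn_integral_count_space_nat)
    also have "\<dots> = (\<Sum>n. ennreal (c i) ^ n * ennreal (exp (- rate i) * rate i ^ n / fact n))"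
      by (simp add: pmf_poisson[OF rate_pos] mult.commute)
    also have "\<dots> = ennreal (exp (- (rate i * (1 - c i))))"
      using assms(2)[OF \<open>i \<in> J\<close>] rate_pos[of i] by (intro poisson_pgf) auto
    finally show "(\<integral>\<^sup>+n. ennreal (c i) ^ n \<partial>measure_pmf (poisson_pmf (rate i))) =
        ennreal (exp (- (rate i * (1 - c i))))" .
  qed
  finally show ?thesis .
qed

definition active :: "(nat \<Rightarrow> nat) \<Rightarrow> (nat \<times> nat) set" where
  "active N = {p. snd p < N (fst p)}"

text \<open>Given the numbers, every point of annulus i contributes its mean factor; averaging over
  the Poisson number yields an exponential, and the exponents of the annuli add up to the volume of
  \<open>A\<close>.\<close>

lemma generating_function:
  assumes A: "A \<in> sets borel" "A \<subseteq> ball (0::'a) (real m)" and s: "0 \<le> s" "s < 1"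
  shows "(\<integral>\<^sup>+w. (\<Prod>i<m. \<Prod>j<fst w i. if snd w (i, j) \<in> A then ennreal s else 1) \<partial>(counts \<Otimes>\<^sub>M points)) =
    ennreal (exp (- (\<rho> * measure lborel A * (1 - s))))"
proof -
  define g where "g y = (if y \<in> A then ennreal s else 1)" for y
  have gm: "g \<in> borel_measurable borel" unfolding g_def using A(1) by measurable
  \<comment> \<open>The mean of the factor \<open>g\<close> at a uniform point of annulus i.\<close>
  define a where "a i = 1 - (1 - s) * measure (annulus_law i) A" for i
  have a0: "0 \<le> a i" for i
  proof -
    interpret prob_space "annulus_law i :: 'a measure" by (rule annulus_law_prob)
    have "(1 - s) * prob A \<le> 1 * 1" using s by (intro mult_mono) auto
    then show ?thesis by (simp add: a_def)
  qed
  have inner: "(\<integral>\<^sup>+y. g y \<partial>annulus_law i) = ennreal (a i)" for i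
  proof -
    interpret prob_space "annulus_law i :: 'a measure" by (rule annulus_law_prob)
    have "(\<integral>\<^sup>+y. g y \<partial>annulus_law i) =
        (\<integral>\<^sup>+y. ennreal s * indicator A y + indicator (space (annulus_law i) - A) y \<partial>annulus_law i)"
      by (rule nn_integral_cong) (auto simp: g_def)
    also have "\<dots> = ennreal s * emeasure (annulus_law i) A + emeasure (annulus_law i) (space (annulus_law i) - A)"
      using A by (subst nn_integral_add)
        (auto simp: nn_integral_cmult_indicator measurable_cong_sets[OF sets_uniform_measure refl])
    also have "\<dots> = ennreal s * ennreal (prob A) + ennreal (1 - prob A)"
      using prob_compl[of A] A by (simp add: emeasure_eq_measure)
    also have "\<dots> = ennreal (a i)"
      using s by (simp add: a_def algebra_simps flip: ennreal_mult ennreal_plus)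
    finally show ?thesis .
  qed
  have m: "(\<lambda>w. \<Prod>i<m. \<Prod>j<fst w i. g (snd w (i, j))) \<in> borel_measurable (counts \<Otimes>\<^sub>M points)"
  proof (rule borel_measurable_prod_ennreal)
    fix i
    have "(\<lambda>w. fst w i) \<in> measurable (counts \<Otimes>\<^sub>M points) (count_space UNIV)"
      by (rule measurable_compose[OF measurable_fst counts_component])
    moreover have "(\<lambda>w. \<Prod>j<n. g (snd w (i, j))) \<in> borel_measurable (counts \<Otimes>\<^sub>M points)" for n
      by (intro borel_measurable_prod_ennreal measurable_compose[OF _ gm]
          measurable_compose[OF measurable_snd points_component])
    ultimately show "(\<lambda>w. \<Prod>j<fst w i. g (snd w (i, j))) \<in> borel_measurable (counts \<Otimes>\<^sub>M points)"
      by (rule measurable_compose_countable[rotated])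
  qed
  have "(\<integral>\<^sup>+w. (\<Prod>i<m. \<Prod>j<fst w i. g (snd w (i, j))) \<partial>(counts \<Otimes>\<^sub>M points)) =
      (\<integral>\<^sup>+N. \<integral>\<^sup>+U. (\<Prod>i<m. \<Prod>j<N i. g (U (i, j))) \<partial>points \<partial>counts)"
    by (subst base.M2.nn_integral_fst[OF m, symmetric]) simp
  also have "\<dots> = (\<integral>\<^sup>+N. (\<Prod>i<m. ennreal (a i) ^ N i) \<partial>counts)"
  proof (rule nn_integral_cong)
    fix N
    have "(\<integral>\<^sup>+U. (\<Prod>i<m. \<Prod>j<N i. g (U (i, j))) \<partial>points) =
        (\<integral>\<^sup>+U. (\<Prod>p\<in>(SIGMA i:{..<m}. {..<N i}). g (U p)) \<partial>points)"
      by (simp add: prod.Sigma split_beta)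
    also have "\<dots> = (\<Prod>p\<in>(SIGMA i:{..<m}. {..<N i}). ennreal (a (fst p)))"
      by (simp add: nn_integral_points gm inner)
    also have "\<dots> = (\<Prod>i<m. \<Prod>j<N i. ennreal (a i))"
      using prod.Sigma[of "{..<m}" "\<lambda>i. {..<N i}" "\<lambda>i j. ennreal (a i)"] by (simp add: split_beta)
    finally show "(\<integral>\<^sup>+U. (\<Prod>i<m. \<Prod>j<N i. g (U (i, j))) \<partial>points) = (\<Prod>i<m. ennreal (a i) ^ N i)" by simp
  qed
  also have "\<dots> = (\<Prod>i<m. ennreal (exp (- (rate i * (1 - a i)))))"
    by (rule nn_integral_counts) (auto simp: a0)
  also have "\<dots> = ennreal (exp (\<Sum>i<m. - (rate i * (1 - a i))))"
    by (simp add: prod_ennreal exp_sum)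
  also have "(\<Sum>i<m. - (rate i * (1 - a i))) = - (\<rho> * measure lborel A * (1 - s))"
  proof -
    \<comment> \<open>The normalising volume of the uniform law cancels against
      \<open>rate i\<close>.\<close>
    have "rate i * (1 - a i) = \<rho> * (1 - s) * measure lborel (annulus i \<inter> A)" for i
      using annulus_measure_pos[where 'a='a, of i] by (simp add: rate_def a_def annulus_law_measure[OF A(1)])
    then have "(\<Sum>i<m. - (rate i * (1 - a i))) = - (\<rho> * (1 - s) * (\<Sum>i<m. measure lborel (annulus i \<inter> A)))"
      by (simp add: sum_negf sum_distrib_left)
    also have "(\<Sum>i<m. measure lborel (annulus i \<inter> A)) = measure lborel (\<Union>i<m. annulus i \<inter> A)"
    proof (rule measure_finite_Union[symmetric])
      show "(\<lambda>i. annulus i \<inter> A) ` {..<m} \<subseteq> sets lborel" using A by auto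
      show "disjoint_family_on (\<lambda>i. annulus i \<inter> A) {..<m}"
        by (auto simp: disjoint_family_on_def annulus_iff)
      show "emeasure lborel (annulus i \<inter> A) \<noteq> \<infinity>" if "i \<in> {..<m}" for i
        using emeasure_bounded_finite[of "annulus i \<inter> A"] annulus_bounded[where 'a='a, of i]
        by (simp add: bounded_Int)
    qed simp
    also have "(\<Union>i<m. annulus i \<inter> A) = A"
    proof -
      have "nat \<lfloor>norm y\<rfloor> < m" if "y \<in> A" for y
      proof -
        have "norm y < real m" using that A(2) by (auto simp: subset_iff)
        then have "\<lfloor>norm y\<rfloor> < int m" by (simp add: floor_less_iff)
        moreover have "0 < m" using \<open>norm y < real m\<close> norm_ge_zero[of y] by linarith
        ultimately show ?thesis by simp
      qed
      then show ?thesis by (auto simp: annulus_iff)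
    qed
    finally show ?thesis by (simp add: algebra_simps)
  qed
  finally show ?thesis by (simp add: g_def)
qed

end

section \<open>From the array of points to an enumeration\<close>

context poisson_construction
begin

definition codes :: "(nat \<Rightarrow> nat) \<times> (nat \<times> nat \<Rightarrow> 'a) \<Rightarrow> nat set" where
  "codes w = {k. snd (prod_decode k) < fst w (fst (prod_decode k))}"

text \<open>An almost sure event. Off this event the enumeration switches to
  \<open>default_seq\<close>, because \<open>point_seq_space\<close> only contains injective locally
  finite sequences.\<close>

definition good :: "(nat \<Rightarrow> nat) \<times> (nat \<times> nat \<Rightarrow> 'a) \<Rightarrow> bool" where
  "good w \<longleftrightarrow> (\<forall>p. snd w p \<in> annulus (fst p)) \<and> (\<forall>p q. p \<noteq> q \<longrightarrow> snd w p \<noteq> snd w q) \<and>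
     (\<forall>n. \<exists>k>n. k \<in> codes w)"

definition default_seq :: "nat \<Rightarrow> 'a" where
  "default_seq n = real n *\<^sub>R (SOME b. b \<in> Basis)"

definition enumeration :: "(nat \<Rightarrow> nat) \<times> (nat \<times> nat \<Rightarrow> 'a) \<Rightarrow> nat \<Rightarrow> 'a" where
  "enumeration w = (if good w then (\<lambda>n. snd w (prod_decode (enum_nat (codes w) n))) else default_seq)"

lemma default_seq: "inj default_seq" "locally_finite_set (range default_seq)"
proof -
  define b :: 'a where "b = (SOME b. b \<in> Basis)"
  have b: "b \<in> Basis" unfolding b_def by (rule someI_ex) (use nonempty_Basis in blast)
  then have nz: "b \<noteq> 0" and nb: "norm b = 1" by auto
  show "inj default_seq"
    using nz by (auto simp: inj_def default_seq_def b_def[symmetric])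
  show "locally_finite_set (range default_seq)"
    unfolding locally_finite_set_def
  proof (intro allI impI)
    fix K :: "'a set" assume "bounded K"
    then obtain m where m: "K \<subseteq> ball 0 m" using bounded_subset_ballD by blast
    have "range default_seq \<inter> K \<subseteq> default_seq ` {..nat \<lceil>m\<rceil>}"
    proof
      fix y assume "y \<in> range default_seq \<inter> K"
      then obtain n where n: "y = default_seq n" "norm y < m" using m by (auto simp: subset_iff)
      then have "real n < m" using nb by (simp add: default_seq_def b_def[symmetric])
      then have "n \<le> nat \<lceil>m\<rceil>" by linarith
      then show "y \<in> default_seq ` {..nat \<lceil>m\<rceil>}" using n by blast
    qed
    then show "finite (range default_seq \<inter> K)" by (rule finite_subset) simp
  qed
qed

lemma annulus_norm: "y \<in> annulus i \<Longrightarrow> norm y < real m \<Longrightarrow> i < m"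
  by (simp add: annulus_def)

lemma goodD:
  assumes "good w"
  shows "snd w p \<in> annulus (fst p)" "inj (snd w)" "infinite (codes w)"
  using assms unfolding good_def inj_def infinite_nat_iff_unbounded by blast+

lemma good_enumeration:
  assumes "good w"
  shows "inj (enumeration w)" "range (enumeration w) = snd w ` active (fst w)"
    "locally_finite_set (range (enumeration w))"
proof -
  note inf = goodD(3)[OF assms] and injU = goodD(2)[OF assms]
  have e: "enumeration w = snd w \<circ> prod_decode \<circ> enumerate (codes w)"
    using assms by (simp add: enumeration_def fun_eq_iff enum_nat_eq_enumerate[OF inf])
  have bij: "bij_betw (enumerate (codes w)) UNIV (codes w)" by (rule bij_enumerate[OF inf])
  show "inj (enumeration w)"
    unfolding e using bij by (intro inj_compose injU inj_prod_decode) (auto simp: bij_betw_def)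
  have "prod_decode ` codes w = active (fst w)"
  proof (intro set_eqI iffI)
    fix p assume "p \<in> active (fst w)"
    then have "prod_encode p \<in> codes w" by (simp add: codes_def active_def)
    then show "p \<in> prod_decode ` codes w" by (metis image_eqI prod_encode_inverse)
  qed (auto simp: codes_def active_def)
  then show r: "range (enumeration w) = snd w ` active (fst w)"
  proof -
    have "range (enumeration w) = snd w ` prod_decode ` range (enumerate (codes w))"
      unfolding e by (simp only: image_comp o_assoc)
    also have "\<dots> = snd w ` prod_decode ` codes w" using bij by (simp only: bij_betw_def)
    finally show ?thesis by (simp only: \<open>prod_decode ` codes w = active (fst w)\<close>)
  qed
  show "locally_finite_set (range (enumeration w))"
    unfolding locally_finite_set_def
  proof (intro allI impI)
    fix K :: "'a set" assume "bounded K"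
    then obtain r0 where "K \<subseteq> ball 0 r0" using bounded_subset_ballD by blast
    moreover obtain m :: nat where "r0 < real m" using reals_Archimedean2 by blast
    ultimately have K: "norm y < real m" if "y \<in> K" for y using that by (force simp: subset_iff)
    have "range (enumeration w) \<inter> K \<subseteq> snd w ` (SIGMA i:{..<m}. {..<fst w i})"
    proof
      fix y assume "y \<in> range (enumeration w) \<inter> K"
      then obtain p where p: "p \<in> active (fst w)" "y = snd w p" "norm y < real m" using K r by auto
      moreover have "y \<in> annulus (fst p)" using goodD(1)[OF assms] p(2) by simp
      ultimately have "p \<in> (SIGMA i:{..<m}. {..<fst w i})"
        using annulus_norm by (cases p) (auto simp: active_def)
      then show "y \<in> snd w ` (SIGMA i:{..<m}. {..<fst w i})" using p by blast
    qed
    then show "finite (range (enumeration w) \<inter> K)" by (rule finite_subset) auto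
  qed
qed

lemma good_count:
  assumes "good w" and A: "A \<subseteq> ball 0 (real m)"
  shows "card (range (enumeration w) \<inter> A) = card {p \<in> (SIGMA i:{..<m}. {..<fst w i}). snd w p \<in> A}"
proof -
  have "range (enumeration w) \<inter> A = snd w ` {p \<in> (SIGMA i:{..<m}. {..<fst w i}). snd w p \<in> A}"
    (is "_ = snd w ` ?J")
  proof (intro set_eqI iffI)
    fix y assume "y \<in> range (enumeration w) \<inter> A"
    then obtain p where p: "p \<in> active (fst w)" "y = snd w p" "y \<in> A"
      using good_enumeration(2)[OF assms(1)] by auto
    moreover have "y \<in> annulus (fst p)" using goodD(1)[OF assms(1)] p(2) by simp
    moreover have "norm y < real m" using A p(3) by (auto simp: subset_iff)
    ultimately show "y \<in> snd w ` ?J"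
      using annulus_norm by (cases p) (auto simp: active_def)
  next
    fix y assume "y \<in> snd w ` ?J"
    then show "y \<in> range (enumeration w) \<inter> A"
      unfolding good_enumeration(2)[OF assms(1)] by (auto simp: active_def)
  qed
  moreover have "inj_on (snd w) ?J"
    using goodD(2)[OF assms(1)] by (rule inj_on_subset) simp
  ultimately show ?thesis by (simp add: card_image)
qed

lemma codes_measurable:
  "Measurable.pred (counts \<Otimes>\<^sub>M points) (\<lambda>w. k \<in> codes w)"
proof -
  have "(\<lambda>w. fst w i) \<in> measurable (counts \<Otimes>\<^sub>M points) (count_space UNIV)" for i
    by (rule measurable_compose[OF measurable_fst counts_component])
  note [measurable] = this
  show ?thesis unfolding codes_def mem_Collect_eq by measurable
qed

lemma points_snd_measurable: "(\<lambda>w. snd w p) \<in> borel_measurable (counts \<Otimes>\<^sub>M points)"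
  by (rule measurable_compose[OF measurable_snd points_component])

lemma good_measurable: "Measurable.pred (counts \<Otimes>\<^sub>M points) good"
proof -
  note [measurable] = codes_measurable
  have [measurable]: "Measurable.pred (counts \<Otimes>\<^sub>M points) (\<lambda>w. snd w p \<in> annulus i)" for p i
    by (rule measurable_compose[OF points_snd_measurable]) simp
  have [measurable]: "Measurable.pred (counts \<Otimes>\<^sub>M points) (\<lambda>w. snd w p \<noteq> snd w q)" for p q
  proof -
    have "(\<lambda>w. snd w p - snd w q) \<in> borel_measurable (counts \<Otimes>\<^sub>M points)"
      by (intro borel_measurable_diff points_snd_measurable)
    then have "Measurable.pred (counts \<Otimes>\<^sub>M points) (\<lambda>w. snd w p - snd w q \<noteq> 0)"
      by (rule measurable_compose) simp
    then show ?thesis by simp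
  qed
  show ?thesis unfolding good_def by measurable
qed

lemma enum_measurable:
  "(\<lambda>w. enum_nat (codes w) n) \<in> measurable (counts \<Otimes>\<^sub>M points) (count_space UNIV)"
proof (induction n)
  note [measurable] = codes_measurable
  case 0
  show ?case unfolding enum_nat.simps by measurable
next
  note [measurable] = codes_measurable
  case (Suc n)
  note [measurable] = this
  show ?case unfolding enum_nat.simps by measurable
qed

lemma enumeration_measurable: "enumeration \<in> measurable (counts \<Otimes>\<^sub>M points) point_seq_space"
  unfolding point_seq_space_def
proof (rule measurable_restrict_space2)
  show "enumeration \<in> space (counts \<Otimes>\<^sub>M points) \<rightarrow> {x. inj x \<and> locally_finite_set (range x)}"
  proof
    fix w show "enumeration w \<in> {x. inj x \<and> locally_finite_set (range x)}"
    proof (cases "good w")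
      case False
      then have "enumeration w = default_seq" by (simp add: enumeration_def)
      then show ?thesis using default_seq by simp
    qed (use good_enumeration in simp)
  qed
  show "enumeration \<in> measurable (counts \<Otimes>\<^sub>M points) (\<Pi>\<^sub>M n\<in>UNIV. borel)"
  proof (rule measurable_PiM_single')
    fix n :: nat
    have "(\<lambda>w. snd w (prod_decode (enum_nat (codes w) n))) \<in> borel_measurable (counts \<Otimes>\<^sub>M points)"
      by (rule measurable_compose_countable[OF points_snd_measurable enum_measurable])
    then have "(\<lambda>w. if good w then snd w (prod_decode (enum_nat (codes w) n)) else default_seq n)
        \<in> borel_measurable (counts \<Otimes>\<^sub>M points)"
      by (rule measurable_If) (use good_measurable in \<open>simp_all add: pred_def\<close>)
    then show "(\<lambda>w. enumeration w n) \<in> borel_measurable (counts \<Otimes>\<^sub>M points)"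
      by (simp add: enumeration_def if_distrib[where f="\<lambda>x. x n"] cong: if_cong)
  qed (simp add: space_PiM)
qed

lemma AE_counts_unbounded: "AE N in counts. \<forall>n. \<exists>i>n. 0 < N i"
proof -

  \<comment> \<open>\<open>q\<close> bounds the probability of an empty annulus uniformly in its
    index, so m consecutive empty annuli have probability at most \<open>q ^ m\<close>.\<close>
  define q where "q = exp (- (\<rho> * measure lborel (ball 0 1 :: 'a set)))"
  have q: "0 < q" "q < 1"
    using \<rho> content_ball_pos[of 1 "0::'a"] by (auto simp: q_def)
  have z: "emeasure (poisson_pmf (rate i)) {0} = ennreal (exp (- rate i))" for i
    by (simp add: emeasure_pmf_single pmf_poisson[OF rate_pos])
  have le_q: "exp (- rate i) \<le> q" for i
    using \<rho> annulus_measure_ge[where 'a='a, of i] by (simp add: q_def rate_def)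
  have "AE N in counts. \<exists>i>n. 0 < N i" for n
  proof (rule AE_I)
    let ?Z = "{N \<in> space counts. \<forall>i>n. N i = 0}"
    have Zm: "?Z \<in> sets counts" by measurable
    have le: "measure counts ?Z \<le> q ^ m" for m
    proof -
      have "emeasure counts ?Z \<le> emeasure counts {N \<in> space counts. \<forall>i\<in>{n<..n+m}. N i \<in> {0}}"
      proof (rule emeasure_mono)
        show "{N \<in> space counts. \<forall>i\<in>{n<..n+m}. N i \<in> {0}} \<in> sets counts"
          unfolding singleton_iff by measurable
      qed auto
      also have "\<dots> = (\<Prod>i\<in>{n<..n+m}. emeasure (poisson_pmf (rate i)) {0})"
        unfolding counts_def by (rule N.emeasure_PiM_Collect) auto
      also have "\<dots> = ennreal (\<Prod>i\<in>{n<..n+m}. exp (- rate i))"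
        by (simp add: z prod_ennreal)
      also have "\<dots> \<le> ennreal (q ^ m)"
        using prod_mono[of "{n<..n+m}" "\<lambda>i. exp (- rate i)" "\<lambda>_. q"] le_q
        by (intro ennreal_leI) simp
      finally show ?thesis using q by (simp add: base.M1.emeasure_eq_measure)
    qed
    have "(\<lambda>m. q ^ m) \<longlonglongrightarrow> 0" using q by (intro LIMSEQ_realpow_zero) auto
    then have "measure counts ?Z \<le> 0" by (rule LIMSEQ_le_const) (use le in blast)
    then show "emeasure counts ?Z = 0"
      using measure_nonneg[of counts ?Z] by (simp add: base.M1.emeasure_eq_measure del: measure_nonneg)
    show "?Z \<in> sets counts" by (rule Zm)
    show "{N \<in> space counts. \<not> (\<exists>i>n. 0 < N i)} \<subseteq> ?Z" by auto
  qed
  then show ?thesis by (simp add: AE_all_countable)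
qed

lemma AE_points: "AE U in points. (\<forall>p. U p \<in> annulus (fst p)) \<and> (\<forall>p q. p \<noteq> q \<longrightarrow> U p \<noteq> U q)"
proof -
  have 1: "AE U in points. U p \<in> annulus (fst p)" for p
    unfolding points_def
  proof (rule AE_PiM_component)
    show "AE y in annulus_law (fst p). y \<in> annulus (fst p)"
      by (rule AE_uniform_measureI) auto
  qed (auto simp: annulus_law_prob)
  have 2: "AE U in points. U p \<noteq> U q" if "p \<noteq> q" for p q
    unfolding points_def
  proof (rule AE_PiM_components_neq)
    fix y :: 'a
    have "emeasure lborel (annulus (fst q) \<inter> {y}) \<le> emeasure lborel {y}"
      by (intro emeasure_mono) auto
    then show "emeasure (annulus_law (fst q)) {y} = 0"
      using annulus_measure_pos[where 'a='a, of "fst q"] by simp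
  qed (use that in \<open>auto simp: annulus_law_prob\<close>)
  have 3: "AE U in points. p \<noteq> q \<longrightarrow> U p \<noteq> U q" for p q
    by (cases "p = q") (auto intro: 2)
  show ?thesis unfolding AE_conj_iff AE_all_countable using 1 3 by blast
qed

lemma AE_good: "AE w in counts \<Otimes>\<^sub>M points. good w"
proof (rule base.AE_pair_measure)
  show "{w \<in> space (counts \<Otimes>\<^sub>M points). good w} \<in> sets (counts \<Otimes>\<^sub>M points)"
    using good_measurable by (simp add: pred_def)
  show "AE N in counts. AE U in points. good (N, U)"
    using AE_counts_unbounded
  proof eventually_elim
    case (elim N)
    have "\<exists>k>n. k \<in> codes (N, U)" for n U
    proof -
      \<comment> \<open>A nonempty annulus i has the active slot (i, 0), whose code is at least
        i.\<close>
      obtain i where "i > n" "0 < N i" using elim by blast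
      then have "prod_encode (i, 0) \<in> codes (N, U)" "prod_encode (i, 0) > n"
        using le_prod_encode_1[of i 0] by (auto simp: codes_def)
      then show ?thesis by blast
    qed
    then show ?case using AE_points by (auto simp: good_def)
  qed
qed

lemma poisson_enumeration:
  "poisson_enumeration \<rho> (distr (counts \<Otimes>\<^sub>M points) point_seq_space enumeration)"
proof (rule poisson_enumerationI)
  show "prob_space (distr (counts \<Otimes>\<^sub>M points) point_seq_space enumeration)"
    by (rule base.prob_space_distr[OF enumeration_measurable])
  fix A :: "'a set" and s :: real
  assume A: "A \<in> sets borel" "bounded A" and s: "0 \<le> s" "s < 1"
  obtain r0 where "A \<subseteq> ball 0 r0" using A bounded_subset_ballD by blast
  moreover obtain m :: nat where "r0 < real m" using reals_Archimedean2 by blast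
  ultimately have Am: "A \<subseteq> ball 0 (real m)" by (force simp: subset_iff)
  have "(\<integral>\<^sup>+x. ennreal s ^ card (range x \<inter> A) \<partial>distr (counts \<Otimes>\<^sub>M points) point_seq_space enumeration) =
      (\<integral>\<^sup>+w. ennreal s ^ card (range (enumeration w) \<inter> A) \<partial>(counts \<Otimes>\<^sub>M points))"
    using measurable_compose[OF point_seq_count_measurable[OF A], of "\<lambda>k. ennreal s ^ k" borel]
    by (subst nn_integral_distr[OF enumeration_measurable]) simp_all
  also have "\<dots> = (\<integral>\<^sup>+w. (\<Prod>i<m. \<Prod>j<fst w i. if snd w (i, j) \<in> A then ennreal s else 1) \<partial>(counts \<Otimes>\<^sub>M points))"
  proof (rule nn_integral_cong_AE)
    show "AE w in counts \<Otimes>\<^sub>M points. ennreal s ^ card (range (enumeration w) \<inter> A) =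
      (\<Prod>i<m. \<Prod>j<fst w i. if snd w (i, j) \<in> A then ennreal s else 1)"
      using AE_good
    proof eventually_elim
      case (elim w)
      let ?J = "SIGMA i:{..<m}. {..<fst w i}"
      have "(\<Prod>i<m. \<Prod>j<fst w i. if snd w (i, j) \<in> A then ennreal s else 1) =
          (\<Prod>p\<in>?J. if snd w p \<in> A then ennreal s else 1)"
        using prod.Sigma[of "{..<m}" "\<lambda>i. {..<fst w i}" "\<lambda>i j. if snd w (i, j) \<in> A then ennreal s else 1"]
        by (simp add: split_beta)
      also have "\<dots> = (\<Prod>p\<in>{p \<in> ?J. snd w p \<in> A}. ennreal s)"
        by (rule prod.inter_filter[symmetric]) auto
      also have "\<dots> = ennreal s ^ card (range (enumeration w) \<inter> A)"
        using good_count[OF elim Am] by simp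
      finally show ?case by simp
    qed
  qed
  also have "\<dots> = ennreal (exp (- (\<rho> * measure lborel A * (1 - s))))"
    by (rule generating_function[OF A(1) Am s])
  finally show "(\<integral>\<^sup>+x. ennreal s ^ card (range x \<inter> A) \<partial>distr (counts \<Otimes>\<^sub>M points) point_seq_space enumeration) = \<dots>" .
qed (use \<rho> in auto)

end

text \<open>Every enumeration gives the same avoidance function and one enumeration exists, so the
  definite description denotes. From here on \<open>PPP\<close> is seen through
  \<open>poisson_law\<close>.\<close>

lemma poisson_law_PPP:
  assumes "0 < \<rho>" and \<nu>: "real_distribution \<nu>"
  shows "poisson_law \<rho> \<nu> (PPP \<rho> \<nu> :: ('a::euclidean_space \<times> real) set measure)"
proof -
  interpret poisson_construction \<rho> "TYPE('a)" by unfold_locales fact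
  let ?Q = "\<lambda>M. \<exists>\<mu> :: (nat \<Rightarrow> 'a) measure. poisson_enumeration \<rho> \<mu> \<and>
     M = distr (\<mu> \<Otimes>\<^sub>M (\<Pi>\<^sub>M n\<in>UNIV. \<nu>)) config_space attach_marks"
  have Q: "poisson_law \<rho> \<nu> M" if "?Q M" for M
    using that poisson_law_of_enumeration[OF _ less_imp_le[OF assms(1)] \<nu>] by blast
  have "\<exists>!M. ?Q M"
    using poisson_enumeration Q poisson_law_unique by blast
  then have "?Q (THE M. ?Q M)" by (rule theI')
  then show ?thesis using Q unfolding PPP_def attach_marks_def by blast
qed

subsection \<open>Measurability of percolation\<close>

lemma config_count_measurable:
  assumes "bounded_region B"
  shows "(\<lambda>\<omega>. card (\<omega> \<inter> B)) \<in> measurable config_space (count_space UNIV)"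
proof (rule nat_measurable_count, rule card_eq_measurable)
  show "finite (\<omega> \<inter> B)" if "\<omega> \<in> space config_space" for \<omega>
    using that assms by (intro config_finite) (auto simp: bounded_region_def)
  show "{\<omega> \<in> space config_space. \<omega> \<inter> B' = {}} \<in> sets config_space" if "B' \<in> sets borel" "B' \<subseteq> B" for B'
    using avoid_sets[OF bounded_region_subset[OF assms that(2,1)]] by (simp add: avoid_def)
qed (use assms in \<open>simp add: bounded_region_def\<close>)

text \<open>A uniformly random point of a finite configuration, viewed as a kernel. Existence of a
  point with some property becomes positivity of a mass that depends measurably on the
  configuration, so no measurable selection of points is involved.\<close>

definition uniform_point :: "('a::euclidean_space \<times> real) set \<Rightarrow> ('a \<times> real) measure" where
  "uniform_point S = (if S = {} then null_measure borel else distr (measure_pmf (pmf_of_set S)) borel (\<lambda>p. p))"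

lemma emeasure_uniform_point:
  assumes "finite S" "A \<in> sets borel"
  shows "emeasure (uniform_point S) A = ennreal (real (card (S \<inter> A)) / real (card S))"
  using assms by (auto simp: uniform_point_def emeasure_distr emeasure_pmf_of_set measure_pmf.emeasure_eq_measure measure_pmf_of_set)

lemma sets_uniform_point [simp]: "sets (uniform_point S) = sets borel"
  by (simp add: uniform_point_def)

lemma uniform_point_kernel:
  assumes K: "bounded_region K"
  shows "(\<lambda>\<omega>. uniform_point (\<omega> \<inter> K)) \<in> measurable config_space (subprob_algebra borel)"
proof (rule measurable_subprob_algebra)
  fix A :: "('a \<times> real) set" assume A: "A \<in> sets borel"
  have KA: "bounded_region (K \<inter> A)"
    using K A by (intro bounded_region_subset[OF K]) (auto simp: bounded_region_def)
  have "(\<lambda>\<omega>. ennreal (real (card (\<omega> \<inter> (K \<inter> A))) / real (card (\<omega> \<inter> K)))) \<in> borel_measurable config_space"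
    using config_count_measurable[OF K] config_count_measurable[OF KA] by measurable
  then show "(\<lambda>\<omega>. emeasure (uniform_point (\<omega> \<inter> K)) A) \<in> borel_measurable config_space"
    using A K by (subst measurable_cong[OF emeasure_uniform_point])
      (auto simp: Int_assoc config_finite bounded_region_def)
next
  fix \<omega> :: "('a \<times> real) set"
  show "subprob_space (uniform_point (\<omega> \<inter> K))"
  proof (cases "\<omega> \<inter> K = {}")
    case True
    then show ?thesis by (simp add: uniform_point_def subprob_space_null_measure)
  next
    case False
    then show ?thesis
      by (auto simp: uniform_point_def intro!: prob_space_imp_subprob_space measure_pmf.prob_space_distr)
  qed
qed simp

lemma ex_bounded_config_point_measurable:
  assumes T: "T \<in> measurable M config_space" and K: "bounded_region K"
    and \<Phi>: "\<Phi> \<in> sets (M \<Otimes>\<^sub>M borel)"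
  shows "{w \<in> space M. \<exists>p\<in>T w \<inter> K. (w, p) \<in> \<Phi>} \<in> sets M"
proof -
  have L: "(\<lambda>w. uniform_point (T w \<inter> K)) \<in> measurable M (subprob_algebra borel)"
    by (rule measurable_compose[OF T uniform_point_kernel[OF K]])
  have eq: "(SIGMA w:space M. Pair w -` \<Phi>) = \<Phi>"
    using sets.sets_into_space[OF \<Phi>] by (auto simp: space_pair_measure)
  have m: "(\<lambda>w. emeasure (uniform_point (T w \<inter> K)) (Pair w -` \<Phi>)) \<in> borel_measurable M"
    by (rule emeasure_measurable_subprob_algebra2[OF _ L]) (simp add: eq \<Phi>)
  have "{w \<in> space M. \<exists>p\<in>T w \<inter> K. (w, p) \<in> \<Phi>} =
      {w \<in> space M. 0 < emeasure (uniform_point (T w \<inter> K)) (Pair w -` \<Phi>)}"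
  proof (intro Collect_cong conj_cong refl)
    fix w assume "w \<in> space M"
    then have fin: "finite (T w \<inter> K)"
      using measurable_space[OF T] K by (intro config_finite) (auto simp: bounded_region_def)
    have "0 < emeasure (uniform_point (T w \<inter> K)) (Pair w -` \<Phi>) \<longleftrightarrow> T w \<inter> K \<inter> Pair w -` \<Phi> \<noteq> {}"
      unfolding emeasure_uniform_point[OF fin sets_Pair1[OF \<Phi>]]
      using fin by (auto simp: zero_less_divide_iff card_gt_0_iff)
    then show "(\<exists>p\<in>T w \<inter> K. (w, p) \<in> \<Phi>) \<longleftrightarrow> 0 < emeasure (uniform_point (T w \<inter> K)) (Pair w -` \<Phi>)"
      by auto
  qed
  also have "\<dots> \<in> sets M" using m by measurable
  finally show ?thesis .
qed

lemma ex_config_point_measurable: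
  fixes T :: "'c \<Rightarrow> ('a::euclidean_space \<times> real) set"
  assumes T: "T \<in> measurable M config_space" and \<Phi>: "\<Phi> \<in> sets (M \<Otimes>\<^sub>M borel)"
  shows "{w \<in> space M. \<exists>p\<in>T w. (w, p) \<in> \<Phi>} \<in> sets M"
proof -
  let ?K = "\<lambda>n. ball 0 (real n) \<times> UNIV :: ('a \<times> real) set"
  have "p \<in> ?K (nat \<lceil>norm (fst p)\<rceil> + 1)" for p
    using norm_ge_zero[of "fst p"] by (cases p) (auto; linarith)
  then have "{w \<in> space M. \<exists>p\<in>T w. (w, p) \<in> \<Phi>} = (\<Union>n. {w \<in> space M. \<exists>p\<in>T w \<inter> ?K n. (w, p) \<in> \<Phi>})"
    by blast
  also have "\<dots> \<in> sets M"
    using ex_bounded_config_point_measurable[OF T bounded_region_Times \<Phi>] by auto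
  finally show ?thesis .
qed

definition close :: "real \<Rightarrow> real \<Rightarrow> 'a::euclidean_space \<times> real \<Rightarrow> 'a \<times> real \<Rightarrow> bool" where
  "close \<zeta> \<beta> p q \<longleftrightarrow> norm (fst p - fst q) + \<beta> * (\<bar>snd p\<bar> + \<bar>snd q\<bar> + \<bar>snd p - snd q\<bar>) \<le> \<zeta>"

lemma graph_edges_iff:
  "(x, y) \<in> graph_edges \<zeta> \<beta> \<omega> \<longleftrightarrow>
     x \<noteq> y \<and> (\<exists>p\<in>\<omega>. \<exists>q\<in>\<omega>. fst p = x \<and> fst q = y \<and> close \<zeta> \<beta> p q)"
  by (force simp: graph_edges_def close_def)

lemma config_unique: "\<omega> \<in> configs \<Longrightarrow> p \<in> \<omega> \<Longrightarrow> q \<in> \<omega> \<Longrightarrow> fst p = fst q \<Longrightarrow> p = q"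
  unfolding configs_def by (cases p; cases q) auto

text \<open>Paths are unrolled into one quantifier over configuration points per step, the form to
  which \<open>ex_config_point_measurable\<close> applies. A step may stay at its point, which does
  not affect reachability.\<close>

primrec reaches_far :: "real \<Rightarrow> real \<Rightarrow> real \<Rightarrow> nat \<Rightarrow> ('a::euclidean_space \<times> real) set \<Rightarrow> 'a \<times> real \<Rightarrow> bool" where
  "reaches_far \<zeta> \<beta> r 0 \<omega> q \<longleftrightarrow> r \<le> norm (fst q)"
| "reaches_far \<zeta> \<beta> r (Suc k) \<omega> q \<longleftrightarrow> (\<exists>p\<in>\<omega>. close \<zeta> \<beta> q p \<and> reaches_far \<zeta> \<beta> r k \<omega> p)"

lemma reaches_far_if_reachable:
  assumes \<omega>: "\<omega> \<in> configs" and "(x, y) \<in> (graph_edges \<zeta> \<beta> \<omega>)\<^sup>*" "q \<in> \<omega>" "fst q = x" "r \<le> norm y"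
  shows "\<exists>k. reaches_far \<zeta> \<beta> r k \<omega> q"
  using assms(2-)
proof (induction arbitrary: q rule: converse_rtrancl_induct)
  case base
  then show ?case by (intro exI[of _ 0]) simp
next
  case (step x z)
  then obtain p p' where "p \<in> \<omega>" "p' \<in> \<omega>" "fst p = x" "fst p' = z" "close \<zeta> \<beta> p p'"
    by (auto simp: graph_edges_iff)
  moreover have "p = q" using config_unique[OF \<omega>] step.prems calculation by auto
  moreover obtain k where "reaches_far \<zeta> \<beta> r k \<omega> p'"
    using step.IH step.prems calculation by blast
  ultimately show ?case by (intro exI[of _ "Suc k"]) auto
qed

lemma reachable_if_reaches_far:
  "reaches_far \<zeta> \<beta> r k \<omega> q \<Longrightarrow> q \<in> \<omega> \<Longrightarrow> \<exists>y. r \<le> norm y \<and> (fst q, y) \<in> (graph_edges \<zeta> \<beta> \<omega>)\<^sup>*"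
proof (induction k arbitrary: q)
  case (Suc k)
  then obtain p where p: "p \<in> \<omega>" "close \<zeta> \<beta> q p" "reaches_far \<zeta> \<beta> r k \<omega> p" by auto
  then obtain y where y: "r \<le> norm y" "(fst p, y) \<in> (graph_edges \<zeta> \<beta> \<omega>)\<^sup>*" using Suc.IH by blast
  have "(fst q, fst p) \<in> (graph_edges \<zeta> \<beta> \<omega>)\<^sup>*"
  proof (cases "fst q = fst p")
    case False
    then have "(fst q, fst p) \<in> graph_edges \<zeta> \<beta> \<omega>" using p Suc.prems by (auto simp: graph_edges_iff)
    then show ?thesis by blast
  qed simp
  then show ?case using y by (meson rtrancl_trans)
qed auto

text \<open>The starting point may vary with n but stays in a fixed ball. By local finiteness
  finitely many starting points occur, so if their clusters were all bounded, the reachable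
  distances would be too. The quantifiers are now countable or range over configuration
  points.\<close>

lemma percolates_iff_reaches_far:
  assumes \<omega>: "\<omega> \<in> configs"
  shows "percolates \<zeta> \<beta> \<omega> \<longleftrightarrow>
    (\<exists>m::nat. \<forall>n::nat. \<exists>k. \<exists>q\<in>\<omega>. norm (fst q) \<le> real m \<and> reaches_far \<zeta> \<beta> (real n) k \<omega> q)"
    (is "_ \<longleftrightarrow> ?R")
proof
  assume "percolates \<zeta> \<beta> \<omega>"
  then obtain q where q: "q \<in> \<omega>" "\<not> bounded {y. (fst q, y) \<in> (graph_edges \<zeta> \<beta> \<omega>)\<^sup>*}"
    by (auto simp: percolates_def)
  obtain m :: nat where m: "norm (fst q) \<le> real m" using real_arch_simple by blast
  have "\<exists>k. reaches_far \<zeta> \<beta> (real n) k \<omega> q" for n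
  proof -
    obtain y where "(fst q, y) \<in> (graph_edges \<zeta> \<beta> \<omega>)\<^sup>*" "real n \<le> norm y"
      using q(2) unfolding bounded_iff by (meson mem_Collect_eq nle_le)
    then show ?thesis using reaches_far_if_reachable[OF \<omega>] q(1) by blast
  qed
  then show ?R using m q(1) by blast
next
  assume ?R
  then obtain m where m: "\<And>n::nat. \<exists>k. \<exists>q\<in>\<omega>. norm (fst q) \<le> real m \<and> reaches_far \<zeta> \<beta> (real n) k \<omega> q"
    by blast
  let ?C = "\<lambda>x. {y. (x, y) \<in> (graph_edges \<zeta> \<beta> \<omega>)\<^sup>*}"
  let ?F = "fst ` \<omega> \<inter> cball 0 (real m)"
  have fin: "finite ?F" using \<omega> by (simp add: configs_def locally_finite_set_def)
  show "percolates \<zeta> \<beta> \<omega>"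
  proof (rule ccontr)
    assume "\<not> percolates \<zeta> \<beta> \<omega>"
    then have "bounded (\<Union>x\<in>?F. ?C x)" using fin by (intro bounded_UN) (auto simp: percolates_def)
    then obtain b where b: "\<And>y. y \<in> (\<Union>x\<in>?F. ?C x) \<Longrightarrow> norm y \<le> b" by (auto simp: bounded_iff)
    obtain n :: nat where n: "b < real n" using reals_Archimedean2 by blast
    obtain k q where q: "q \<in> \<omega>" "norm (fst q) \<le> real m" "reaches_far \<zeta> \<beta> (real n) k \<omega> q"
      using m by blast
    obtain y where y: "real n \<le> norm y" "y \<in> ?C (fst q)" using reachable_if_reaches_far[OF q(3,1)] by auto
    then have "y \<in> (\<Union>x\<in>?F. ?C x)" using q by auto
    then show False using b n y(1) by fastforce
  qed
qed

lemma close_measurable: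
  "{z. close \<zeta> \<beta> (fst z) (snd z)} \<in> sets (borel :: (('a::euclidean_space \<times> real) \<times> ('a \<times> real)) measure)"
  unfolding close_def
  by (intro borel_closed closed_Collect_le continuous_intros)

text \<open>Joint measurability in the configuration and the starting point is what lets the
  induction add one more step of the path.\<close>

lemma reaches_far_measurable:
  "{z \<in> space (config_space \<Otimes>\<^sub>M borel). reaches_far \<zeta> \<beta> r k (fst z) (snd z)}
     \<in> sets (config_space \<Otimes>\<^sub>M (borel :: ('a::euclidean_space \<times> real) measure))"
proof (induction k)
  case 0
  let ?M = "config_space \<Otimes>\<^sub>M (borel :: ('a \<times> real) measure)"
  have "{q :: 'a \<times> real. r \<le> norm (fst q)} \<in> sets borel"
    by (intro borel_closed closed_Collect_le continuous_intros)
  from measurable_sets[OF measurable_snd this]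
  have "snd -` {q. r \<le> norm (fst q)} \<inter> space ?M \<in> sets ?M" .
  also have "snd -` {q. r \<le> norm (fst q)} \<inter> space ?M = {z \<in> space ?M. reaches_far \<zeta> \<beta> r 0 (fst z) (snd z)}"
    by auto
  finally show ?case .
next
  case (Suc k)
  let ?M = "config_space \<Otimes>\<^sub>M (borel :: ('a \<times> real) measure)"
  let ?\<Phi> = "{u \<in> space (?M \<Otimes>\<^sub>M borel). close \<zeta> \<beta> (snd (fst u)) (snd u) \<and> reaches_far \<zeta> \<beta> r k (fst (fst u)) (snd u)}"
  have "(\<lambda>u. (snd (fst u), snd u)) \<in> measurable (?M \<Otimes>\<^sub>M borel) (borel \<Otimes>\<^sub>M borel)"
    by measurable
  then have "(\<lambda>u. (snd (fst u), snd u)) -` {z. close \<zeta> \<beta> (fst z) (snd z)} \<inter> space (?M \<Otimes>\<^sub>M borel) \<in> sets (?M \<Otimes>\<^sub>M borel)"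
    by (rule measurable_sets) (simp only: borel_prod close_measurable)
  moreover have "(\<lambda>u. (fst (fst u), snd u)) \<in> measurable (?M \<Otimes>\<^sub>M borel) ?M"
    by measurable
  from measurable_sets[OF this Suc]
  have "(\<lambda>u. (fst (fst u), snd u)) -` {z \<in> space ?M. reaches_far \<zeta> \<beta> r k (fst z) (snd z)} \<inter> space (?M \<Otimes>\<^sub>M borel)
    \<in> sets (?M \<Otimes>\<^sub>M borel)" .
  ultimately have "((\<lambda>u. (snd (fst u), snd u)) -` {z. close \<zeta> \<beta> (fst z) (snd z)} \<inter> space (?M \<Otimes>\<^sub>M borel)) \<inter>
    ((\<lambda>u. (fst (fst u), snd u)) -` {z \<in> space ?M. reaches_far \<zeta> \<beta> r k (fst z) (snd z)} \<inter> space (?M \<Otimes>\<^sub>M borel))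
    \<in> sets (?M \<Otimes>\<^sub>M borel)" by (rule sets.Int)
  also have "((\<lambda>u. (snd (fst u), snd u)) -` {z. close \<zeta> \<beta> (fst z) (snd z)} \<inter> space (?M \<Otimes>\<^sub>M borel)) \<inter>
    ((\<lambda>u. (fst (fst u), snd u)) -` {z \<in> space ?M. reaches_far \<zeta> \<beta> r k (fst z) (snd z)} \<inter> space (?M \<Otimes>\<^sub>M borel)) = ?\<Phi>"
    by (auto simp: space_pair_measure)
  finally have \<Phi>: "?\<Phi> \<in> sets (?M \<Otimes>\<^sub>M borel)" .
  have "{z \<in> space ?M. \<exists>p\<in>fst z. (z, p) \<in> ?\<Phi>} \<in> sets ?M"
    by (rule ex_config_point_measurable[OF measurable_fst \<Phi>])
  also have "{z \<in> space ?M. \<exists>p\<in>fst z. (z, p) \<in> ?\<Phi>} =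
      {z \<in> space ?M. reaches_far \<zeta> \<beta> r (Suc k) (fst z) (snd z)}"
    by (auto simp: space_pair_measure)
  finally show ?case .
qed

lemma percolates_sets:
  "{\<omega> \<in> configs. percolates \<zeta> \<beta> \<omega>} \<in> sets (config_space :: ('a::euclidean_space \<times> real) set measure)"
proof -
  let ?M = "config_space :: ('a \<times> real) set measure"
  let ?E = "\<lambda>m n k. {\<omega> \<in> space ?M. \<exists>q\<in>\<omega>. norm (fst q) \<le> real m \<and> reaches_far \<zeta> \<beta> (real n) k \<omega> q}"
  have E: "?E m n k \<in> sets ?M" for m n k :: nat
  proof -
    let ?\<Phi> = "{z \<in> space (?M \<Otimes>\<^sub>M borel). reaches_far \<zeta> \<beta> (real n) k (fst z) (snd z)} \<inter>
      (snd -` {q. norm (fst q) \<le> real m} \<inter> space (?M \<Otimes>\<^sub>M borel))"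
    have "{q :: 'a \<times> real. norm (fst q) \<le> real m} \<in> sets borel"
      by (intro borel_closed closed_Collect_le continuous_intros)
    then have "?\<Phi> \<in> sets (?M \<Otimes>\<^sub>M borel)"
      by (intro sets.Int reaches_far_measurable measurable_sets[OF measurable_snd])
    from ex_config_point_measurable[OF measurable_ident this]
    show ?thesis by (rule back_subst[where P="\<lambda>X. X \<in> sets ?M"]) (auto simp: space_pair_measure)
  qed
  have "{\<omega> \<in> configs. percolates \<zeta> \<beta> \<omega>} = {\<omega> \<in> space ?M. \<exists>m. \<forall>n. \<exists>k. \<omega> \<in> ?E m n k}"
    using percolates_iff_reaches_far by (auto; blast)
  also have "\<dots> \<in> sets ?M" using E by measurable
  finally show ?thesis .
qed

subsection \<open>The zero-one law\<close>

lemma graph_edges_mono: "\<omega> \<subseteq> \<omega>' \<Longrightarrow> graph_edges \<zeta> \<beta> \<omega> \<subseteq> graph_edges \<zeta> \<beta> \<omega>'"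
  by (auto simp: graph_edges_def; blast)

lemma percolates_mono:
  assumes "percolates \<zeta> \<beta> \<omega>" "\<omega> \<subseteq> \<omega>'"
  shows "percolates \<zeta> \<beta> \<omega>'"
proof -
  obtain x where x: "x \<in> fst ` \<omega>" "\<not> bounded {y. (x, y) \<in> (graph_edges \<zeta> \<beta> \<omega>)\<^sup>*}"
    using assms(1) by (auto simp: percolates_def)
  have "{y. (x, y) \<in> (graph_edges \<zeta> \<beta> \<omega>)\<^sup>*} \<subseteq> {y. (x, y) \<in> (graph_edges \<zeta> \<beta> \<omega>')\<^sup>*}"
    using rtrancl_mono[OF graph_edges_mono[OF assms(2)]] by blast
  then have "\<not> bounded {y. (x, y) \<in> (graph_edges \<zeta> \<beta> \<omega>')\<^sup>*}" using x(2) bounded_subset by blast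
  then show ?thesis using x(1) assms(2) unfolding percolates_def by blast
qed

lemma graph_edges_norm:
  assumes "(x, y) \<in> graph_edges \<zeta> \<beta> \<omega>" "0 \<le> \<beta>"
  shows "norm (x - y) \<le> \<zeta>"
proof -
  obtain e f where "norm (x - y) + \<beta> * (\<bar>e\<bar> + \<bar>f\<bar> + \<bar>e - f\<bar>) \<le> \<zeta>"
    using assms(1) by (auto simp: graph_edges_def)
  moreover have "0 \<le> \<beta> * (\<bar>e\<bar> + \<bar>f\<bar> + \<bar>e - f\<bar>)" using assms(2) by simp
  ultimately show ?thesis by linarith
qed

abbreviation outside :: "real \<Rightarrow> ('a::euclidean_space \<times> real) set" where
  "outside r \<equiv> {x. r \<le> norm x} \<times> UNIV"

lemma graph_edges_outside:
  assumes "(x, y) \<in> graph_edges \<zeta> \<beta> \<omega>" "r \<le> norm x" "r \<le> norm y"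
  shows "(x, y) \<in> graph_edges \<zeta> \<beta> (\<omega> \<inter> outside r)"
  using assms by (auto simp: graph_edges_def)

text \<open>Edges have length at most \<open>\<zeta>\<close>, so a path leaving the ball lands in
  one of finitely many points. The original cluster is covered by the ball and the outer clusters of
  these points, one of which must be unbounded.\<close>

lemma percolates_outside:
  assumes \<omega>: "\<omega> \<in> configs" and "0 \<le> \<beta>"
  shows "percolates \<zeta> \<beta> (\<omega> \<inter> outside r) \<longleftrightarrow> percolates \<zeta> \<beta> \<omega>"
proof
  assume "percolates \<zeta> \<beta> \<omega>"
  then obtain x where x: "x \<in> fst ` \<omega>" "\<not> bounded {y. (x, y) \<in> (graph_edges \<zeta> \<beta> \<omega>)\<^sup>*}"
    by (auto simp: percolates_def)
  \<comment> \<open>\<open>r + \<zeta>\<close> bounds the points reached by an edge out of the ball;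
    \<open>norm x\<close> admits the start itself when it lies outside.\<close>
  define W where "W = fst ` \<omega> \<inter> {w. r \<le> norm w} \<inter> cball 0 (max (r + \<zeta>) (norm x))"
  let ?C = "\<lambda>w. {y. (w, y) \<in> (graph_edges \<zeta> \<beta> (\<omega> \<inter> outside r))\<^sup>*}"
  have "finite (fst ` \<omega> \<inter> cball 0 (max (r + \<zeta>) (norm x)))"
    using \<omega> by (simp add: configs_def locally_finite_set_def)
  then have fin: "finite W" unfolding W_def by (rule rev_finite_subset) auto
  have inW: "norm y < r \<or> (\<exists>w\<in>W. y \<in> ?C w)" if "(x, y) \<in> (graph_edges \<zeta> \<beta> \<omega>)\<^sup>*" for y
    using that
  proof (induction rule: rtrancl_induct)
    case base
    then show ?case using x(1) by (cases "norm x < r") (auto simp: W_def)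
  next
    case (step y z)
    show ?case
    proof (cases "norm z < r")
      case False
      show ?thesis
      proof (cases "norm y < r")
        case True
        have "norm z \<le> norm y + norm (y - z)" using norm_triangle_ineq4[of y "y - z"] by simp
        then have "norm z \<le> r + \<zeta>" using True graph_edges_norm[OF step(2) assms(2)] by linarith
        moreover have "z \<in> fst ` \<omega>" using step(2) by (force simp: graph_edges_def)
        ultimately have "z \<in> W" using False by (auto simp: W_def)
        then show ?thesis by auto
      next
        case y: False
        then obtain w where w: "w \<in> W" "y \<in> ?C w" using step.IH by blast
        have "(y, z) \<in> graph_edges \<zeta> \<beta> (\<omega> \<inter> outside r)"
          using graph_edges_outside[OF step(2)] y False by simp
        then have "z \<in> ?C w" using w(2) by (auto intro: rtrancl_into_rtrancl)
        then show ?thesis using w(1) by blast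
      qed
    qed simp
  qed
  show "percolates \<zeta> \<beta> (\<omega> \<inter> outside r)"
  proof (rule ccontr)
    assume n: "\<not> percolates \<zeta> \<beta> (\<omega> \<inter> outside r)"
    have "bounded (?C w)" if "w \<in> W" for w
    proof -
      have "w \<in> fst ` (\<omega> \<inter> outside r)" using that by (force simp: W_def)
      then show ?thesis using n by (auto simp: percolates_def)
    qed
    then have "bounded (ball 0 r \<union> (\<Union>w\<in>W. ?C w))" using fin by (simp add: bounded_UN)
    then have "bounded {y. (x, y) \<in> (graph_edges \<zeta> \<beta> \<omega>)\<^sup>*}"
      by (rule bounded_subset) (use inW in \<open>auto simp: subset_iff\<close>)
    then show False using x(2) by contradiction
  qed
qed (auto elim: percolates_mono)

lemma subset_config: "\<omega> \<in> configs \<Longrightarrow> \<omega>' \<subseteq> \<omega> \<Longrightarrow> \<omega>' \<in> configs"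
  unfolding configs_def locally_finite_set_def mem_Collect_eq
  by (intro conjI allI impI; meson finite_subset Int_mono image_mono subset_refl subsetD)

text \<open>The percolation event is unchanged when the configuration is modified inside a ball, so it is
  a tail event for the independent restrictions of the process to the annuli.\<close>

lemma percolation_zero_one:
  fixes M :: "('a::euclidean_space \<times> real) set measure"
  assumes P: "poisson_law \<rho> \<nu> M" and \<nu>: "real_distribution \<nu>" and "0 \<le> \<beta>"
  shows "measure M {\<omega> \<in> configs. percolates \<zeta> \<beta> \<omega>} = 0 \<or> measure M {\<omega> \<in> configs. percolates \<zeta> \<beta> \<omega>} = 1"
proof -
  interpret prob_space M using P by (rule poisson_law_prob_space)
  note sp = poisson_law_space[OF P]
  \<comment> \<open>Avoidance of regions over the i-th annulus: pi-systems that are independent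
    because the annuli are disjoint.\<close>
  define G where "G i = {avoid B | B :: ('a \<times> real) set. bounded_region B \<and> B \<subseteq> annulus i \<times> UNIV}" for i :: nat
  have "indep_sets G UNIV"
  proof (rule indep_setsI)
    show "G i \<subseteq> events" for i
      using poisson_law_sets[OF P] by (auto simp: G_def avoid_sets)
    fix E and J :: "nat set" assume J: "J \<noteq> {}" "J \<subseteq> UNIV" "finite J" "\<forall>j\<in>J. E j \<in> G j"
    then have "\<forall>j\<in>J. \<exists>B. E j = avoid B \<and> bounded_region B \<and> B \<subseteq> annulus j \<times> UNIV" by (auto simp: G_def)
    then obtain B where B: "\<And>j. j \<in> J \<Longrightarrow> E j = avoid (B j) \<and> bounded_region (B j) \<and> B j \<subseteq> annulus j \<times> UNIV"
      by metis
    have "disjoint_family_on B J"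
      unfolding disjoint_family_on_def
    proof (intro ballI impI)
      fix i j assume ij: "i \<in> J" "j \<in> J" "i \<noteq> j"
      have "annulus i \<inter> annulus j = ({} :: 'a set)" using ij(3) by (auto simp: annulus_iff)
      then show "B i \<inter> B j = {}" using B[OF ij(1)] B[OF ij(2)] by blast
    qed
    then have "prob (avoid (\<Union>j\<in>J. B j)) = (\<Prod>j\<in>J. prob (avoid (B j)))"
      using J(3) B by (intro poisson_law_avoid_UN[OF P \<nu>]) auto
    then show "prob (\<Inter>j\<in>J. E j) = (\<Prod>j\<in>J. prob (E j))" using B J(1) by (simp add: avoid_UN)
  qed
  moreover have "Int_stable (G i)" for i
  proof (rule Int_stableI)
    fix a b assume "a \<in> G i" "b \<in> G i"
    then obtain B C where "a = avoid B" "b = avoid C" "bounded_region (B \<union> C)" "B \<union> C \<subseteq> annulus i \<times> UNIV"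
      unfolding G_def using bounded_region_Un by blast
    then show "a \<inter> b \<in> G i" unfolding G_def using avoid_Int by blast
  qed
  ultimately have ind: "indep_sets (\<lambda>i. sigma_sets (space M) (G i)) UNIV"
    by (intro indep_sets_sigma) auto
  let ?A = "\<lambda>i. sigma_sets (space M) (G i)"
  let ?E = "{\<omega> \<in> configs. percolates \<zeta> \<beta> \<omega>} :: ('a \<times> real) set set"
  have "?E \<in> tail_events ?A"
    unfolding tail_events_def
  proof (rule INT_I)
    fix n :: nat
    let ?S = "sigma configs (\<Union> (?A ` {n..}))"
    have Gs: "G i \<subseteq> Pow configs" for i by (auto simp: G_def avoid_def)
    have As: "\<Union> (?A ` {n..}) \<subseteq> Pow configs"
      using sigma_sets_into_sp[OF Gs] unfolding sp by blast
    have Ssp: "space ?S = configs" using As by (rule space_measure_of)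
    have Sst: "sets ?S = sigma_sets configs (\<Union> (?A ` {n..}))" using As by (rule sets_measure_of)
    \<comment> \<open>Deleting the points of the ball of radius n leaves something that depends only
      on the annuli from n on. Since deletion preserves percolation, pulling the event back along it
      gives the tail property.\<close>
    have "(\<lambda>\<omega>. \<omega> \<inter> outside (real n)) \<in> measurable ?S config_space"
    proof (rule measurable_config_spaceI)
      show "\<omega> \<inter> outside (real n) \<in> configs" if "\<omega> \<in> space ?S" for \<omega>
        using that by (auto simp: Ssp intro: subset_config)
      fix B :: "('a \<times> real) set" assume B: "bounded_region B"
      then obtain r where r: "fst ` B \<subseteq> ball 0 r"
        using bounded_subset_ballD unfolding bounded_region_def by blast
      obtain m :: nat where m: "r < real m" using reals_Archimedean2 by blast
      let ?B = "\<lambda>i. B \<inter> annulus i \<times> UNIV"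
      have Bi: "avoid (?B i) \<in> sets ?S" if "n \<le> i" for i
      proof -
        have "?B i \<in> sets borel" using B by (intro sets.Int) (auto simp: bounded_region_def borel_Times_sets)
        then have "bounded_region (?B i)" by (intro bounded_region_subset[OF B]) auto
        then have "avoid (?B i) \<in> G i" by (auto simp: G_def)
        then have "avoid (?B i) \<in> \<Union> (?A ` {n..})" using that by (intro UN_I[of i]) (auto intro: sigma_sets.Basic)
        then show ?thesis unfolding Sst by (rule sigma_sets.Basic)
      qed
      \<comment> \<open>\<open>m\<close> exceeds the radius of \<open>B\<close>, so finitely many
        annuli cover the part of \<open>B\<close> outside the ball.\<close>
      have "{\<omega> \<in> space ?S. \<omega> \<inter> outside (real n) \<inter> B = {}} = (\<Inter>i\<in>{n..n+m}. avoid (?B i))"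
      proof (intro set_eqI iffI)
        fix \<omega> assume \<omega>: "\<omega> \<in> {\<omega> \<in> space ?S. \<omega> \<inter> outside (real n) \<inter> B = {}}"
        have "\<omega> \<inter> ?B i = {}" if "n \<le> i" for i
        proof -
          have "annulus i \<times> UNIV \<subseteq> (outside (real n) :: ('a \<times> real) set)"
            using that by (auto simp: annulus_def)
          then show ?thesis using \<omega> by blast
        qed
        then show "\<omega> \<in> (\<Inter>i\<in>{n..n+m}. avoid (?B i))" using \<omega> by (simp add: avoid_def Ssp)
      next
        fix \<omega> assume \<omega>: "\<omega> \<in> (\<Inter>i\<in>{n..n+m}. avoid (?B i))"
        have "p \<notin> \<omega>" if p: "p \<in> outside (real n)" "p \<in> B" for p
        proof -
          have "norm (fst p) < real m" using r p(2) m by (force simp: subset_iff image_subset_iff)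
          moreover have "real n \<le> norm (fst p)" using p(1) by auto
          ultimately have "nat \<lfloor>norm (fst p)\<rfloor> \<in> {n..n+m}"
            by (auto simp: le_nat_floor nat_le_iff floor_le_iff)
          moreover have "p \<in> ?B (nat \<lfloor>norm (fst p)\<rfloor>)" using p(2) by (cases p) (simp add: annulus_iff)
          ultimately show ?thesis using \<omega> by (auto simp: avoid_def)
        qed
        moreover have "\<omega> \<in> configs" using INT_D[OF \<omega>, of n] avoid_in_configs by auto
        ultimately show "\<omega> \<in> {\<omega> \<in> space ?S. \<omega> \<inter> outside (real n) \<inter> B = {}}"
          by (auto simp: Ssp)
      qed
      also have "\<dots> \<in> sets ?S" using Bi by (intro sets.finite_INT) auto
      finally show "{\<omega> \<in> space ?S. \<omega> \<inter> outside (real n) \<inter> B = {}} \<in> sets ?S" .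
    qed
    from measurable_sets[OF this percolates_sets[of \<zeta> \<beta>]]
    have "(\<lambda>\<omega>. \<omega> \<inter> outside (real n)) -` ?E \<inter> space ?S \<in> sigma_sets configs (\<Union> (?A ` {n..}))"
      unfolding Sst .
    also have "(\<lambda>\<omega>. \<omega> \<inter> outside (real n)) -` ?E \<inter> space ?S = ?E"
    proof (rule set_eqI)
      fix \<omega> :: "('a \<times> real) set"
      have "\<omega> \<inter> outside (real n) \<in> configs \<and> (percolates \<zeta> \<beta> (\<omega> \<inter> outside (real n)) \<longleftrightarrow> percolates \<zeta> \<beta> \<omega>)"
        if "\<omega> \<in> configs"
        using percolates_outside[OF that \<open>0 \<le> \<beta>\<close>] subset_config[OF that Int_lower1] by simp
      then show "\<omega> \<in> (\<lambda>\<omega>. \<omega> \<inter> outside (real n)) -` ?E \<inter> space ?S \<longleftrightarrow> \<omega> \<in> ?E"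
        unfolding Ssp vimage_def Int_iff mem_Collect_eq by metis
    qed
    finally show "?E \<in> sigma_sets (space M) (\<Union> (?A ` {n..}))" unfolding sp .
  qed
  moreover have "sigma_algebra (space M) (?A i)" for i
    unfolding sp by (rule sigma_algebra_sigma_sets) (auto simp: G_def avoid_def)
  ultimately show ?thesis using ind by (intro kolmogorov_0_1_law) auto
qed

subsection \<open>Absence of percolation at low intensity\<close>

text \<open>Finite branching leaves finitely many vertices within n steps, so some reachable vertex
  is farther away; a shortest path to it repeats no vertex.\<close>

lemma long_distinct_path:
  assumes fin: "\<And>z. finite (R `` {z})" and inf: "infinite (R\<^sup>* `` {z})"
  shows "\<exists>f. f 0 = z \<and> (\<forall>i<n. (f i, f (Suc i)) \<in> R) \<and> inj_on f {..n::nat}"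
proof -
  have "finite ((R ^^ k) `` {z})" for k
  proof (induction k)
    case (Suc k)
    have "(R ^^ Suc k) `` {z} = (\<Union>y\<in>(R ^^ k) `` {z}. R `` {y})" by auto
    then show ?case using Suc fin by simp
  qed simp
  then have "finite (\<Union>k\<le>n. (R ^^ k) `` {z})" by simp
  then obtain y where y: "(z, y) \<in> R\<^sup>*" "y \<notin> (\<Union>k\<le>n. (R ^^ k) `` {z})"
    using inf by (meson Image_singleton_iff finite_subset subsetI)
  define m where "m = (LEAST k. (z, y) \<in> R ^^ k)"
  obtain k where "(z, y) \<in> R ^^ k" using y(1) rtrancl_imp_relpow by blast
  then have m: "(z, y) \<in> R ^^ m" unfolding m_def by (rule LeastI)
  then have "n < m" using y(2) by (meson Image_singleton_iff UN_I atMost_iff not_le)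
  obtain f where f: "f 0 = z" "f m = y" "\<forall>i<m. (f i, f (Suc i)) \<in> R"
    using m by (auto simp: relpow_fun_conv)
  have seg: "(f i, f (i + k)) \<in> R ^^ k" if "i + k \<le> m" for i k
    using that f(3) by (induction k) auto
  have "f i \<noteq> f j" if "i < j" "j \<le> m" for i j
  proof
    assume "f i = f j"
    have "(z, f i) \<in> R ^^ i" "(f i, y) \<in> R ^^ (m - j)"
      using that seg[of 0 i] seg[of j "m - j"] f(1,2) \<open>f i = f j\<close> by simp_all
    then have "(z, y) \<in> R ^^ (i + (m - j))"
      unfolding relpow_add by (rule relcompI)
    then have "m \<le> i + (m - j)" unfolding m_def by (rule Least_le)
    then show False using that by linarith
  qed
  then have "inj_on f {..m}" by (intro linorder_inj_onI) auto
  then show ?thesis using f \<open>n < m\<close> by (intro exI[of _ f]) (auto intro: inj_on_subset)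
qed

section \<open>Unit cells and paths of occupied cells\<close>

definition lattice_point :: "('a::euclidean_space \<Rightarrow> int) \<Rightarrow> 'a" where
  "lattice_point k = (\<Sum>b\<in>Basis. of_int (k b) *\<^sub>R b)"

definition cell_of :: "'a::euclidean_space \<Rightarrow> 'a" where
  "cell_of x = lattice_point (\<lambda>b. \<lfloor>x \<bullet> b\<rfloor>)"

definition cell_region :: "'a::euclidean_space \<Rightarrow> ('a \<times> real) set" where
  "cell_region z = cell_of -` {z} \<times> UNIV"

text \<open>Differences between cells that coincide or touch, corners included: three choices per
  coordinate.\<close>

definition unit_steps :: "'a::euclidean_space set" where
  "unit_steps = lattice_point ` (Basis \<rightarrow>\<^sub>E {-1..1})"

lemma lattice_point_inner: "b \<in> Basis \<Longrightarrow> lattice_point k \<bullet> b = of_int (k b)"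
  unfolding lattice_point_def by (simp add: inner_sum_left_Basis)

lemma lattice_point_restrict: "lattice_point (restrict k Basis) = lattice_point k"
  unfolding lattice_point_def by (intro sum.cong) auto

lemma unit_steps_finite: "finite (unit_steps :: 'a::euclidean_space set)"
  and unit_steps_card: "card (unit_steps :: 'a::euclidean_space set) \<le> 3 ^ DIM('a)"
proof -
  have f: "finite ((Basis :: 'a set) \<rightarrow>\<^sub>E {-1..1::int})" by (intro finite_PiE) auto
  then show "finite (unit_steps :: 'a set)" by (simp add: unit_steps_def)
  have "card (unit_steps :: 'a set) \<le> card ((Basis :: 'a set) \<rightarrow>\<^sub>E {-1..1::int})"
    unfolding unit_steps_def by (rule card_image_le[OF f])
  also have "\<dots> = 3 ^ DIM('a)" by (simp add: card_PiE)
  finally show "card (unit_steps :: 'a set) \<le> 3 ^ DIM('a)" .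
qed

lemma cell_of_step:
  assumes "norm (x - y) \<le> 1"
  shows "cell_of y - cell_of x \<in> unit_steps"
proof -
  let ?k = "restrict (\<lambda>b. \<lfloor>y \<bullet> b\<rfloor> - \<lfloor>x \<bullet> b\<rfloor>) Basis"
  have "?k \<in> Basis \<rightarrow>\<^sub>E {-1..1}"
  proof (rule restrict_PiE_iff[THEN iffD2], intro ballI)
    fix b :: 'a assume "b \<in> Basis"
    then have "\<bar>x \<bullet> b - y \<bullet> b\<bar> \<le> 1"
      using Basis_le_norm[of b "x - y"] assms by (simp add: inner_diff_left)
    then show "\<lfloor>y \<bullet> b\<rfloor> - \<lfloor>x \<bullet> b\<rfloor> \<in> {-1..1}"
      unfolding atLeastAtMost_iff by linarith
  qed
  moreover have "cell_of y - cell_of x = lattice_point ?k"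
    unfolding lattice_point_restrict by (simp add: cell_of_def lattice_point_def sum_subtractf scaleR_diff_left)
  ultimately show ?thesis unfolding unit_steps_def by blast
qed

lemma countable_cells: "countable (range (cell_of :: 'a::euclidean_space \<Rightarrow> 'a))"
proof -
  have "range (cell_of :: 'a \<Rightarrow> 'a) \<subseteq> lattice_point ` (Basis \<rightarrow>\<^sub>E UNIV)"
  proof
    fix z assume "z \<in> range (cell_of :: 'a \<Rightarrow> 'a)"
    then obtain x :: 'a where x: "z = lattice_point (restrict (\<lambda>b. \<lfloor>x \<bullet> b\<rfloor>) Basis)"
      by (auto simp: cell_of_def lattice_point_restrict)
    show "z \<in> lattice_point ` (Basis \<rightarrow>\<^sub>E UNIV)"
      unfolding x by (intro imageI restrict_PiE_iff[THEN iffD2]) blast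
  qed
  moreover have "countable (lattice_point ` ((Basis :: 'a set) \<rightarrow>\<^sub>E (UNIV :: int set)))"
    by (intro countable_image countable_PiE) auto
  ultimately show ?thesis by (rule countable_subset)
qed

lemma cell_subset_cbox: "cell_of -` {z} \<subseteq> cbox z (z + One)"
proof
  fix x assume "x \<in> cell_of -` {z}"
  then have z: "z \<bullet> b = of_int \<lfloor>x \<bullet> b\<rfloor>" if "b \<in> Basis" for b
    using lattice_point_inner[OF that] by (auto simp: cell_of_def)
  show "x \<in> cbox z (z + One)"
    unfolding mem_box
  proof (intro ballI)
    fix b :: 'a assume b: "b \<in> Basis"
    have "(z + One) \<bullet> b = of_int \<lfloor>x \<bullet> b\<rfloor> + 1" using b by (simp add: inner_add_left z)
    then show "z \<bullet> b \<le> x \<bullet> b \<and> x \<bullet> b \<le> (z + One) \<bullet> b"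
      unfolding z[OF b] by linarith
  qed
qed

lemma cell_borel: "cell_of -` {z} \<in> sets (borel :: 'a::euclidean_space measure)"
proof -
  have "(cell_of :: 'a \<Rightarrow> 'a) \<in> borel_measurable borel"
    unfolding cell_of_def lattice_point_def by measurable
  from measurable_sets[OF this, of "{z}"] show ?thesis by simp
qed

lemma cell_bounded: "bounded (cell_of -` {z})"
  by (rule bounded_subset[OF bounded_cbox cell_subset_cbox])

lemma cell_region_bounded: "bounded_region (cell_region z)"
  unfolding cell_region_def by (rule bounded_region_Times[OF cell_borel cell_bounded]) simp

lemma cell_region_measure:
  assumes "real_distribution \<nu>"
  shows "measure (lborel \<Otimes>\<^sub>M \<nu>) (cell_region (z :: 'a::euclidean_space)) \<le> 1"
proof -
  interpret real_distribution \<nu> by fact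
  have "emeasure (lborel \<Otimes>\<^sub>M \<nu>) (cell_region z) = emeasure lborel (cell_of -` {z}) * emeasure \<nu> UNIV"
    unfolding cell_region_def using cell_borel by (intro emeasure_pair_measure_Times) auto
  also have "\<dots> = emeasure lborel (cell_of -` {z})" using emeasure_space_1 by simp
  also have "\<dots> \<le> emeasure lborel (cbox z (z + One))"
    by (intro emeasure_mono cell_subset_cbox) auto
  also have "\<dots> = 1" by (subst emeasure_lborel_cbox) (auto simp: inner_add_left)
  finally show ?thesis unfolding measure_def by (metis enn2real_1 enn2real_mono ennreal_one_less_top)
qed

text \<open>An unbounded cluster visits infinitely many cells, and edges of length at most 1 join
  equal or touching ones. The path is recorded by its increments so that the paths of a given length
  can be counted.\<close>

lemma percolates_long_path:
  assumes \<omega>: "\<omega> \<in> configs" "percolates 1 1 \<omega>"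
  shows "\<exists>z\<in>range cell_of. \<forall>n::nat. \<exists>s\<in>{..<n} \<rightarrow>\<^sub>E unit_steps.
    inj_on (\<lambda>i. z + (\<Sum>l<i. s l)) {..n} \<and> (\<forall>i\<le>n. \<omega> \<inter> cell_region (z + (\<Sum>l<i. s l)) \<noteq> {})"
proof -
  obtain x where x: "x \<in> fst ` \<omega>" "\<not> bounded {y. (x, y) \<in> (graph_edges 1 1 \<omega>)\<^sup>*}"
    using \<omega>(2) by (auto simp: percolates_def)
  let ?occ = "\<lambda>z. \<omega> \<inter> cell_region z \<noteq> {}"
  define R where "R = {(z, z'). z' - z \<in> unit_steps \<and> ?occ z \<and> ?occ z'}"
  have occ: "?occ (cell_of y)" if "y \<in> fst ` \<omega>" for y
    using that by (force simp: cell_region_def)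
  have reach: "(cell_of x, cell_of y) \<in> R\<^sup>*" if "(x, y) \<in> (graph_edges 1 1 \<omega>)\<^sup>*" for y
    using that
  proof (induction rule: rtrancl_induct)
    case (step y y')
    have "y \<in> fst ` \<omega>" "y' \<in> fst ` \<omega>" using step(2) by (force simp: graph_edges_def)+
    then have "(cell_of y, cell_of y') \<in> R"
      using cell_of_step[OF graph_edges_norm[OF step(2)]] occ by (simp add: R_def)
    then show ?case using step.IH by (rule rtrancl_into_rtrancl[rotated])
  qed simp
  have "finite (R `` {z})" for z
  proof (rule finite_subset)
    show "R `` {z} \<subseteq> (\<lambda>s. z + s) ` unit_steps"
    proof
      fix z' assume "z' \<in> R `` {z}"
      then have "z' = z + (z' - z)" "z' - z \<in> unit_steps" by (auto simp: R_def)
      then show "z' \<in> (\<lambda>s. z + s) ` unit_steps" by (rule image_eqI)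
    qed
  qed (simp add: unit_steps_finite)
  moreover have "infinite (R\<^sup>* `` {cell_of x})"
  proof
    assume "finite (R\<^sup>* `` {cell_of x})"
    then have "bounded (\<Union>z\<in>R\<^sup>* `` {cell_of x}. cell_of -` {z})" by (intro bounded_UN ballI cell_bounded)
    then have "bounded {y. (x, y) \<in> (graph_edges 1 1 \<omega>)\<^sup>*}"
      by (rule bounded_subset) (use reach in auto)
    then show False using x(2) by contradiction
  qed
  ultimately have path: "\<exists>f. f 0 = cell_of x \<and> (\<forall>i<n. (f i, f (Suc i)) \<in> R) \<and> inj_on f {..n}" for n
    by (rule long_distinct_path)
  show ?thesis
  proof (intro bexI[of _ "cell_of x"] allI)
    fix n
    obtain f where f: "f 0 = cell_of x" "\<And>i. i < n \<Longrightarrow> (f i, f (Suc i)) \<in> R" "inj_on f {..n}"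
      using path by blast
    define s where "s = restrict (\<lambda>i. f (Suc i) - f i) {..<n}"
    have s: "s \<in> {..<n} \<rightarrow>\<^sub>E unit_steps" using f(2) by (auto simp: s_def R_def)
    have pos: "cell_of x + (\<Sum>l<i. s l) = f i" if "i \<le> n" for i
    proof -
      have "(\<Sum>l<i. s l) = (\<Sum>l<i. f (Suc l) - f l)"
        using that by (intro sum.cong) (auto simp: s_def)
      then show ?thesis by (simp add: sum_lessThan_telescope f(1))
    qed
    have "?occ (f i)" if "i \<le> n" for i
    proof (cases i)
      case 0
      then show ?thesis using f(1) occ[OF x(1)] by simp
    next
      case (Suc j)
      then show ?thesis using f(2)[of j] that by (auto simp: R_def)
    qed
    moreover have "inj_on (\<lambda>i. cell_of x + (\<Sum>l<i. s l)) {..n}"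
      using f(3) pos by (subst inj_on_cong[of _ _ f]) auto
    ultimately show "\<exists>s\<in>{..<n} \<rightarrow>\<^sub>E unit_steps. inj_on (\<lambda>i. cell_of x + (\<Sum>l<i. s l)) {..n} \<and>
        (\<forall>i\<le>n. ?occ (cell_of x + (\<Sum>l<i. s l)))"
      using s pos by auto
  qed simp
qed

text \<open>A union bound over at most \<open>3 ^ (d * n)\<close> step sequences, each asking for n
  + 1 occupied cells of probability at most \<open>\<rho>\<close>. The cells are distinct, which is
  what makes their probabilities multiply.\<close>

lemma no_percolation_low_intensity:
  fixes M :: "('a::euclidean_space \<times> real) set measure"
  assumes P: "poisson_law \<rho> \<nu> M" and \<nu>: "real_distribution \<nu>" and "0 < \<rho>" "\<rho> * 3 ^ DIM('a) < 1"
  shows "measure M {\<omega> \<in> configs. percolates 1 1 \<omega>} = 0"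
proof -
  interpret prob_space M using P by (rule poisson_law_prob_space)
  \<comment> \<open>From 1 - exp(-x) \<le> x, a cell region having measure at most 1.\<close>
  have av: "1 - prob (avoid (cell_region z)) \<le> \<rho>" for z :: 'a
  proof -
    have "1 - \<rho> * measure (lborel \<Otimes>\<^sub>M \<nu>) (cell_region z) \<le> prob (avoid (cell_region z))"
      unfolding poisson_law_avoid[OF P cell_region_bounded] using exp_ge_add_one_self by (metis uminus_add_conv_diff add.commute)
    moreover have "\<rho> * measure (lborel \<Otimes>\<^sub>M \<nu>) (cell_region z) \<le> \<rho> * 1"
      using cell_region_measure[OF \<nu>] \<open>0 < \<rho>\<close> by (intro mult_left_mono) auto
    ultimately show ?thesis by linarith
  qed
  have ev: "avoid B \<in> events" if "bounded_region B" for B :: "('a \<times> real) set"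
    using avoid_sets[OF that] poisson_law_sets[OF P] by simp
  define pos where "pos z s i = z + (\<Sum>l<i. s l)" for z :: 'a and s :: "nat \<Rightarrow> 'a" and i :: nat
  define E where "E z n s = {\<omega> \<in> configs. \<forall>i\<in>{..n}. \<omega> \<inter> cell_region (pos z s i) \<noteq> {}}" for z n s
  \<comment> \<open>Some path of n + 1 distinct occupied cells starts at \<open>z\<close>.
    Percolation forces this for every n at one of countably many \<open>z\<close>.\<close>
  define F where "F z n = (\<Union>s\<in>{s \<in> {..<n} \<rightarrow>\<^sub>E unit_steps. inj_on (pos z s) {..n}}. E z n s)" for z n
  have Eev: "E z n s \<in> events" for z n s
  proof -
    have "E z n s = avoid {} - (\<Union>i\<in>{..n}. avoid (cell_region (pos z s i)))"
      by (auto simp: E_def avoid_def)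
    also have "\<dots> \<in> events" by (intro sets.Diff sets.finite_UN ev cell_region_bounded) auto
    finally show ?thesis .
  qed
  have fin: "finite {s \<in> {..<n} \<rightarrow>\<^sub>E (unit_steps :: 'a set). inj_on (pos z s) {..n}}" for z n
    by (rule finite_subset[of _ "{..<n} \<rightarrow>\<^sub>E unit_steps"]) (auto intro!: finite_PiE unit_steps_finite)
  have Fev: "F z n \<in> events" for z n
    unfolding F_def by (intro sets.finite_UN fin Eev)
  have Eprob: "prob (E z n s) \<le> \<rho> ^ Suc n" if "inj_on (pos z s) {..n}" for z n s
  proof -
    have "E z n s = {\<omega> \<in> avoid {}. \<forall>i\<in>{..n}. \<omega> \<inter> cell_region (pos z s i) \<noteq> {}}"
      by (auto simp: E_def avoid_def)
    also have "prob \<dots> = prob (avoid {}) * (\<Prod>i\<in>{..n}. 1 - prob (avoid (cell_region (pos z s i))))"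
    proof (rule poisson_law_occupied[OF P \<nu>])
      show "disjoint_family_on (\<lambda>i. cell_region (pos z s i)) {..n}"
        using that by (fastforce simp: disjoint_family_on_def cell_region_def inj_on_def)
    qed (auto simp: cell_region_bounded)
    also have "\<dots> \<le> 1 * (\<Prod>i\<in>{..n}. \<rho>)"
      using av \<open>0 < \<rho>\<close> by (intro mult_mono prod_mono prod_nonneg) (auto simp: diff_ge_0_iff_ge)
    finally show ?thesis by simp
  qed
  have Fprob: "prob (F z n) \<le> \<rho> * (\<rho> * 3 ^ DIM('a)) ^ n" for z n
  proof -
    let ?S = "{s \<in> {..<n} \<rightarrow>\<^sub>E (unit_steps :: 'a set). inj_on (pos z s) {..n}}"
    have "prob (F z n) \<le> (\<Sum>s\<in>?S. prob (E z n s))"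
      unfolding F_def using fin Eev by (intro finite_measure_subadditive_finite) auto
    also have "\<dots> \<le> (\<Sum>s\<in>?S. \<rho> ^ Suc n)" by (intro sum_mono Eprob) auto
    also have "\<dots> = real (card ?S) * \<rho> ^ Suc n" by simp
    also have "\<dots> \<le> real ((3 ^ DIM('a)) ^ n) * \<rho> ^ Suc n"
    proof (intro mult_right_mono of_nat_mono)
      have "card ?S \<le> card ({..<n} \<rightarrow>\<^sub>E (unit_steps :: 'a set))"
        by (intro card_mono finite_PiE unit_steps_finite) auto
      also have "\<dots> = card (unit_steps :: 'a set) ^ n" by (simp add: card_PiE)
      also have "\<dots> \<le> (3 ^ DIM('a)) ^ n" by (intro power_mono unit_steps_card) auto
      finally show "card ?S \<le> (3 ^ DIM('a)) ^ n" .
    qed (use \<open>0 < \<rho>\<close> in auto)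
    also have "\<dots> = \<rho> * (\<rho> * 3 ^ DIM('a)) ^ n" by (simp add: power_mult_distrib mult_ac)
    finally show ?thesis .
  qed
  have null: "(\<Inter>n. F z n) \<in> null_sets M" for z
  proof -
    have I: "(\<Inter>n. F z n) \<in> events" using Fev by auto
    have "(\<lambda>n. \<rho> * (\<rho> * 3 ^ DIM('a)) ^ n) \<longlonglongrightarrow> \<rho> * 0"
      using assms(3,4) by (intro tendsto_mult_left LIMSEQ_realpow_zero) auto
    moreover have "prob (\<Inter>n. F z n) \<le> \<rho> * (\<rho> * 3 ^ DIM('a)) ^ n" for n
      using finite_measure_mono[of "\<Inter>n. F z n" "F z n"] Fev Fprob[of z n] by fastforce
    ultimately have "prob (\<Inter>n. F z n) \<le> \<rho> * 0"
      by (intro LIMSEQ_le_const) blast+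
    then show ?thesis using I measure_nonneg[of M "\<Inter>n. F z n"]
      by (intro null_setsI) (simp_all add: emeasure_eq_measure del: measure_nonneg)
  qed
  have N: "(\<Union>z\<in>range cell_of. \<Inter>n. F z n) \<in> null_sets M"
    using null countable_cells by (intro null_sets_UN') auto
  have S: "{\<omega> \<in> configs. percolates 1 1 \<omega>} \<subseteq> (\<Union>z\<in>range cell_of. \<Inter>n. F z n)"
  proof
    fix \<omega> :: "('a \<times> real) set" assume "\<omega> \<in> {\<omega> \<in> configs. percolates 1 1 \<omega>}"
    then have \<omega>: "\<omega> \<in> configs" "percolates 1 1 \<omega>" by auto
    obtain z where z: "z \<in> range cell_of" and path: "\<And>n. \<exists>s\<in>{..<n} \<rightarrow>\<^sub>E unit_steps.
        inj_on (pos z s) {..n} \<and> (\<forall>i\<le>n. \<omega> \<inter> cell_region (pos z s i) \<noteq> {})"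
      using percolates_long_path[OF \<omega>] unfolding pos_def by blast
    have "\<omega> \<in> F z n" for n
    proof -
      obtain s where "s \<in> {..<n} \<rightarrow>\<^sub>E unit_steps" "inj_on (pos z s) {..n}"
        "\<forall>i\<le>n. \<omega> \<inter> cell_region (pos z s i) \<noteq> {}" using path by blast
      then show ?thesis unfolding F_def using \<omega>(1) by (intro UN_I[of s]) (simp_all add: E_def)
    qed
    then show "\<omega> \<in> (\<Union>z\<in>range cell_of. \<Inter>n. F z n)" using z by (intro UN_I[of z] INT_I)
  qed
  have E: "{\<omega> \<in> configs. percolates 1 1 \<omega>} \<in> events"
    using percolates_sets poisson_law_sets[OF P] by simp
  from null_sets_subset[OF N E S] show ?thesis by (simp add: null_setsD1 measure_def)
qed

subsection \<open>Percolation at high intensity\<close>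

definition sub_pairs :: "(nat \<times> nat) set set" where
  "sub_pairs = {A. A \<subseteq> {..<3} \<times> {..<3} \<and> card A = 2}"

definition subsquare :: "nat \<times> nat \<Rightarrow> nat \<times> nat \<Rightarrow> nat \<times> nat" where
  "subsquare s t = (3 * fst s + fst t, 3 * snd s + snd t)"

text \<open>A square of level \<open>n + 1\<close> consists of \<open>3 \<times> 3\<close> squares of level \<open>n\<close>. The good subsquares of a good
  square are connected to each other, and to those of any adjacent good square, because of the three
  pairs of subsquares that touch along the common side at most two are spoilt.\<close>

primrec bad_square :: "(nat \<times> nat \<Rightarrow> bool) \<Rightarrow> nat \<Rightarrow> nat \<times> nat \<Rightarrow> bool" where
  "bad_square c 0 s \<longleftrightarrow> c s"
| "bad_square c (Suc n) s \<longleftrightarrow> (\<exists>A\<in>sub_pairs. \<forall>t\<in>A. bad_square c n (subsquare s t))"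

primrec open_part :: "(nat \<times> nat \<Rightarrow> bool) \<Rightarrow> nat \<Rightarrow> nat \<times> nat \<Rightarrow> (nat \<times> nat) set" where
  "open_part c 0 s = {s}"
| "open_part c (Suc n) s = (\<Union>t\<in>{t \<in> {..<3} \<times> {..<3}. \<not> bad_square c n (subsquare s t)}. open_part c n (subsquare s t))"

definition grid_edges :: "(nat \<times> nat \<Rightarrow> bool) \<Rightarrow> ((nat \<times> nat) \<times> (nat \<times> nat)) set" where
  "grid_edges c = {(s, t). \<not> c s \<and> \<not> c t \<and>
     (t = (Suc (fst s), snd s) \<or> t = (fst s, Suc (snd s)) \<or> s = (Suc (fst t), snd t) \<or> s = (fst t, Suc (snd t)))}"

lemma grid_edges_sym: "sym (grid_edges c)"
  unfolding sym_def grid_edges_def by auto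

lemma grid_connected_sym: "(u, v) \<in> (grid_edges c)\<^sup>* \<Longrightarrow> (v, u) \<in> (grid_edges c)\<^sup>*"
  using sym_rtrancl[OF grid_edges_sym] by (rule symD)

lemma sub_pairs_finite: "finite sub_pairs" and sub_pairs_card: "card sub_pairs = 36"
proof -
  have f: "finite ({..<3::nat} \<times> {..<3::nat})" by simp
  show "finite sub_pairs" unfolding sub_pairs_def using f by simp
  have "card sub_pairs = card ({..<3::nat} \<times> {..<3::nat}) choose 2"
    unfolding sub_pairs_def using f by (rule n_subsets)
  also have "\<dots> = 36" by (simp add: card_cartesian_product choose_two)
  finally show "card sub_pairs = 36" .
qed

lemma good_square_unique_bad:
  assumes "\<not> bad_square c (Suc n) s" "t \<in> {..<3} \<times> {..<3}" "t' \<in> {..<3} \<times> {..<3}"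
    and "bad_square c n (subsquare s t)" "bad_square c n (subsquare s t')"
  shows "t = t'"
proof (rule ccontr)
  assume "t \<noteq> t'"
  then have "{t, t'} \<in> sub_pairs" using assms(2,3) by (auto simp: sub_pairs_def)
  then show False using assms by auto
qed

text \<open>With at most one cell missing there are a full row r (fixed first index) and a full
  column k. A cell whose row is full follows it to column k; otherwise the missing cell lies in its
  row, so its column is full and leads to row r. Transitivity is assumed only through present cells,
  because links through empty parts carry no path.\<close>

lemma three_by_three_connected:
  fixes g :: "nat \<Rightarrow> nat \<Rightarrow> bool" and L :: "nat \<Rightarrow> nat \<Rightarrow> nat \<Rightarrow> nat \<Rightarrow> bool"
  assumes uniq: "\<And>a b a' b'. a < 3 \<Longrightarrow> b < 3 \<Longrightarrow> a' < 3 \<Longrightarrow> b' < 3 \<Longrightarrow> \<not> g a b \<Longrightarrow> \<not> g a' b' \<Longrightarrow> a = a' \<and> b = b'"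
    and refl: "\<And>a b. a < 3 \<Longrightarrow> b < 3 \<Longrightarrow> g a b \<Longrightarrow> L a b a b"
    and sym: "\<And>a b a' b'. L a b a' b' \<Longrightarrow> L a' b' a b"
    and trans: "\<And>a b a' b' a'' b''. g a' b' \<Longrightarrow> a' < 3 \<Longrightarrow> b' < 3 \<Longrightarrow> L a b a' b' \<Longrightarrow> L a' b' a'' b'' \<Longrightarrow> L a b a'' b''"
    and col: "\<And>a b. Suc a < 3 \<Longrightarrow> b < 3 \<Longrightarrow> g a b \<Longrightarrow> g (Suc a) b \<Longrightarrow> L a b (Suc a) b"
    and row: "\<And>a b. a < 3 \<Longrightarrow> Suc b < 3 \<Longrightarrow> g a b \<Longrightarrow> g a (Suc b) \<Longrightarrow> L a b a (Suc b)"
    and pq: "a < 3" "b < 3" "g a b" "a' < 3" "b' < 3" "g a' b'"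
  shows "L a b a' b'"
proof -
  have three: "x = 0 \<or> x = 1 \<or> x = 2" if "x < 3" for x :: nat using that by linarith
  have frow: "L x y x z" if "\<And>y. y < 3 \<Longrightarrow> g x y" "x < 3" "y < 3" "z < 3" for x y z
  proof -
    have s: "L x 0 x 1" "L x 1 x 2" using row[of x 0] row[of x 1] that by (auto simp: numeral_2_eq_2)
    have "L x 0 x 2" using trans[of x 1] s that by auto
    then show ?thesis using three[OF that(3)] three[OF that(4)] s refl[of x] sym that by auto
  qed
  have fcol: "L x y z y" if "\<And>x. x < 3 \<Longrightarrow> g x y" "x < 3" "y < 3" "z < 3" for x y z
  proof -
    have s: "L 0 y 1 y" "L 1 y 2 y" using col[of 0 y] col[of 1 y] that by (auto simp: numeral_2_eq_2)
    have "L 0 y 2 y" using trans[of 1 y] s that by auto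
    then show ?thesis using three[OF that(2)] three[OF that(4)] s refl[of _ y] sym that by auto
  qed
  obtain r where r: "r < 3" "\<And>y. y < 3 \<Longrightarrow> g r y"
    using uniq[of 0 _ 1] by (metis one_less_numeral_iff semiring_norm(77) zero_less_numeral zero_neq_one)
  obtain k where k: "k < 3" "\<And>x. x < 3 \<Longrightarrow> g x k"
    using uniq[of _ 0 _ 1] by (metis one_less_numeral_iff semiring_norm(77) zero_less_numeral zero_neq_one)
  have hub: "L x y r k" if "x < 3" "y < 3" "g x y" for x y
  proof (cases "\<forall>z<3. g x z")
    case True
    then have "L x y x k" using frow[of x y k] that k by auto
    moreover have "L x k r k" using fcol[of k x r] that k r by auto
    ultimately show ?thesis using trans[of x k] k that by auto
  next
    case False
    then obtain z where z: "z < 3" "\<not> g x z" by auto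
    have "g w y" if "w < 3" for w
      using uniq[of w y x z] z that \<open>x < 3\<close> \<open>y < 3\<close> \<open>g x y\<close> by metis
    then have "L x y r y" using fcol[of y x r] that r by auto
    moreover have "L r y r k" using frow[of r y k] that k r by auto
    ultimately show ?thesis using trans[of r y] r that by auto
  qed
  show ?thesis using trans[OF k(2)[OF r(1)] r(1) k(1) hub[OF pq(1-3)] sym[OF hub[OF pq(4-6)]]] .
qed

text \<open>Links between open parts can be chained only through a nonempty one.\<close>

lemma open_part_nonempty: "\<not> bad_square c n s \<Longrightarrow> open_part c n s \<noteq> {}"
proof (induction n arbitrary: s)
  case (Suc n)
  have "\<not> bad_square c n (subsquare s (0, 0)) \<or> \<not> bad_square c n (subsquare s (0, 1))"
    using good_square_unique_bad[OF Suc.prems, of "(0,0)" "(0,1)"] by auto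
  then obtain t where "t \<in> {..<3} \<times> {..<3}" "\<not> bad_square c n (subsquare s t)"
    using SigmaI[of "0::nat" "{..<3}" "0::nat" "\<lambda>_. {..<3}"] SigmaI[of "0::nat" "{..<3}" "1::nat" "\<lambda>_. {..<3}"]
    by fastforce
  then show ?case using Suc.IH[of "subsquare s t"] by auto
qed simp

lemma open_part_connected:
  assumes "\<not> bad_square c n s" "\<not> bad_square c n s'"
    and "s' \<in> {s, (Suc (fst s), snd s), (fst s, Suc (snd s))}"
    and "u \<in> open_part c n s" "v \<in> open_part c n s'"
  shows "(u, v) \<in> (grid_edges c)\<^sup>*"
  using assms
proof (induction n arbitrary: s s' u v)
  case 0
  then show ?case by (cases "s = s'") (auto simp: grid_edges_def intro!: r_into_rtrancl)
next
  case (Suc n)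
  define linked where "linked s s' \<longleftrightarrow> (\<forall>u\<in>open_part c n s. \<forall>v\<in>open_part c n s'. (u, v) \<in> (grid_edges c)\<^sup>*)" for s s'
  have link: "linked s s'" if "\<not> bad_square c n s" "\<not> bad_square c n s'"
    "s' \<in> {s, (Suc (fst s), snd s), (fst s, Suc (snd s))}" for s s'
    using Suc.IH that unfolding linked_def by blast
  have link_sym: "linked s' s" if "linked s s'" for s s'
    using that grid_connected_sym unfolding linked_def by blast
  have link_trans: "linked s s''" if "\<not> bad_square c n s'" "linked s s'" "linked s' s''" for s s' s''
    using that open_part_nonempty[OF that(1)] unfolding linked_def by (meson all_not_in_conv rtrancl_trans)
  have inner: "linked (subsquare s t) (subsquare s t')"
    if s: "\<not> bad_square c (Suc n) s" and t: "t \<in> {..<3} \<times> {..<3}" "t' \<in> {..<3} \<times> {..<3}"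
      and g: "\<not> bad_square c n (subsquare s t)" "\<not> bad_square c n (subsquare s t')" for s t t'
  proof -
    have "linked (subsquare s (fst t, snd t)) (subsquare s (fst t', snd t'))"
    proof (rule three_by_three_connected[where g="\<lambda>a b. \<not> bad_square c n (subsquare s (a, b))"
          and L="\<lambda>a b a' b'. linked (subsquare s (a, b)) (subsquare s (a', b'))"])
      fix a b a' b' :: nat assume "a < 3" "b < 3" "a' < 3" "b' < 3"
        "\<not> \<not> bad_square c n (subsquare s (a, b))" "\<not> \<not> bad_square c n (subsquare s (a', b'))"
      then show "a = a' \<and> b = b'" using good_square_unique_bad[OF s, of "(a, b)" "(a', b')"] by auto
    qed (use t g in \<open>auto intro: link link_sym link_trans simp: subsquare_def\<close>)
    then show ?thesis by simp
  qed
  obtain t where t: "t \<in> {..<3} \<times> {..<3}" "\<not> bad_square c n (subsquare s t)" "u \<in> open_part c n (subsquare s t)"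
    using Suc.prems(4) by auto
  obtain t' where t': "t' \<in> {..<3} \<times> {..<3}" "\<not> bad_square c n (subsquare s' t')" "v \<in> open_part c n (subsquare s' t')"
    using Suc.prems(5) by auto
  have "linked (subsquare s t) (subsquare s' t')"
  proof (cases "s' = s")
    case True
    then show ?thesis using inner[OF Suc.prems(1) t(1) _ t(2)] t' by simp
  next
    case False
    \<comment> \<open>A touching pair that survives on both sides of the common side; the connection
      runs from \<open>t\<close> to \<open>w\<close>, across to \<open>w'\<close> and on to
      \<open>t'\<close>.\<close>
    have "\<exists>w w'. w \<in> {..<3} \<times> {..<3} \<and> w' \<in> {..<3} \<times> {..<3} \<and> \<not> bad_square c n (subsquare s w) \<and>
        \<not> bad_square c n (subsquare s' w') \<and>
        subsquare s' w' \<in> {(Suc (fst (subsquare s w)), snd (subsquare s w)), (fst (subsquare s w), Suc (snd (subsquare s w)))}"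
    proof (cases "s' = (Suc (fst s), snd s)")
      case True
      have "\<exists>b<3. \<not> bad_square c n (subsquare s (2, b)) \<and> \<not> bad_square c n (subsquare s' (0, b))"
      proof (rule ccontr)
        assume "\<not> ?thesis"
        then have h: "bad_square c n (subsquare s (2, b)) \<or> bad_square c n (subsquare s' (0, b))" if "b < 3" for b
          using that by blast
        have u1: "b = b'" if "b < 3" "b' < 3" "bad_square c n (subsquare s (2, b))" "bad_square c n (subsquare s (2, b'))" for b b'
          using good_square_unique_bad[OF Suc.prems(1), of "(2, b)" "(2, b')"] that by auto
        have u2: "b = b'" if "b < 3" "b' < 3" "bad_square c n (subsquare s' (0, b))" "bad_square c n (subsquare s' (0, b'))" for b b'
          using good_square_unique_bad[OF Suc.prems(2), of "(0, b)" "(0, b')"] that by auto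
        show False using h[of 0] h[of 1] h[of 2] u1[of 0 1] u1[of 0 2] u1[of 1 2] u2[of 0 1] u2[of 0 2] u2[of 1 2] by auto
      qed
      then obtain b where "b < 3" "\<not> bad_square c n (subsquare s (2, b))" "\<not> bad_square c n (subsquare s' (0, b))" by blast
      then show ?thesis using True
        by (intro exI[of _ "(2, b)"] exI[of _ "(0, b)"]) (auto simp: subsquare_def)
    next
      case F: False
      then have s': "s' = (fst s, Suc (snd s))" using False Suc.prems(3) by auto
      have "\<exists>a<3. \<not> bad_square c n (subsquare s (a, 2)) \<and> \<not> bad_square c n (subsquare s' (a, 0))"
      proof (rule ccontr)
        assume "\<not> ?thesis"
        then have h: "bad_square c n (subsquare s (a, 2)) \<or> bad_square c n (subsquare s' (a, 0))" if "a < 3" for a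
          using that by blast
        have u1: "a = a'" if "a < 3" "a' < 3" "bad_square c n (subsquare s (a, 2))" "bad_square c n (subsquare s (a', 2))" for a a'
          using good_square_unique_bad[OF Suc.prems(1), of "(a, 2)" "(a', 2)"] that by auto
        have u2: "a = a'" if "a < 3" "a' < 3" "bad_square c n (subsquare s' (a, 0))" "bad_square c n (subsquare s' (a', 0))" for a a'
          using good_square_unique_bad[OF Suc.prems(2), of "(a, 0)" "(a', 0)"] that by auto
        show False using h[of 0] h[of 1] h[of 2] u1[of 0 1] u1[of 0 2] u1[of 1 2] u2[of 0 1] u2[of 0 2] u2[of 1 2] by auto
      qed
      then obtain a where "a < 3" "\<not> bad_square c n (subsquare s (a, 2))" "\<not> bad_square c n (subsquare s' (a, 0))" by blast
      then show ?thesis using s'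
        by (intro exI[of _ "(a, 2)"] exI[of _ "(a, 0)"]) (auto simp: subsquare_def)
    qed
    then obtain w w' where w: "w \<in> {..<3} \<times> {..<3}" "w' \<in> {..<3} \<times> {..<3}" "\<not> bad_square c n (subsquare s w)"
        "\<not> bad_square c n (subsquare s' w')" "linked (subsquare s w) (subsquare s' w')"
      using link by (metis insertCI)
    have "linked (subsquare s t) (subsquare s' w')"
      by (rule link_trans[OF w(3) inner[OF Suc.prems(1) t(1) w(1) t(2) w(3)] w(5)])
    then show ?thesis
      by (rule link_trans[OF w(4) _ inner[OF Suc.prems(2) w(2) t'(1) w(4) t'(2)]])
  qed
  then show ?case using t(3) t'(3) unfolding linked_def by blast
qed

lemma open_part_coordinates:
  "(x, y) \<in> open_part c n s \<Longrightarrow> fst s * 3 ^ n \<le> x \<and> snd s * 3 ^ n \<le> y"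
proof (induction n arbitrary: s)
  case (Suc n)
  then obtain t where t: "(x, y) \<in> open_part c n (subsquare s t)" by auto
  have "fst (subsquare s t) * 3 ^ n \<le> x" "snd (subsquare s t) * 3 ^ n \<le> y"
    using Suc.IH[OF t] by auto
  then show ?case by (auto simp: subsquare_def algebra_simps)
qed auto

text \<open>The corner blocks are nested and all good, so the origin belongs to each of their open
  parts. At level N one of the two neighbours of the corner block is good too, and its points have a
  coordinate of at least \<open>3 ^ N\<close>.\<close>

lemma unbounded_open_cluster:
  assumes good: "\<And>n. \<not> bad_square c n (0, 0)"
  shows "\<exists>x y. ((0, 0), (x, y)) \<in> (grid_edges c)\<^sup>* \<and> (N \<le> x \<or> N \<le> y)"
proof -
  have origin: "(0, 0) \<in> open_part c n (0, 0)" for n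
  proof (induction n)
    case (Suc n)
    have "subsquare (0, 0) (0, 0) = (0, 0)" by (simp add: subsquare_def)
    then show ?case using good[of n] Suc
      unfolding open_part.simps by (intro UN_I[of "(0, 0)"]) auto
  qed simp
  obtain t where t: "t = (1, 0) \<or> t = (0, 1)" "\<not> bad_square c N (subsquare (0, 0) t)"
    using good_square_unique_bad[OF good, of "(1,0)" "(0,1)" N] by auto
  obtain x y where xy: "(x, y) \<in> open_part c N (subsquare (0, 0) t)"
    using open_part_nonempty[OF t(2)] by fastforce
  have "(x, y) \<in> open_part c (Suc N) (0, 0)"
    unfolding open_part.simps using xy t by (intro UN_I[of t]) auto
  then have "((0, 0), (x, y)) \<in> (grid_edges c)\<^sup>*"
    using open_part_connected[OF good good _ origin] by blast
  moreover have "N \<le> 3 ^ N" by (rule less_imp_le[OF less_exp[of N, THEN order_less_le_trans]]) (simp add: power_mono)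
  moreover have "3 ^ N \<le> x \<or> 3 ^ N \<le> y"
    using open_part_coordinates[OF xy] t(1) by (auto simp: subsquare_def)
  then have "N \<le> x \<or> N \<le> y" using \<open>N \<le> 3 ^ N\<close> order_trans by blast
  ultimately show ?thesis by blast
qed

section \<open>Probability of bad blocks\<close>

lemma closed_squares_bound:
  fixes M :: "'c measure" and C :: "nat \<times> nat \<Rightarrow> 'c set"
  assumes "prob_space M" and q: "0 \<le> q" "q \<le> 1 / 72"
    and ev: "\<And>s. C s \<in> sets M"
    and closed: "\<And>F. finite F \<Longrightarrow> F \<noteq> {} \<Longrightarrow> measure M (\<Inter>s\<in>F. C s) \<le> q ^ card F"
  shows "{w \<in> space M. bad_square (\<lambda>s. w \<in> C s) n s} \<in> sets M"
    and "finite F \<Longrightarrow> F \<noteq> {} \<Longrightarrow>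
      measure M {w \<in> space M. \<forall>s\<in>F. bad_square (\<lambda>s. w \<in> C s) n s} \<le> (q / 2 ^ n) ^ card F"
proof -
  interpret prob_space M by fact
  let ?bad = "\<lambda>w. bad_square (\<lambda>s. w \<in> C s)"
  have Csub: "C s \<subseteq> space M" for s by (rule sets.sets_into_space[OF ev])
  have fin_pair: "finite A" and ne_pair: "A \<noteq> {}" if "A \<in> sub_pairs" for A
    using that card.infinite[of A] by (auto simp: sub_pairs_def)
  have Bev: "{w \<in> space M. ?bad w n s} \<in> events" for n s
  proof (induction n arbitrary: s)
    case 0
    have "{w \<in> space M. ?bad w 0 s} = C s" using Csub[of s] by auto
    then show ?case using ev by simp
  next
    case (Suc n)
    show ?case
      unfolding bad_square.simps using Suc sub_pairs_finite fin_pair ne_pair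
      by (intro sets.sets_Collect_finite_Ex sets.sets_Collect_finite_All')
  qed
  then show "{w \<in> space M. ?bad w n s} \<in> events" .
  \<comment> \<open>The bound is proved for whole sets of squares: a bad square of the next level
    asks for two bad squares jointly, and joint bounds stand in for independence.\<close>
  show "measure M {w \<in> space M. \<forall>s\<in>F. ?bad w n s} \<le> (q / 2 ^ n) ^ card F" if "finite F" "F \<noteq> {}"
    using that
  proof (induction n arbitrary: F)
    case 0
    have "{w \<in> space M. \<forall>s\<in>F. ?bad w 0 s} = (\<Inter>s\<in>F. C s)"
      unfolding bad_square.simps using 0 Csub by blast
    then show ?case using closed[OF 0] by simp
  next
    case (Suc n)
    \<comment> \<open>\<open>\<pi>\<close> picks a bad pair in every square of \<open>F\<close>: 36
      choices per square, and twice as many squares one level down.\<close>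
    define G where "G \<pi> = (\<Union>s\<in>F. subsquare s ` \<pi> s)" for \<pi> :: "nat \<times> nat \<Rightarrow> (nat \<times> nat) set"
    let ?\<Pi> = "F \<rightarrow>\<^sub>E sub_pairs"
    have fin\<Pi>: "finite ?\<Pi>" using Suc.prems sub_pairs_finite by (intro finite_PiE) auto
    have G: "finite (G \<pi>)" "G \<pi> \<noteq> {}" "card (G \<pi>) = 2 * card F" if "\<pi> \<in> ?\<Pi>" for \<pi>
    proof -
      have \<pi>: "\<pi> s \<subseteq> {..<3} \<times> {..<3}" "card (\<pi> s) = 2" "finite (\<pi> s)" if "s \<in> F" for s
        using \<open>\<pi> \<in> ?\<Pi>\<close> that fin_pair[of "\<pi> s"] by (auto simp: sub_pairs_def PiE_iff)
      have inj: "inj_on (subsquare s) (\<pi> s)" for s by (auto simp: inj_on_def subsquare_def)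
      \<comment> \<open>Division by 3 recovers the enclosing square, so distinct squares have
        disjoint subsquares and the doubling of the cardinality is exact.\<close>
      have inv: "((fst (subsquare s t)) div 3, (snd (subsquare s t)) div 3) = s"
        if "s \<in> F" "t \<in> \<pi> s" for s t
        using \<pi>(1)[OF that(1)] that(2) by (cases s; cases t) (auto simp: subsquare_def)
      show "finite (G \<pi>)"
        unfolding G_def using Suc.prems(1) \<pi>(3) by (intro finite_UN_I finite_imageI)
      have "card (G \<pi>) = (\<Sum>s\<in>F. card (subsquare s ` \<pi> s))"
        unfolding G_def
      proof (rule card_UN_disjoint)
        show "\<forall>i\<in>F. \<forall>j\<in>F. i \<noteq> j \<longrightarrow> subsquare i ` \<pi> i \<inter> subsquare j ` \<pi> j = {}"
        proof (intro ballI impI)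
          fix i j assume ij: "i \<in> F" "j \<in> F" "i \<noteq> j"
          have "subsquare i t \<noteq> subsquare j t'" if "t \<in> \<pi> i" "t' \<in> \<pi> j" for t t'
            using inv[OF ij(1) that(1)] inv[OF ij(2) that(2)] ij(3) by metis
          then show "subsquare i ` \<pi> i \<inter> subsquare j ` \<pi> j = {}" by blast
        qed
      qed (use Suc.prems \<pi> in auto)
      also have "\<dots> = 2 * card F" using \<pi>(2) by (simp add: card_image[OF inj])
      finally show "card (G \<pi>) = 2 * card F" .
      then show "G \<pi> \<noteq> {}" using Suc.prems by (auto simp: card_gt_0_iff)
    qed
    have Gev: "{w \<in> space M. \<forall>s\<in>G \<pi>. ?bad w n s} \<in> events" if "\<pi> \<in> ?\<Pi>" for \<pi>
      using Bev G(1)[OF that] by (intro sets.sets_Collect_finite_All')  (auto simp: G(2)[OF that])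
    have "{w \<in> space M. \<forall>s\<in>F. ?bad w (Suc n) s} \<subseteq> (\<Union>\<pi>\<in>?\<Pi>. {w \<in> space M. \<forall>s\<in>G \<pi>. ?bad w n s})"
    proof
      fix w assume w: "w \<in> {w \<in> space M. \<forall>s\<in>F. ?bad w (Suc n) s}"
      then have "\<forall>s\<in>F. \<exists>A. A \<in> sub_pairs \<and> (\<forall>t\<in>A. ?bad w n (subsquare s t))" by auto
      then obtain \<pi> where \<pi>: "\<And>s. s \<in> F \<Longrightarrow> \<pi> s \<in> sub_pairs \<and> (\<forall>t\<in>\<pi> s. ?bad w n (subsquare s t))"
        by metis
      have "restrict \<pi> F \<in> ?\<Pi>" using \<pi> by (intro restrict_PiE_iff[THEN iffD2]) blast
      moreover have "\<forall>s\<in>G (restrict \<pi> F). ?bad w n s" using \<pi> by (auto simp: G_def)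
      ultimately show "w \<in> (\<Union>\<pi>\<in>?\<Pi>. {w \<in> space M. \<forall>s\<in>G \<pi>. ?bad w n s})" using w by blast
    qed
    then have "prob {w \<in> space M. \<forall>s\<in>F. ?bad w (Suc n) s} \<le> prob (\<Union>\<pi>\<in>?\<Pi>. {w \<in> space M. \<forall>s\<in>G \<pi>. ?bad w n s})"
      using Gev fin\<Pi> by (intro finite_measure_mono sets.finite_UN)
    also have "\<dots> \<le> (\<Sum>\<pi>\<in>?\<Pi>. prob {w \<in> space M. \<forall>s\<in>G \<pi>. ?bad w n s})"
      using Gev fin\<Pi> by (intro finite_measure_subadditive_finite image_subsetI)
    also have "\<dots> \<le> (\<Sum>\<pi>\<in>?\<Pi>. (q / 2 ^ n) ^ (2 * card F))"
    proof (rule sum_mono)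
      fix \<pi> assume "\<pi> \<in> ?\<Pi>"
      from Suc.IH[OF G(1,2)[OF this]] G(3)[OF this]
      show "prob {w \<in> space M. \<forall>s\<in>G \<pi>. ?bad w n s} \<le> (q / 2 ^ n) ^ (2 * card F)" by (simp only:)
    qed
    also have "\<dots> = (36 * (q / 2 ^ n)\<^sup>2) ^ card F"
      using Suc.prems by (simp add: card_PiE sub_pairs_card power_mult_distrib power_mult)
    also have "\<dots> \<le> (q / 2 ^ Suc n) ^ card F"
    proof (rule power_mono)
      \<comment> \<open>One level maps a bound p to \<open>36 * p ^ 2\<close>. The threshold 1/72
        makes this at most p / 2, so the bound halves each time.\<close>
      have "36 * (q * q) \<le> q / 2" using mult_left_mono[OF q(2) q(1)] by simp
      also have "\<dots> \<le> q / 2 * 2 ^ n" using q(1) mult_left_mono[of 1 "2 ^ n" "q / 2"] by simp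
      finally show "36 * (q / 2 ^ n)\<^sup>2 \<le> q / 2 ^ Suc n"
        by (simp add: power2_eq_square field_simps)
    qed (use q in simp)
    finally show ?case .
  qed
qed

text \<open>The bounds q / 2^n sum to 2 q < 1, so with positive probability no corner block is
  bad.\<close>

lemma good_square_positive:
  fixes M :: "'c measure" and C :: "nat \<times> nat \<Rightarrow> 'c set"
  assumes "prob_space M" and q: "0 \<le> q" "q \<le> 1 / 72"
    and ev: "\<And>s. C s \<in> sets M"
    and closed: "\<And>F. finite F \<Longrightarrow> F \<noteq> {} \<Longrightarrow> measure M (\<Inter>s\<in>F. C s) \<le> q ^ card F"
  shows "0 < measure M {w \<in> space M. \<forall>n. \<not> bad_square (\<lambda>s. w \<in> C s) n (0, 0)}"
proof -
  interpret prob_space M by fact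
  let ?B = "\<lambda>n. {w \<in> space M. bad_square (\<lambda>s. w \<in> C s) n (0, 0)}"
  have Bev: "?B n \<in> events" for n
    by (rule closed_squares_bound(1)[OF assms])
  have le: "prob (?B n) \<le> q * (1 / 2) ^ n" for n
    using closed_squares_bound(2)[OF assms, of "{(0, 0)}" n] by (simp add: power_one_over)
  have sm: "summable (\<lambda>n. q * (1 / 2) ^ n)" by (intro summable_mult summable_geometric) simp
  have smB: "summable (\<lambda>n. prob (?B n))"
    by (rule summable_comparison_test'[OF sm, of 0]) (use le in simp)
  have "prob (\<Union>n. ?B n) \<le> (\<Sum>n. prob (?B n))"
    using Bev by (intro finite_measure_subadditive_countably smB) auto
  also have "\<dots> \<le> (\<Sum>n. q * (1 / 2) ^ n)" by (intro suminf_le le smB sm)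
  also have "\<dots> = 2 * q" by (subst suminf_mult) (auto simp: suminf_geometric intro: summable_geometric)
  also have "\<dots> < 1" using q by simp
  finally have "prob (\<Union>n. ?B n) < 1" .
  moreover have "{w \<in> space M. \<forall>n. \<not> bad_square (\<lambda>s. w \<in> C s) n (0, 0)} = space M - (\<Union>n. ?B n)" by auto
  ultimately show ?thesis using Bev by (simp add: prob_compl[of "\<Union>n. ?B n"])
qed

section \<open>Disjoint open boxes indexed by a quadrant of a coordinate plane\<close>

definition tile :: "'a::euclidean_space \<Rightarrow> 'a \<Rightarrow> real \<Rightarrow> nat \<times> nat \<Rightarrow> 'a set" where
  "tile b1 b2 l s = (let z = (l * real (fst s)) *\<^sub>R b1 + (l * real (snd s)) *\<^sub>R b2 in box z (z + l *\<^sub>R One))"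

lemma tile_coordinates:
  assumes "x \<in> tile b1 b2 l s" "b1 \<in> Basis" "b2 \<in> Basis" "b1 \<noteq> b2" "b \<in> Basis"
  shows "l * (if b = b1 then real (fst s) else if b = b2 then real (snd s) else 0) < x \<bullet> b"
    and "x \<bullet> b < l * (if b = b1 then real (fst s) else if b = b2 then real (snd s) else 0) + l"
  using assms by (auto simp: tile_def Let_def mem_box inner_add_left inner_Basis)

lemma tile_measure:
  assumes "0 < l"
  shows "emeasure lborel (tile b1 b2 l s :: 'a::euclidean_space set) = ennreal (l ^ DIM('a))"
  unfolding tile_def Let_def using assms
  by (subst emeasure_lborel_box) (auto simp: inner_add_left)

lemma tile_disjoint:
  assumes "0 < l" "b1 \<in> Basis" "b2 \<in> Basis" "b1 \<noteq> b2" "s \<noteq> t"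
  shows "tile b1 b2 l s \<inter> tile b1 b2 l t = {}"
proof (rule ccontr)
  assume "tile b1 b2 l s \<inter> tile b1 b2 l t \<noteq> {}"
  then obtain x where x: "x \<in> tile b1 b2 l s" "x \<in> tile b1 b2 l t" by blast
  have eq: "m = n" if "l * real m < y" "y < l * real m + l" "l * real n < y" "y < l * real n + l" for m n :: nat and y
  proof -
    have "l * real m < l * (real n + 1)" "l * real n < l * (real m + 1)"
      using that by (auto simp: algebra_simps)
    then have "real m < real n + 1" "real n < real m + 1" using \<open>0 < l\<close> by simp_all
    then show ?thesis by linarith
  qed
  have "fst s = fst t"
    using tile_coordinates[OF x(1) assms(2-4,2)] tile_coordinates[OF x(2) assms(2-4,2)]
    by (intro eq[of _ "x \<bullet> b1"]) auto
  moreover have "snd s = snd t"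
    using tile_coordinates[OF x(1) assms(2-4,3)] tile_coordinates[OF x(2) assms(2-4,3)] assms(4)
    by (intro eq[of _ "x \<bullet> b2"]) auto
  ultimately show False using assms(5) by (simp add: prod_eq_iff)
qed

lemma tile_adjacent_dist:
  fixes x y :: "'a::euclidean_space"
  assumes "0 < l" "b1 \<in> Basis" "b2 \<in> Basis" "b1 \<noteq> b2"
    and x: "x \<in> tile b1 b2 l s" and y: "y \<in> tile b1 b2 l t"
    and st: "fst s \<le> Suc (fst t)" "fst t \<le> Suc (fst s)" "snd s \<le> Suc (snd t)" "snd t \<le> Suc (snd s)"
  shows "norm (x - y) \<le> 2 * l * real DIM('a)"
proof -
  have "\<bar>(x - y) \<bullet> b\<bar> \<le> 2 * l" if b: "b \<in> Basis" for b
  proof -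
    let ?c = "\<lambda>s. if b = b1 then real (fst s) else if b = b2 then real (snd s) else 0"
    have "?c s \<le> ?c t + 1" "?c t \<le> ?c s + 1" using st by auto
    then have "l * ?c s \<le> l * (?c t + 1)" "l * ?c t \<le> l * (?c s + 1)"
      using \<open>0 < l\<close> by (auto intro!: mult_left_mono simp del: mult_le_cancel_left_pos)
    then have "l * ?c s \<le> l * ?c t + l" "l * ?c t \<le> l * ?c s + l"
      unfolding distrib_left mult_1_right .
    then show ?thesis
      using tile_coordinates[OF x assms(2-4) b] tile_coordinates[OF y assms(2-4) b]
      unfolding inner_diff_left by linarith
  qed
  then have "(\<Sum>b\<in>Basis. \<bar>(x - y) \<bullet> b\<bar>) \<le> (\<Sum>b\<in>(Basis :: 'a set). 2 * l)" by (intro sum_mono)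
  then show ?thesis using norm_le_l1[of "x - y"] by (simp add: mult_ac)
qed

text \<open>A tile is closed if no point with a mark in \<open>{-1/8..1/8}\<close> lies over it.
  Such points over equal or adjacent tiles are joined, and 72 in the hypothesis yields the block
  threshold 1/72. The block argument gives positive probability, which the zero-one law lifts to
  1.\<close>

lemma percolation_high_intensity:
  fixes M :: "('a::euclidean_space \<times> real) set measure"
  assumes d: "2 \<le> DIM('a)" and P: "poisson_law \<rho> \<nu> M" and \<nu>: "real_distribution \<nu>"
    and \<rho>: "72 \<le> \<rho> * ((1 / (4 * real DIM('a))) ^ DIM('a) * measure \<nu> {-1/8..1/8})"
  shows "measure M {\<omega> \<in> configs. percolates 1 1 \<omega>} = 1"
proof -
  interpret N: real_distribution \<nu> by fact
  interpret prob_space M using P by (rule poisson_law_prob_space)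
  note sp = poisson_law_space[OF P]
  \<comment> \<open>Two distinct coordinate directions exist because d \<ge> 2.\<close>
  obtain b1 b2 :: 'a where b: "b1 \<in> Basis" "b2 \<in> Basis" "b1 \<noteq> b2"
    using d by (metis card_2_iff' card_le_Suc_iff ex_card insertI1 insertI2 insert_subset numeral_2_eq_2 subset_iff)
  \<comment> \<open>Points over adjacent tiles are then within 1/2, and marks of size at most 1/8
    cost at most 1/8 + 1/8 + 1/4 = 1/2, which together use up the threshold 1.\<close>
  define l where "l = 1 / (4 * real DIM('a))"
  have l: "0 < l" by (simp add: l_def)
  let ?J = "{-1/8..1/8} :: real set"
  define S where "S s = tile b1 b2 l s \<times> ?J" for s
  have tile_set: "tile b1 b2 l s \<in> sets borel" "bounded (tile b1 b2 l s)" for s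
    by (simp_all add: tile_def Let_def)
  have Sreg: "bounded_region (S s)" for s
    unfolding S_def using tile_set by (intro bounded_region_Times) auto
  define q where "q = exp (- (\<rho> * (l ^ DIM('a) * measure \<nu> ?J)))"
  have Sprob: "prob (avoid (S s)) = q" for s
  proof -
    have "emeasure (lborel \<Otimes>\<^sub>M \<nu>) (S s) = emeasure lborel (tile b1 b2 l s) * emeasure \<nu> ?J"
      unfolding S_def using tile_set by (intro N.emeasure_pair_measure_Times) auto
    also have "\<dots> = ennreal (l ^ DIM('a) * measure \<nu> ?J)"
      using l by (simp add: tile_measure[OF l] N.emeasure_eq_measure ennreal_mult)
    finally have "measure (lborel \<Otimes>\<^sub>M \<nu>) (S s) = l ^ DIM('a) * measure \<nu> ?J"
      using l by (intro measure_eq_emeasure_eq_ennreal) auto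
    then show ?thesis unfolding poisson_law_avoid[OF P Sreg] by (simp add: q_def)
  qed
  have q: "0 \<le> q" "q \<le> 1 / 72"
  proof -
    let ?v = "\<rho> * (l ^ DIM('a) * measure \<nu> ?J)"
    have "72 \<le> exp ?v" using \<rho> exp_ge_add_one_self[of ?v] unfolding l_def by linarith
    then show "q \<le> 1 / 72" unfolding q_def exp_minus by (simp add: field_simps)
  qed (simp add: q_def)
  have ev: "avoid (S s) \<in> events" for s
    using avoid_sets[OF Sreg] poisson_law_sets[OF P] by simp
  have closed: "prob (\<Inter>s\<in>F. avoid (S s)) \<le> q ^ card F" if F: "finite F" "F \<noteq> {}" for F
  proof -
    have "disjoint_family_on S F"
      unfolding disjoint_family_on_def S_def using tile_disjoint[OF l b] by blast
    then have "prob (avoid (\<Union>s\<in>F. S s)) = (\<Prod>s\<in>F. prob (avoid (S s)))"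
      using F Sreg by (intro poisson_law_avoid_UN[OF P \<nu>]) auto
    then show ?thesis using F by (simp add: avoid_UN Sprob)
  qed
  let ?good = "{\<omega> \<in> space M. \<forall>n. \<not> bad_square (\<lambda>s. \<omega> \<in> avoid (S s)) n (0, 0)}"
  have "0 < prob ?good"
    by (rule good_square_positive[OF prob_space_axioms q ev closed])
  moreover have "?good \<subseteq> {\<omega> \<in> configs. percolates 1 1 \<omega>}"
  proof
    fix \<omega> assume "\<omega> \<in> ?good"
    then have \<omega>: "\<omega> \<in> configs" and good: "\<And>n. \<not> bad_square (\<lambda>s. \<omega> \<in> avoid (S s)) n (0, 0)"
      by (auto simp: sp)
    let ?c = "\<lambda>s. \<omega> \<in> avoid (S s)"
    have occ: "\<exists>p. p \<in> \<omega> \<and> p \<in> S s" if "\<not> ?c s" for s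
      using that \<omega> by (auto simp: avoid_def)
    have edge: "(fst p, fst q) \<in> (graph_edges 1 1 \<omega>)\<^sup>*"
      if p: "p \<in> \<omega>" "p \<in> S s" and q: "q \<in> \<omega>" "q \<in> S t"
        and st: "fst s \<le> Suc (fst t)" "fst t \<le> Suc (fst s)" "snd s \<le> Suc (snd t)" "snd t \<le> Suc (snd s)"
      for p q s t
    proof (cases "fst p = fst q")
      case False
      have "norm (fst p - fst q) \<le> 2 * l * real DIM('a)"
        using p(2) q(2) by (intro tile_adjacent_dist[OF l b _ _ st]) (auto simp: S_def)
      also have "\<dots> = 1 / 2" by (simp add: l_def)
      finally have "norm (fst p - fst q) \<le> 1 / 2" .
      moreover have "\<bar>snd p\<bar> \<le> 1 / 8" "\<bar>snd q\<bar> \<le> 1 / 8"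
        using p(2) q(2) by (auto simp: S_def abs_le_iff)
      ultimately have "close 1 1 p q" unfolding close_def by (simp add: abs_le_iff)
      then have "(fst p, fst q) \<in> graph_edges 1 1 \<omega>" using p q False unfolding graph_edges_iff by blast
      then show ?thesis by blast
    qed simp
    have reach: "(fst p, fst q) \<in> (graph_edges 1 1 \<omega>)\<^sup>*"
      if "(s, t) \<in> (grid_edges ?c)\<^sup>*" "p \<in> \<omega>" "p \<in> S s" "q \<in> \<omega>" "q \<in> S t" for s t p q
      using that
    proof (induction arbitrary: q rule: rtrancl_induct)
      case base
      then show ?case by (intro edge[of p s q s]) auto
    next
      case (step t t')
      obtain r where r: "r \<in> \<omega>" "r \<in> S t" using occ[of t] step(2) by (auto simp: grid_edges_def)
      have "(fst p, fst r) \<in> (graph_edges 1 1 \<omega>)\<^sup>*" using step r by blast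
      moreover have "(fst r, fst q) \<in> (graph_edges 1 1 \<omega>)\<^sup>*"
        using r step.prems step(2) by (intro edge[of r t q t']) (auto simp: grid_edges_def)
      ultimately show ?case by (rule rtrancl_trans)
    qed
    have "\<not> ?c (0, 0)" using good[of 0] by simp
    then obtain p where p: "p \<in> \<omega>" "p \<in> S (0, 0)" using occ by blast
    have "\<not> bounded {y. (fst p, y) \<in> (graph_edges 1 1 \<omega>)\<^sup>*}"
    proof
      assume "bounded {y. (fst p, y) \<in> (graph_edges 1 1 \<omega>)\<^sup>*}"
      then obtain r where r: "\<And>y. (fst p, y) \<in> (graph_edges 1 1 \<omega>)\<^sup>* \<Longrightarrow> norm y \<le> r"
        by (auto simp: bounded_iff)
      obtain n :: nat where n: "r / l < real n" using reals_Archimedean2 by blast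
      obtain x y where xy: "((0, 0), (x, y)) \<in> (grid_edges ?c)\<^sup>*" "Suc n \<le> x \<or> Suc n \<le> y"
        using unbounded_open_cluster[OF good] by blast
      have "(x, y) \<noteq> (0, 0)" using xy(2) by auto
      then have "\<not> ?c (x, y)" using xy(1) by (auto elim: rtranclE simp: grid_edges_def)
      then obtain q where q: "q \<in> \<omega>" "q \<in> S (x, y)" using occ by blast
      then have t: "fst q \<in> tile b1 b2 l (x, y)" by (auto simp: S_def)
      have "l * real n < norm (fst q)"
      proof -
        have "l * real x < fst q \<bullet> b1" "l * real y < fst q \<bullet> b2"
          using tile_coordinates(1)[OF t b b(1)] tile_coordinates(1)[OF t b b(2)] b(3) by auto
        moreover have "fst q \<bullet> b1 \<le> norm (fst q)" "fst q \<bullet> b2 \<le> norm (fst q)"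
          using Basis_le_norm[OF b(1), of "fst q"] Basis_le_norm[OF b(2), of "fst q"] by auto
        moreover have "l * real n \<le> l * real x \<or> l * real n \<le> l * real y"
          using xy(2) l by auto
        ultimately show ?thesis by linarith
      qed
      moreover have "r < l * real n" using n l by (simp add: pos_divide_less_eq mult.commute)
      moreover have "norm (fst q) \<le> r" using r[OF reach[OF xy(1) p q]] .
      ultimately show False by linarith
    qed
    then show "\<omega> \<in> {\<omega> \<in> configs. percolates 1 1 \<omega>}" using p(1) \<omega> unfolding percolates_def by blast
  qed
  moreover have "{\<omega> \<in> configs. percolates 1 1 \<omega>} \<in> events"
    using percolates_sets poisson_law_sets[OF P] by simp
  ultimately have "0 < prob {\<omega> \<in> configs. percolates 1 1 \<omega>}"
    using finite_measure_mono by (meson order_less_le_trans)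
  then show ?thesis using percolation_zero_one[OF P \<nu>, of 1 1] by auto
qed

subsection \<open>Rescaling\<close>

definition rescale_point :: "real \<Rightarrow> real \<Rightarrow> 'a::euclidean_space \<times> real \<Rightarrow> 'a \<times> real" where
  "rescale_point \<zeta> \<beta> p = (fst p /\<^sub>R \<zeta>, snd p * \<beta> / \<zeta>)"

definition rescale :: "real \<Rightarrow> real \<Rightarrow> ('a::euclidean_space \<times> real) set \<Rightarrow> ('a \<times> real) set" where
  "rescale \<zeta> \<beta> \<omega> = rescale_point \<zeta> \<beta> ` {p \<in> \<omega>. \<bar>snd p\<bar> \<le> \<zeta> / \<beta>}"

lemma close_rescale:
  assumes "0 < \<zeta>" "0 < \<beta>"
  shows "close 1 1 (rescale_point \<zeta> \<beta> p) (rescale_point \<zeta> \<beta> q) \<longleftrightarrow> close \<zeta> \<beta> p q"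
proof -
  have "norm (fst p /\<^sub>R \<zeta> - fst q /\<^sub>R \<zeta>) = norm (fst p - fst q) / \<zeta>"
    using assms by (simp flip: scaleR_diff_right add: divide_inverse mult.commute)
  moreover have "\<bar>snd p * \<beta> / \<zeta>\<bar> = \<beta> * \<bar>snd p\<bar> / \<zeta>" "\<bar>snd q * \<beta> / \<zeta>\<bar> = \<beta> * \<bar>snd q\<bar> / \<zeta>"
    using assms by (simp_all add: abs_mult)
  moreover have "\<bar>snd p * \<beta> / \<zeta> - snd q * \<beta> / \<zeta>\<bar> = \<beta> * \<bar>snd p - snd q\<bar> / \<zeta>"
    using assms by (simp add: abs_mult flip: diff_divide_distrib left_diff_distrib)
  ultimately have "close 1 1 (rescale_point \<zeta> \<beta> p) (rescale_point \<zeta> \<beta> q) \<longleftrightarrow>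
      (norm (fst p - fst q) + \<beta> * (\<bar>snd p\<bar> + \<bar>snd q\<bar> + \<bar>snd p - snd q\<bar>)) / \<zeta> \<le> 1"
    by (simp add: close_def rescale_point_def add_divide_distrib distrib_left)
  also have "\<dots> \<longleftrightarrow> close \<zeta> \<beta> p q" using assms by (simp add: close_def)
  finally show ?thesis .
qed

lemma close_mark_bound:
  assumes "close \<zeta> \<beta> p q" "0 < \<beta>"
  shows "\<bar>snd p\<bar> \<le> \<zeta> / \<beta>" "\<bar>snd q\<bar> \<le> \<zeta> / \<beta>"
proof -
  have le: "\<beta> * (\<bar>snd p\<bar> + \<bar>snd q\<bar> + \<bar>snd p - snd q\<bar>) \<le> \<zeta>"
    using assms(1) norm_ge_zero[of "fst p - fst q"] unfolding close_def by linarith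
  have "\<beta> * \<bar>snd p\<bar> \<le> \<zeta>" "\<beta> * \<bar>snd q\<bar> \<le> \<zeta>"
    using assms(2) by (intro order_trans[OF _ le] mult_left_mono; simp)+
  then show "\<bar>snd p\<bar> \<le> \<zeta> / \<beta>" "\<bar>snd q\<bar> \<le> \<zeta> / \<beta>"
    using assms(2) by (simp_all add: pos_le_divide_eq mult.commute)
qed

lemma graph_edges_rescale:
  assumes "0 < \<zeta>" "0 < \<beta>"
  shows "(x /\<^sub>R \<zeta>, y /\<^sub>R \<zeta>) \<in> graph_edges 1 1 (rescale \<zeta> \<beta> \<omega>) \<longleftrightarrow> (x, y) \<in> graph_edges \<zeta> \<beta> \<omega>"
proof
  assume "(x, y) \<in> graph_edges \<zeta> \<beta> \<omega>"
  then obtain p q where pq: "p \<in> \<omega>" "q \<in> \<omega>" "fst p = x" "fst q = y" "close \<zeta> \<beta> p q" "x \<noteq> y"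
    by (auto simp: graph_edges_iff)
  then have "rescale_point \<zeta> \<beta> p \<in> rescale \<zeta> \<beta> \<omega>" "rescale_point \<zeta> \<beta> q \<in> rescale \<zeta> \<beta> \<omega>"
    using close_mark_bound[OF pq(5) assms(2)] by (auto simp: rescale_def)
  moreover have "close 1 1 (rescale_point \<zeta> \<beta> p) (rescale_point \<zeta> \<beta> q)"
    using close_rescale assms pq(5) by blast
  moreover have "fst (rescale_point \<zeta> \<beta> p) = x /\<^sub>R \<zeta>" "fst (rescale_point \<zeta> \<beta> q) = y /\<^sub>R \<zeta>"
    using pq by (auto simp: rescale_point_def)
  moreover have "x /\<^sub>R \<zeta> \<noteq> y /\<^sub>R \<zeta>" using pq(6) assms by simp
  ultimately show "(x /\<^sub>R \<zeta>, y /\<^sub>R \<zeta>) \<in> graph_edges 1 1 (rescale \<zeta> \<beta> \<omega>)"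
    unfolding graph_edges_iff by blast
next
  assume "(x /\<^sub>R \<zeta>, y /\<^sub>R \<zeta>) \<in> graph_edges 1 1 (rescale \<zeta> \<beta> \<omega>)"
  then obtain p q where pq: "p \<in> \<omega>" "q \<in> \<omega>" "fst p /\<^sub>R \<zeta> = x /\<^sub>R \<zeta>" "fst q /\<^sub>R \<zeta> = y /\<^sub>R \<zeta>"
    "close 1 1 (rescale_point \<zeta> \<beta> p) (rescale_point \<zeta> \<beta> q)" "x /\<^sub>R \<zeta> \<noteq> y /\<^sub>R \<zeta>"
    unfolding graph_edges_iff by (auto simp: rescale_def rescale_point_def)
  have "fst p = x" "fst q = y" "x \<noteq> y" using pq(3,4,6) assms by auto
  moreover have "close \<zeta> \<beta> p q" using pq(5) close_rescale[OF assms] by blast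
  ultimately
  show "(x, y) \<in> graph_edges \<zeta> \<beta> \<omega>" using pq(1,2) unfolding graph_edges_iff by blast
qed

lemma rtrancl_image:
  assumes "(x, y) \<in> r\<^sup>*" "\<And>x y. (x, y) \<in> r \<Longrightarrow> (f x, f y) \<in> s"
  shows "(f x, f y) \<in> s\<^sup>*"
  using assms(1) by (induction rule: rtrancl_induct) (auto intro: assms(2) rtrancl_into_rtrancl)

lemma percolates_rescale:
  assumes "0 < \<zeta>" "0 < \<beta>"
  shows "percolates 1 1 (rescale \<zeta> \<beta> \<omega>) \<longleftrightarrow> percolates \<zeta> \<beta> (\<omega> :: ('a::euclidean_space \<times> real) set)"
proof -
  let ?E = "graph_edges \<zeta> \<beta> \<omega>" and ?E' = "graph_edges 1 1 (rescale \<zeta> \<beta> \<omega>)"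
  have up: "(x /\<^sub>R \<zeta>, y /\<^sub>R \<zeta>) \<in> ?E'\<^sup>*" if "(x, y) \<in> ?E\<^sup>*" for x y
    using that graph_edges_rescale[OF assms] by (intro rtrancl_image[where f="\<lambda>x. x /\<^sub>R \<zeta>"]) blast+
  have down: "(\<zeta> *\<^sub>R x, \<zeta> *\<^sub>R y) \<in> ?E\<^sup>*" if "(x, y) \<in> ?E'\<^sup>*" for x y
  proof (rule rtrancl_image[OF that, where f="\<lambda>x. \<zeta> *\<^sub>R x"])
    fix x y assume "(x, y) \<in> ?E'"
    then show "(\<zeta> *\<^sub>R x, \<zeta> *\<^sub>R y) \<in> ?E"
      using graph_edges_rescale[OF assms, of "\<zeta> *\<^sub>R x" "\<zeta> *\<^sub>R y" \<omega>] assms by simp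
  qed
  show ?thesis
  proof
    assume "percolates 1 1 (rescale \<zeta> \<beta> \<omega>)"
    then obtain p where p: "p \<in> \<omega>" "\<not> bounded {y. (fst p /\<^sub>R \<zeta>, y) \<in> ?E'\<^sup>*}"
      by (auto simp: percolates_def rescale_def rescale_point_def)
    have "{y. (fst p /\<^sub>R \<zeta>, y) \<in> ?E'\<^sup>*} \<subseteq> (\<lambda>y. y /\<^sub>R \<zeta>) ` {y. (fst p, y) \<in> ?E\<^sup>*}"
    proof
      fix y assume "y \<in> {y. (fst p /\<^sub>R \<zeta>, y) \<in> ?E'\<^sup>*}"
      then have "(fst p, \<zeta> *\<^sub>R y) \<in> ?E\<^sup>*" using down[of "fst p /\<^sub>R \<zeta>" y] assms by simp
      then show "y \<in> (\<lambda>y. y /\<^sub>R \<zeta>) ` {y. (fst p, y) \<in> ?E\<^sup>*}"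
        using assms by (intro image_eqI[of _ _ "\<zeta> *\<^sub>R y"]) auto
    qed
    then have "\<not> bounded {y. (fst p, y) \<in> ?E\<^sup>*}"
      using p(2) bounded_scaling bounded_subset by blast
    then show "percolates \<zeta> \<beta> \<omega>" using p(1) unfolding percolates_def by blast
  next
    assume "percolates \<zeta> \<beta> \<omega>"
    then obtain x where x: "\<not> bounded {y. (x, y) \<in> ?E\<^sup>*}" by (auto simp: percolates_def)
    \<comment> \<open>A vertex with an unbounded cluster has an edge, so its mark is small enough
      for it to survive the deletion.\<close>
    have "{y. (x, y) \<in> ?E\<^sup>*} \<noteq> {x}" using x by auto
    then obtain y where "(x, y) \<in> ?E" by (auto elim: converse_rtranclE)
    then have "(x /\<^sub>R \<zeta>, y /\<^sub>R \<zeta>) \<in> ?E'" using graph_edges_rescale[OF assms] by blast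
    then have "x /\<^sub>R \<zeta> \<in> fst ` rescale \<zeta> \<beta> \<omega>" unfolding graph_edges_iff by force
    moreover have "\<not> bounded {y. (x /\<^sub>R \<zeta>, y) \<in> ?E'\<^sup>*}"
    proof
      assume "bounded {y. (x /\<^sub>R \<zeta>, y) \<in> ?E'\<^sup>*}"
      then have "bounded ((\<lambda>y. \<zeta> *\<^sub>R y) ` {y. (x /\<^sub>R \<zeta>, y) \<in> ?E'\<^sup>*})" by (rule bounded_scaling)
      moreover have "{y. (x, y) \<in> ?E\<^sup>*} \<subseteq> (\<lambda>y. \<zeta> *\<^sub>R y) ` {y. (x /\<^sub>R \<zeta>, y) \<in> ?E'\<^sup>*}"
      proof
        fix y assume "y \<in> {y. (x, y) \<in> ?E\<^sup>*}"
        then show "y \<in> (\<lambda>y. \<zeta> *\<^sub>R y) ` {y. (x /\<^sub>R \<zeta>, y) \<in> ?E'\<^sup>*}"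
          using up[of x y] assms by (intro image_eqI[of _ _ "y /\<^sub>R \<zeta>"]) auto
      qed
      ultimately show False using x bounded_subset by blast
    qed
    ultimately show "percolates 1 1 (rescale \<zeta> \<beta> \<omega>)" unfolding percolates_def by blast
  qed
qed

lemma rescale_config:
  assumes "\<omega> \<in> configs" "0 < \<zeta>"
  shows "rescale \<zeta> \<beta> \<omega> \<in> (configs :: ('a::euclidean_space \<times> real) set set)"
proof -
  have "finite (fst ` rescale \<zeta> \<beta> \<omega> \<inter> K)" if "bounded K" for K
  proof -
    have "finite (fst ` \<omega> \<inter> (\<lambda>x. \<zeta> *\<^sub>R x) ` K)"
      using assms(1) bounded_scaling[OF that] by (auto simp: configs_def locally_finite_set_def)
    then have "finite ((\<lambda>x. x /\<^sub>R \<zeta>) ` (fst ` \<omega> \<inter> (\<lambda>x. \<zeta> *\<^sub>R x) ` K))" by (rule finite_imageI)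
    moreover have "fst ` rescale \<zeta> \<beta> \<omega> \<inter> K \<subseteq> (\<lambda>x. x /\<^sub>R \<zeta>) ` (fst ` \<omega> \<inter> (\<lambda>x. \<zeta> *\<^sub>R x) ` K)"
    proof
      fix y assume "y \<in> fst ` rescale \<zeta> \<beta> \<omega> \<inter> K"
      then obtain p where p: "p \<in> \<omega>" "y = fst p /\<^sub>R \<zeta>" "y \<in> K"
        by (auto simp: rescale_def rescale_point_def)
      then have "fst p = \<zeta> *\<^sub>R y" using assms(2) by simp
      then have "fst p \<in> fst ` \<omega> \<inter> (\<lambda>x. \<zeta> *\<^sub>R x) ` K" using p by blast
      then show "y \<in> (\<lambda>x. x /\<^sub>R \<zeta>) ` (fst ` \<omega> \<inter> (\<lambda>x. \<zeta> *\<^sub>R x) ` K)" unfolding p(2) by (rule imageI)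
    qed
    ultimately show ?thesis by (rule finite_subset[rotated])
  qed
  moreover have "e = e'" if e: "(x, e) \<in> rescale \<zeta> \<beta> \<omega>" and e': "(x, e') \<in> rescale \<zeta> \<beta> \<omega>" for x e e'
  proof -
    obtain p where p: "p \<in> \<omega>" "(x, e) = rescale_point \<zeta> \<beta> p"
      using e unfolding rescale_def by blast
    obtain q where q: "q \<in> \<omega>" "(x, e') = rescale_point \<zeta> \<beta> q"
      using e' unfolding rescale_def by blast
    have "fst p /\<^sub>R \<zeta> = fst q /\<^sub>R \<zeta>" using p(2) q(2) by (simp add: rescale_point_def)
    then have "fst p = fst q" using assms(2) by simp
    then have "p = q" by (rule config_unique[OF assms(1) p(1) q(1)])
    then have "(x, e) = (x, e')" using p(2) q(2) by (simp only:)
    then show ?thesis by simp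
  qed
  ultimately show ?thesis unfolding configs_def locally_finite_set_def by blast
qed

definition rescale_preimage :: "real \<Rightarrow> real \<Rightarrow> ('a::euclidean_space \<times> real) set \<Rightarrow> ('a \<times> real) set" where
  "rescale_preimage \<zeta> \<beta> B = {p. \<bar>snd p\<bar> \<le> \<zeta> / \<beta>} \<inter> rescale_point \<zeta> \<beta> -` B"

text \<open>This moves avoidance from the rescaled configuration to the original one, where
  \<open>poisson_law\<close> evaluates it.\<close>

lemma rescale_avoids: "rescale \<zeta> \<beta> \<omega> \<inter> B = {} \<longleftrightarrow> \<omega> \<inter> rescale_preimage \<zeta> \<beta> B = {}"
  by (auto simp: rescale_def rescale_preimage_def)

lemma rescale_preimage_region:
  assumes B: "bounded_region B" and "0 < \<zeta>"
  shows "bounded_region (rescale_preimage \<zeta> \<beta> B :: ('a::euclidean_space \<times> real) set)"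
proof -
  have "continuous_on UNIV (rescale_point \<zeta> \<beta> :: 'a \<times> real \<Rightarrow> 'a \<times> real)"
    unfolding rescale_point_def divide_inverse by (intro continuous_intros)
  then have "rescale_point \<zeta> \<beta> \<in> borel_measurable (borel :: ('a \<times> real) measure)"
    by (rule borel_measurable_continuous_onI)
  then have "rescale_point \<zeta> \<beta> -` B \<in> sets borel"
    using B measurable_sets[of _ borel borel B] by (auto simp: bounded_region_def)
  moreover have "{p :: 'a \<times> real. \<bar>snd p\<bar> \<le> \<zeta> / \<beta>} \<in> sets borel"
    by (intro borel_closed closed_Collect_le continuous_intros)
  moreover have "fst ` rescale_preimage \<zeta> \<beta> B \<subseteq> (\<lambda>x. \<zeta> *\<^sub>R x) ` fst ` B"
  proof
    fix x assume "x \<in> fst ` rescale_preimage \<zeta> \<beta> B"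
    then obtain p where p: "x = fst p" "rescale_point \<zeta> \<beta> p \<in> B"
      unfolding rescale_preimage_def by blast
    have "x = \<zeta> *\<^sub>R fst (rescale_point \<zeta> \<beta> p)" using \<open>0 < \<zeta>\<close> by (simp add: p(1) rescale_point_def)
    then show "x \<in> (\<lambda>x. \<zeta> *\<^sub>R x) ` fst ` B" using p(2) by blast
  qed
  moreover have "bounded ((\<lambda>x. \<zeta> *\<^sub>R x) ` fst ` B)"
    using B by (intro bounded_scaling) (simp add: bounded_region_def)
  ultimately show ?thesis
    unfolding bounded_region_def rescale_preimage_def by (auto intro: bounded_subset)
qed

lemma rescale_measurable:
  assumes "0 < \<zeta>"
  shows "rescale \<zeta> \<beta> \<in> measurable config_space (config_space :: ('a::euclidean_space \<times> real) set measure)"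
proof (rule measurable_config_spaceI)
  show "rescale \<zeta> \<beta> w \<in> configs" if "w \<in> space config_space" for w
    using that assms by (simp add: rescale_config)
  show "{w \<in> space config_space. rescale \<zeta> \<beta> w \<inter> B = {}} \<in> sets config_space" if "bounded_region B" for B
    using avoid_sets[OF rescale_preimage_region[OF that assms]] by (simp add: rescale_avoids avoid_def)
qed

lemma emeasure_lborel_scaled_preimage:
  fixes A :: "'a::euclidean_space set"
  assumes "A \<in> sets borel" "0 < \<zeta>"
  shows "emeasure lborel {x. x /\<^sub>R \<zeta> \<in> A} = ennreal (\<zeta> ^ DIM('a)) * emeasure lborel A"
proof -
  have m: "(\<lambda>x :: 'a. 0 + inverse \<zeta> *\<^sub>R x) \<in> borel_measurable lborel" by simp
  have "emeasure lborel A = (\<integral>\<^sup>+x. ennreal (\<bar>inverse \<zeta>\<bar> ^ DIM('a)) * indicator A x \<partial>distr lborel borel (\<lambda>x. 0 + inverse \<zeta> *\<^sub>R x))"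
    using assms by (subst lborel_affine[of "inverse \<zeta>" 0]) (auto simp: emeasure_density)
  also have "\<dots> = ennreal (\<bar>inverse \<zeta>\<bar> ^ DIM('a)) * emeasure (distr lborel borel (\<lambda>x. 0 + inverse \<zeta> *\<^sub>R x)) A"
    using assms by (intro nn_integral_cmult_indicator) simp
  also have "emeasure (distr lborel borel (\<lambda>x. 0 + inverse \<zeta> *\<^sub>R x)) A = emeasure lborel {x. x /\<^sub>R \<zeta> \<in> A}"
    using assms by (subst emeasure_distr[OF m]) (auto intro!: arg_cong[where f="emeasure lborel"])
  finally have "ennreal (\<zeta> ^ DIM('a)) * emeasure lborel A =
      ennreal (\<zeta> ^ DIM('a)) * ennreal (\<bar>inverse \<zeta>\<bar> ^ DIM('a)) * emeasure lborel {x. x /\<^sub>R \<zeta> \<in> A}"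
    by (simp add: mult.assoc)
  also have "ennreal (\<zeta> ^ DIM('a)) * ennreal (\<bar>inverse \<zeta>\<bar> ^ DIM('a)) = 1"
    using assms by (simp add: power_inverse flip: ennreal_mult)
  finally show ?thesis by simp
qed

text \<open>If \<open>\<nu>'\<close> is a probability measure, \<open>J = UNIV\<close> shows that a
  nonnegative \<open>k\<close> is the mass of \<open>{-s..s}\<close>, the fraction of points that
  survive.\<close>

definition marks_rescale_to :: "real measure \<Rightarrow> real \<Rightarrow> real \<Rightarrow> real measure \<Rightarrow> bool" where
  "marks_rescale_to \<nu> s k \<nu>' \<longleftrightarrow>
     (\<forall>J\<in>sets borel. emeasure \<nu> {e \<in> {-s..s}. e / s \<in> J} = ennreal k * emeasure \<nu>' J)"

text \<open>Slicing at a fixed mark separates the two scalings: positions give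
  \<open>\<zeta> ^ d\<close> in every slice, marks give \<open>k\<close> in the outer
  integral.\<close>

lemma rescale_preimage_measure:
  fixes B :: "('a::euclidean_space \<times> real) set"
  assumes \<nu>: "real_distribution \<nu>" and \<nu>': "real_distribution \<nu>'"
    and pos: "0 < \<zeta>" "0 < \<beta>" "0 \<le> k" and r: "marks_rescale_to \<nu> (\<zeta> / \<beta>) k \<nu>'"
    and B: "bounded_region B"
  shows "measure (lborel \<Otimes>\<^sub>M \<nu>) (rescale_preimage \<zeta> \<beta> B) = \<zeta> ^ DIM('a) * k * measure (lborel \<Otimes>\<^sub>M \<nu>') B"
proof -
  interpret N: real_distribution \<nu> by fact
  interpret N': real_distribution \<nu>' by fact
  interpret P: pair_sigma_finite "lborel :: 'a measure" \<nu> ..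
  interpret P': pair_sigma_finite "lborel :: 'a measure" \<nu>' ..
  define s where "s = \<zeta> / \<beta>"
  have s: "0 < s" using pos by (simp add: s_def)
  define \<phi> where "\<phi> u = emeasure lborel ((\<lambda>x :: 'a. (x, u)) -` B)" for u
  have Bm: "B \<in> sets (lborel \<Otimes>\<^sub>M \<nu>')" "rescale_preimage \<zeta> \<beta> B \<in> sets (lborel \<Otimes>\<^sub>M \<nu>)"
    by (rule fmeasurableD[OF bounded_region_finite_measure[OF \<nu>' B]],
        rule fmeasurableD[OF bounded_region_finite_measure[OF \<nu> rescale_preimage_region[OF B pos(1)]]])
  have sec: "(\<lambda>x. (x, u)) -` B \<in> sets borel" for u
    using sets_Pair2[OF Bm(1), of u] by simp
  have "\<phi> \<in> borel_measurable \<nu>'"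
    unfolding \<phi>_def by (rule P'.measurable_emeasure_Pair2[OF Bm(1)])
  then have \<phi> [measurable]: "\<phi> \<in> borel_measurable borel"
    by (simp add: measurable_cong_sets[OF N'.events_eq_borel refl])
  have slice: "emeasure lborel ((\<lambda>x. (x, e)) -` rescale_preimage \<zeta> \<beta> B) =
      ennreal (\<zeta> ^ DIM('a)) * (indicator {-s..s} e * \<phi> (e / s))" for e
  proof (cases "e \<in> {-s..s}")
    case True
    then have "\<bar>e\<bar> \<le> \<zeta> / \<beta>" by (auto simp: s_def)
    then have "(\<lambda>x. (x, e)) -` rescale_preimage \<zeta> \<beta> B = {x. x /\<^sub>R \<zeta> \<in> (\<lambda>x. (x, e / s)) -` B}"
      by (auto simp: rescale_preimage_def rescale_point_def s_def)
    then show ?thesis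
      using True emeasure_lborel_scaled_preimage[OF sec pos(1)] by (simp add: \<phi>_def)
  next
    case False
    then have "\<not> \<bar>e\<bar> \<le> \<zeta> / \<beta>" by (auto simp: s_def)
    then have "(\<lambda>x. (x, e)) -` rescale_preimage \<zeta> \<beta> B = {}"
      by (auto simp: rescale_preimage_def)
    then show ?thesis using False by simp
  qed
  \<comment> \<open>The law of the retained and divided marks, which \<open>r\<close> identifies
    with \<open>k\<close> times \<open>\<nu>'\<close>.\<close>
  let ?D = "distr (density \<nu> (indicator {-s..s})) borel (\<lambda>e. e / s)"
  have Dm: "(\<lambda>e. e / s) \<in> measurable (density \<nu> (indicator {-s..s})) borel"
    by (simp add: measurable_cong_sets[OF N.events_eq_borel refl])
  have "?D = density \<nu>' (\<lambda>_. ennreal k)"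
  proof (rule measure_eqI)
    fix J assume "J \<in> sets ?D"
    then have J: "J \<in> sets borel" by simp
    have pre: "(\<lambda>e. e / s) -` J \<in> sets borel"
      using measurable_sets[of "\<lambda>e. e / s" borel borel J] J by simp
    have "emeasure ?D J = emeasure (density \<nu> (indicator {-s..s})) ((\<lambda>e. e / s) -` J)"
      using J by (subst emeasure_distr[OF Dm]) (auto simp: N.space_eq_univ)
    also have "\<dots> = emeasure \<nu> ({-s..s} \<inter> (\<lambda>e. e / s) -` J)"
      using pre by (subst emeasure_density) (auto simp: N.events_eq_borel
          measurable_cong_sets[OF N.events_eq_borel refl] simp flip: indicator_inter_arith)
    also have "{-s..s} \<inter> (\<lambda>e. e / s) -` J = {e \<in> {-s..s}. e / s \<in> J}" by auto
    also have "emeasure \<nu> \<dots> = ennreal k * emeasure \<nu>' J"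
      using r J unfolding marks_rescale_to_def s_def by blast
    also have "\<dots> = emeasure (density \<nu>' (\<lambda>_. ennreal k)) J"
      using J by (simp add: emeasure_density_const N'.events_eq_borel)
    finally show "emeasure ?D J = emeasure (density \<nu>' (\<lambda>_. ennreal k)) J" .
  qed (simp add: N'.events_eq_borel)
  note D = this
  have "emeasure (lborel \<Otimes>\<^sub>M \<nu>) (rescale_preimage \<zeta> \<beta> B) =
      (\<integral>\<^sup>+e. emeasure lborel ((\<lambda>x. (x, e)) -` rescale_preimage \<zeta> \<beta> B) \<partial>\<nu>)"
    by (rule P.emeasure_pair_measure_alt2[OF Bm(2)])
  also have "\<dots> = ennreal (\<zeta> ^ DIM('a)) * (\<integral>\<^sup>+e. indicator {-s..s} e * \<phi> (e / s) \<partial>\<nu>)"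
    unfolding slice by (intro nn_integral_cmult) (simp add: measurable_cong_sets[OF N.events_eq_borel refl])
  also have "(\<integral>\<^sup>+e. indicator {-s..s} e * \<phi> (e / s) \<partial>\<nu>) = (\<integral>\<^sup>+u. \<phi> u \<partial>?D)"
    by (subst nn_integral_distr[OF Dm]) (simp_all add: nn_integral_density measurable_cong_sets[OF N.events_eq_borel refl])
  also have "\<dots> = ennreal k * (\<integral>\<^sup>+u. \<phi> u \<partial>\<nu>')"
    unfolding D by (simp add: nn_integral_density nn_integral_cmult measurable_cong_sets[OF N'.events_eq_borel refl])
  also have "(\<integral>\<^sup>+u. \<phi> u \<partial>\<nu>') = emeasure (lborel \<Otimes>\<^sub>M \<nu>') B"
    unfolding \<phi>_def by (rule P'.emeasure_pair_measure_alt2[OF Bm(1), symmetric])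
  finally have "emeasure (lborel \<Otimes>\<^sub>M \<nu>) (rescale_preimage \<zeta> \<beta> B) =
      ennreal (\<zeta> ^ DIM('a)) * (ennreal k * emeasure (lborel \<Otimes>\<^sub>M \<nu>') B)" .
  then show ?thesis
    using pos by (simp add: measure_def enn2real_mult mult.assoc)
qed

lemma poisson_law_rescale:
  fixes M :: "('a::euclidean_space \<times> real) set measure"
  assumes P: "poisson_law \<rho> \<nu> M" and \<nu>: "real_distribution \<nu>" "real_distribution \<nu>'"
    and pos: "0 < \<zeta>" "0 < \<beta>" "0 \<le> k" and r: "marks_rescale_to \<nu> (\<zeta> / \<beta>) k \<nu>'"
  shows "poisson_law (\<rho> * \<zeta> ^ DIM('a) * k) \<nu>' (distr M config_space (rescale \<zeta> \<beta>))"
  unfolding poisson_law_def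
proof (intro conjI allI impI)
  interpret prob_space M using P by (rule poisson_law_prob_space)
  have T: "rescale \<zeta> \<beta> \<in> measurable M config_space"
    using rescale_measurable[OF pos(1)] measurable_cong_sets[OF poisson_law_sets[OF P] refl] by blast
  show "prob_space (distr M config_space (rescale \<zeta> \<beta>))" by (rule prob_space_distr[OF T])
  fix B :: "('a \<times> real) set" assume B: "bounded_region B"
  have "measure (distr M config_space (rescale \<zeta> \<beta>)) (avoid B) = prob (rescale \<zeta> \<beta> -` avoid B \<inter> space M)"
    by (rule measure_distr[OF T avoid_sets[OF B]])
  also have "rescale \<zeta> \<beta> -` avoid B \<inter> space M = avoid (rescale_preimage \<zeta> \<beta> B)"
    unfolding poisson_law_space[OF P] using rescale_config[OF _ pos(1)]
    by (auto simp: avoid_def rescale_avoids)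
  also have "prob \<dots> = exp (- (\<rho> * \<zeta> ^ DIM('a) * k * measure (lborel \<Otimes>\<^sub>M \<nu>') B))"
    unfolding poisson_law_avoid[OF P rescale_preimage_region[OF B pos(1)]]
      rescale_preimage_measure[OF \<nu> pos r B] by (simp add: mult.assoc)
  finally show "measure (distr M config_space (rescale \<zeta> \<beta>)) (avoid B) = \<dots>" .
qed simp

lemma theta_eq:
  assumes "0 < \<rho>" "real_distribution \<nu>"
  shows "theta TYPE('a::euclidean_space) \<zeta> \<beta> \<rho> \<nu> =
    measure (PPP \<rho> \<nu> :: ('a \<times> real) set measure) {\<omega> \<in> configs. percolates \<zeta> \<beta> \<omega>}"
  unfolding theta_def poisson_law_space[OF poisson_law_PPP[OF assms]] ..

text \<open>The rescaled process has the avoidance function of a Poisson process with the new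
  parameters, hence its law, and the percolation events correspond under
  \<open>rescale\<close>.\<close>

lemma theta_rescale:
  assumes "0 < \<rho>" and \<nu>: "real_distribution \<nu>" "real_distribution \<nu>'"
    and pos: "0 < \<zeta>" "0 < \<beta>" "0 < k" and r: "marks_rescale_to \<nu> (\<zeta> / \<beta>) k \<nu>'"
  shows "theta TYPE('a::euclidean_space) \<zeta> \<beta> \<rho> \<nu> = theta TYPE('a) 1 1 (\<rho> * \<zeta> ^ DIM('a) * k) \<nu>'"
proof -
  let ?M = "PPP \<rho> \<nu> :: ('a \<times> real) set measure"
  note P = poisson_law_PPP[OF assms(1) \<nu>(1), where 'a='a]
  have pos': "0 < \<rho> * \<zeta> ^ DIM('a) * k" using assms by simp
  have "distr ?M config_space (rescale \<zeta> \<beta>) = PPP (\<rho> * \<zeta> ^ DIM('a) * k) \<nu>'"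
    using poisson_law_rescale[OF P \<nu> pos(1,2) less_imp_le[OF pos(3)] r] poisson_law_PPP[OF pos' \<nu>(2)]
    by (rule poisson_law_unique)
  then have "theta TYPE('a) 1 1 (\<rho> * \<zeta> ^ DIM('a) * k) \<nu>' =
      measure (distr ?M config_space (rescale \<zeta> \<beta>)) {\<omega> \<in> configs. percolates 1 1 \<omega>}"
    by (simp add: theta_eq[OF pos' \<nu>(2)])
  also have "\<dots> = measure ?M (rescale \<zeta> \<beta> -` {\<omega> \<in> configs. percolates 1 1 \<omega>} \<inter> space ?M)"
  proof (rule measure_distr)
    show "rescale \<zeta> \<beta> \<in> measurable ?M config_space"
      using rescale_measurable[OF pos(1)] measurable_cong_sets[OF poisson_law_sets[OF P] refl] by blast
  qed (rule percolates_sets)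
  also have "rescale \<zeta> \<beta> -` {\<omega> \<in> configs. percolates 1 1 \<omega>} \<inter> space ?M = {\<omega> \<in> configs. percolates \<zeta> \<beta> \<omega>}"
    unfolding poisson_law_space[OF P]
    using rescale_config[OF _ pos(1)] percolates_rescale[OF pos(1,2)] by blast
  finally show ?thesis by (simp add: theta_eq[OF assms(1) \<nu>(1)])
qed

subsection \<open>Mark distributions with power-law densities\<close>

text \<open>Covers the one-sided and the symmetric law at once: in both uses \<open>h\<close> is
  invariant under positive scaling.\<close>

definition power_marks :: "(real \<Rightarrow> real) \<Rightarrow> real \<Rightarrow> real \<Rightarrow> real measure" where
  "power_marks h C \<alpha> = density lborel
     (\<lambda>E. ennreal ((\<alpha> + 1) / C powr (\<alpha> + 1) * (h E * \<bar>E\<bar> powr \<alpha>) * indicator {-C..C} E))"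

lemma nu_plus_power_marks: "nu_plus C \<alpha> = power_marks (indicator {0..}) C \<alpha>"
  unfolding nu_plus_def power_marks_def
  by (intro arg_cong[where f="density lborel"]) (auto simp: fun_eq_iff indicator_def)

lemma nu_sym_power_marks: "nu_sym C \<alpha> = power_marks (\<lambda>_. 1 / 2) C \<alpha>"
  unfolding nu_sym_def power_marks_def
  by (intro arg_cong[where f="density lborel"]) (auto simp: fun_eq_iff indicator_def mult.commute)

text \<open>The substitution E = s u: homogeneity of the density gives
  \<open>s powr \<alpha>\<close>, the differential one more factor s. The bound
  \<open>s \<le> C\<close> keeps the cutoff out of reach.\<close>

lemma power_marks_rescale:
  assumes h [measurable]: "h \<in> borel_measurable borel" and hom: "\<And>s u. 0 < s \<Longrightarrow> h (s * u) = h u"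
    and h0: "\<And>u. 0 \<le> h u"
    and s: "0 < s" "s \<le> C" and "0 \<le> \<alpha>" and J [measurable]: "J \<in> sets borel"
  shows "emeasure (power_marks h C \<alpha>) {e \<in> {-s..s}. e / s \<in> J} =
    ennreal ((s / C) powr (\<alpha> + 1)) * emeasure (power_marks h 1 \<alpha>) J"
proof -
  let ?S = "{e \<in> {-s..s}. e / s \<in> J}"
  let ?f = "\<lambda>C E. (\<alpha> + 1) / C powr (\<alpha> + 1) * (h E * \<bar>E\<bar> powr \<alpha>) * indicator {-C..C} E"
  have S [measurable]: "?S \<in> sets borel" by measurable
  have fm [measurable]: "?f C \<in> borel_measurable borel" for C by measurable
  have "emeasure (power_marks h C \<alpha>) ?S = (\<integral>\<^sup>+E. ennreal (?f C E) * indicator ?S E \<partial>lborel)"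
    unfolding power_marks_def by (rule emeasure_density) measurable
  also have "\<dots> = ennreal \<bar>s\<bar> * (\<integral>\<^sup>+u. ennreal (?f C (0 + s * u)) * indicator ?S (0 + s * u) \<partial>lborel)"
    using s by (intro nn_integral_real_affine) auto
  also have "\<dots> = (\<integral>\<^sup>+u. ennreal \<bar>s\<bar> * (ennreal (?f C (0 + s * u)) * indicator ?S (0 + s * u)) \<partial>lborel)"
    by (intro nn_integral_cmult[symmetric]) measurable
  also have "\<dots> = (\<integral>\<^sup>+u. ennreal ((s / C) powr (\<alpha> + 1)) * (ennreal (?f 1 u) * indicator J u) \<partial>lborel)"
  proof (rule nn_integral_cong)
    fix u :: real
    show "ennreal \<bar>s\<bar> * (ennreal (?f C (0 + s * u)) * indicator ?S (0 + s * u)) =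
      ennreal ((s / C) powr (\<alpha> + 1)) * (ennreal (?f 1 u) * indicator J u)"
    proof (cases "u \<in> {-1..1} \<inter> J")
      case True
      have su: "-s \<le> s * u" "s * u \<le> s"
        using True s mult_left_mono[of "-1" u s] mult_left_mono[of u 1 s] by auto
      have "s * u \<in> {-C..C}" unfolding atLeastAtMost_iff using su s by linarith
      moreover have "s * u \<in> ?S" using su True s by simp
      moreover have "s * ((\<alpha> + 1) / C powr (\<alpha> + 1) * (h (s * u) * \<bar>s * u\<bar> powr \<alpha>)) =
          (s / C) powr (\<alpha> + 1) * ((\<alpha> + 1) * (h u * \<bar>u\<bar> powr \<alpha>))"
        using s by (simp add: hom abs_mult powr_mult powr_divide powr_add)
      ultimately show ?thesis
        using True s h0 \<open>0 \<le> \<alpha>\<close> by (simp flip: ennreal_mult)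
    next
      case False
      have "u \<in> {-1..1} \<inter> J" if "s * u \<in> ?S"
      proof -
        have "s * -1 \<le> s * u" "s * u \<le> s * 1" using that by auto
        then have "-1 \<le> u" "u \<le> 1" using s by (simp_all only: mult_le_cancel_left_pos)
        then show ?thesis using that s by simp
      qed
      then have "s * u \<notin> ?S" using False by blast
      then have L: "indicator ?S (0 + s * u) = (0 :: ennreal)"
        unfolding add_0_left by (rule indicator_simps(2))
      have R: "ennreal (?f 1 u) * indicator J u = 0"
      proof (cases "u \<in> J")
        case True
        then have "u \<notin> {-1..1}" using False by blast
        then have "indicator {-1..1} u = (0 :: real)" by (rule indicator_simps(2))
        then show ?thesis by (simp only: mult_zero_right ennreal_0 mult_zero_left)
      qed simp
      show ?thesis unfolding L R by simp
    qed
  qed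
  also have "\<dots> = ennreal ((s / C) powr (\<alpha> + 1)) * (\<integral>\<^sup>+u. ennreal (?f 1 u) * indicator J u \<partial>lborel)"
    by (intro nn_integral_cmult) measurable
  also have "(\<integral>\<^sup>+u. ennreal (?f 1 u) * indicator J u \<partial>lborel) = emeasure (power_marks h 1 \<alpha>) J"
    unfolding power_marks_def by (rule emeasure_density[symmetric]) measurable
  finally show ?thesis .
qed

lemma nn_integral_power_marks:
  fixes \<alpha> :: real
  assumes "0 \<le> \<alpha>"
  shows "(\<integral>\<^sup>+u. ennreal ((\<alpha> + 1) * \<bar>u\<bar> powr \<alpha> * indicator {0..1} u) \<partial>lborel) = 1"
proof -
  have "((\<lambda>u. u powr \<alpha>) has_integral (1 powr (\<alpha> + 1) / (\<alpha> + 1))) {0..1::real}"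
    using assms by (intro has_integral_powr_from_0) auto
  then have "((\<lambda>u. (\<alpha> + 1) * u powr \<alpha>) has_integral ((\<alpha> + 1) * (1 powr (\<alpha> + 1) / (\<alpha> + 1)))) {0..1::real}"
    by (rule has_integral_mult_right)
  then have "((\<lambda>u. (\<alpha> + 1) * u powr \<alpha>) has_integral 1) {0..1::real}" using assms by simp
  then have "integral\<^sup>N lborel (\<lambda>u. indicator {0..1} u * ((\<alpha> + 1) * u powr \<alpha>)) = ennreal 1"
    using assms by (intro nn_integral_has_integral_lebesgue) auto
  also have "(\<lambda>u :: real. indicator {0..1} u * ((\<alpha> + 1) * u powr \<alpha>)) =
      (\<lambda>u. (\<alpha> + 1) * \<bar>u\<bar> powr \<alpha> * indicator {0..1} u)"
    by (auto simp: fun_eq_iff indicator_def)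
  finally show ?thesis by simp
qed

lemma nn_integral_reflected_power_marks:
  fixes \<alpha> :: real
  assumes "0 \<le> \<alpha>"
  shows "(\<integral>\<^sup>+u. ennreal ((\<alpha> + 1) * \<bar>u\<bar> powr \<alpha> * indicator {0..1} (- u)) \<partial>lborel) = 1"
proof -
  have "1 = (\<integral>\<^sup>+u. ennreal ((\<alpha> + 1) * \<bar>u\<bar> powr \<alpha> * indicator {0..1} u) \<partial>lborel)"
    by (rule nn_integral_power_marks[OF assms, symmetric])
  also have "\<dots> = ennreal \<bar>-1\<bar> * (\<integral>\<^sup>+u. ennreal ((\<alpha> + 1) * \<bar>0 + -1 * u\<bar> powr \<alpha> * indicator {0..1} (0 + -1 * u)) \<partial>lborel)"
    by (intro nn_integral_real_affine) auto
  finally show ?thesis by simp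
qed

lemma nn_integral_half:
  assumes "f \<in> borel_measurable M" "\<And>u. 0 \<le> f u"
  shows "(\<integral>\<^sup>+u. ennreal (f u / 2) \<partial>M) = ennreal (1 / 2) * (\<integral>\<^sup>+u. ennreal (f u) \<partial>M)"
proof -
  have "ennreal (f u / 2) = ennreal (1 / 2) * ennreal (f u)" for u
    using assms(2)[of u] by (subst ennreal_mult[symmetric]) auto
  then have "(\<integral>\<^sup>+u. ennreal (f u / 2) \<partial>M) = (\<integral>\<^sup>+u. ennreal (1 / 2) * ennreal (f u) \<partial>M)"
    by (simp only:)
  also have "\<dots> = ennreal (1 / 2) * (\<integral>\<^sup>+u. ennreal (f u) \<partial>M)"
    using assms(1) by (intro nn_integral_cmult) measurable
  finally show ?thesis .
qed

lemma real_distribution_power_marks: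
  assumes "emeasure (power_marks h C \<alpha>) UNIV = 1"
  shows "real_distribution (power_marks h C \<alpha>)"
proof -
  have "prob_space (power_marks h C \<alpha>)"
    by (rule prob_spaceI) (use assms in \<open>simp add: power_marks_def\<close>)
  then show ?thesis
    by (simp add: real_distribution_def real_distribution_axioms_def power_marks_def)
qed

lemma real_distribution_nu_plus:
  assumes "0 \<le> \<alpha>"
  shows "real_distribution (nu_plus 1 \<alpha>)"
  unfolding nu_plus_power_marks
proof (rule real_distribution_power_marks)
  have "emeasure (power_marks (indicator {0..}) 1 \<alpha>) UNIV =
      (\<integral>\<^sup>+u. ennreal ((\<alpha> + 1) * \<bar>u\<bar> powr \<alpha> * indicator {0..1} u) \<partial>lborel)"
    unfolding power_marks_def
    by (subst emeasure_density) (auto intro!: nn_integral_cong simp: indicator_def)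
  then show "emeasure (power_marks (indicator {0..}) 1 \<alpha>) UNIV = 1"
    by (simp add: nn_integral_power_marks[OF assms])
qed

lemma nu_sym_negative:
  assumes "0 \<le> \<alpha>"
  shows "emeasure (nu_sym 1 \<alpha>) {..<0} = ennreal (1 / 2)"
proof -
  have "emeasure (nu_sym 1 \<alpha>) {..<0} =
      (\<integral>\<^sup>+u. ennreal ((\<alpha> + 1) * \<bar>u\<bar> powr \<alpha> * indicator {0..1} (- u) / 2) \<partial>lborel)"
    unfolding nu_sym_power_marks power_marks_def using assms
    by (subst emeasure_density) (auto intro!: nn_integral_cong simp: indicator_def)
  also have "\<dots> = ennreal (1 / 2) * (\<integral>\<^sup>+u. ennreal ((\<alpha> + 1) * \<bar>u\<bar> powr \<alpha> * indicator {0..1} (- u)) \<partial>lborel)"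
    using assms by (intro nn_integral_half) auto
  finally show ?thesis by (simp only: nn_integral_reflected_power_marks[OF assms] mult_1_right)
qed

lemma real_distribution_nu_sym:
  assumes "0 \<le> \<alpha>"
  shows "real_distribution (nu_sym 1 \<alpha>)"
  unfolding nu_sym_power_marks
proof (rule real_distribution_power_marks)
  have "emeasure (power_marks (\<lambda>_. 1 / 2) 1 \<alpha>) UNIV =
      (\<integral>\<^sup>+u. ennreal ((\<alpha> + 1) * \<bar>u\<bar> powr \<alpha> * indicator {0..1} u / 2) +
         ennreal ((\<alpha> + 1) * \<bar>u\<bar> powr \<alpha> * indicator {0..1} (- u) / 2) \<partial>lborel)"
    unfolding power_marks_def using assms
    by (subst emeasure_density) (auto intro!: nn_integral_cong simp: indicator_def)
  also have "\<dots> = (\<integral>\<^sup>+u. ennreal ((\<alpha> + 1) * \<bar>u\<bar> powr \<alpha> * indicator {0..1} u / 2) \<partial>lborel) +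
      (\<integral>\<^sup>+u. ennreal ((\<alpha> + 1) * \<bar>u\<bar> powr \<alpha> * indicator {0..1} (- u) / 2) \<partial>lborel)"
    by (rule nn_integral_add) measurable
  also have "(\<integral>\<^sup>+u. ennreal ((\<alpha> + 1) * \<bar>u\<bar> powr \<alpha> * indicator {0..1} u / 2) \<partial>lborel) =
      ennreal (1 / 2) * (\<integral>\<^sup>+u. ennreal ((\<alpha> + 1) * \<bar>u\<bar> powr \<alpha> * indicator {0..1} u) \<partial>lborel)"
    using assms by (intro nn_integral_half) auto
  also have "(\<integral>\<^sup>+u. ennreal ((\<alpha> + 1) * \<bar>u\<bar> powr \<alpha> * indicator {0..1} (- u) / 2) \<partial>lborel) =
      ennreal (1 / 2) * (\<integral>\<^sup>+u. ennreal ((\<alpha> + 1) * \<bar>u\<bar> powr \<alpha> * indicator {0..1} (- u)) \<partial>lborel)"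
    using assms by (intro nn_integral_half) auto
  also have "ennreal (1 / 2) * (\<integral>\<^sup>+u. ennreal ((\<alpha> + 1) * \<bar>u\<bar> powr \<alpha> * indicator {0..1} u) \<partial>lborel) +
      ennreal (1 / 2) * (\<integral>\<^sup>+u. ennreal ((\<alpha> + 1) * \<bar>u\<bar> powr \<alpha> * indicator {0..1} (- u)) \<partial>lborel) =
      ennreal (1 / 2) + ennreal (1 / 2)"
    by (simp only: nn_integral_power_marks[OF assms] nn_integral_reflected_power_marks[OF assms] mult_1_right)
  also have "\<dots> = 1" by (subst ennreal_plus[symmetric]) auto
  finally show "emeasure (power_marks (\<lambda>_. 1 / 2) 1 \<alpha>) UNIV = 1" .
qed

lemma nu_plus_rescale:
  assumes "0 < s" "s \<le> C" "0 \<le> \<alpha>" "J \<in> sets borel"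
  shows "emeasure (nu_plus C \<alpha>) {e \<in> {-s..s}. e / s \<in> J} = ennreal ((s / C) powr (\<alpha> + 1)) * emeasure (nu_plus 1 \<alpha>) J"
  unfolding nu_plus_power_marks using assms
  by (intro power_marks_rescale) (auto simp: indicator_def zero_le_mult_iff)

lemma nu_sym_rescale:
  assumes "0 < s" "s \<le> C" "0 \<le> \<alpha>" "J \<in> sets borel"
  shows "emeasure (nu_sym C \<alpha>) {e \<in> {-s..s}. e / s \<in> J} = ennreal ((s / C) powr (\<alpha> + 1)) * emeasure (nu_sym 1 \<alpha>) J"
  unfolding nu_sym_power_marks using assms by (intro power_marks_rescale) auto

lemma scaled_set_borel:
  fixes s :: real
  assumes [measurable]: "J \<in> sets borel"
  shows "{e \<in> {-s..s}. e / s \<in> J} \<in> sets borel"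
  by measurable

lemma V_plus_marks_rescale:
  assumes "V_plus_with \<alpha> \<nu> \<epsilon> C" "0 \<le> \<alpha>" "0 < s" "s \<le> min C \<epsilon>"
  shows "marks_rescale_to \<nu> s ((s / C) powr (\<alpha> + 1)) (nu_plus 1 \<alpha>)"
  unfolding marks_rescale_to_def
proof
  fix J :: "real set" assume J: "J \<in> sets borel"
  have "{e \<in> {-s..s}. e / s \<in> J} \<subseteq> {-\<epsilon>..\<epsilon>}" using assms(4) by auto
  with J have "emeasure \<nu> {e \<in> {-s..s}. e / s \<in> J} = emeasure (nu_plus C \<alpha>) {e \<in> {-s..s}. e / s \<in> J}"
    using assms(1) scaled_set_borel[OF J] unfolding V_plus_with_def by blast
  also have "\<dots> = ennreal ((s / C) powr (\<alpha> + 1)) * emeasure (nu_plus 1 \<alpha>) J"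
    by (rule nu_plus_rescale) (use assms J in auto)
  finally show "emeasure \<nu> {e \<in> {-s..s}. e / s \<in> J} = \<dots>" .
qed

lemma V_sym_marks_rescale:
  assumes "V_sym_with \<alpha> \<nu> \<epsilon> C" "0 \<le> \<alpha>" "0 < s" "s \<le> min C \<epsilon>"
  shows "marks_rescale_to \<nu> s ((s / C) powr (\<alpha> + 1)) (nu_sym 1 \<alpha>)"
  unfolding marks_rescale_to_def
proof
  fix J :: "real set" assume J: "J \<in> sets borel"
  have "{e \<in> {-s..s}. e / s \<in> J} \<subseteq> {-\<epsilon>..\<epsilon>}" using assms(4) by auto
  with J have "emeasure \<nu> {e \<in> {-s..s}. e / s \<in> J} = emeasure (nu_sym C \<alpha>) {e \<in> {-s..s}. e / s \<in> J}"
    using assms(1) scaled_set_borel[OF J] unfolding V_sym_with_def by blast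
  also have "\<dots> = ennreal ((s / C) powr (\<alpha> + 1)) * emeasure (nu_sym 1 \<alpha>) J"
    by (rule nu_sym_rescale) (use assms J in auto)
  finally show "emeasure \<nu> {e \<in> {-s..s}. e / s \<in> J} = \<dots>" .
qed

text \<open>Serves the symmetric case, as \<open>lambda_c_star\<close> tests \<open>V_plus\<close>
  first. At a scale s not exceeding any of the four constants, the negative marks have positive mass
  under one description and none under the other.\<close>

lemma V_plus_disjoint_V_sym:
  assumes "V_sym_with \<alpha> \<nu> \<epsilon> C" "0 \<le> \<alpha>"
  shows "\<nu> \<notin> V_plus \<alpha>"
proof
  assume "\<nu> \<in> V_plus \<alpha>"
  then obtain \<epsilon>' C' where V: "V_plus_with \<alpha> \<nu> \<epsilon>' C'" by (auto simp: V_plus_def)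
  define s where "s = min (min C \<epsilon>) (min C' \<epsilon>')"
  have s: "0 < s" "s \<le> min C \<epsilon>" "s \<le> min C' \<epsilon>'"
    using assms(1) V by (auto simp: s_def V_sym_with_def V_plus_with_def)
  have C: "0 < C" using assms(1) by (simp add: V_sym_with_def)
  let ?N = "{e \<in> {-s..s}. e / s \<in> {..<0}}"
  have "emeasure \<nu> ?N = ennreal ((s / C) powr (\<alpha> + 1)) * emeasure (nu_sym 1 \<alpha>) {..<0}"
    using V_sym_marks_rescale[OF assms s(1,2), unfolded marks_rescale_to_def, rule_format, of "{..<0}"] by simp
  then have "emeasure \<nu> ?N \<noteq> 0" using s C by (simp add: nu_sym_negative[OF assms(2)] flip: ennreal_mult)
  moreover have "emeasure \<nu> ?N = ennreal ((s / C') powr (\<alpha> + 1)) * emeasure (nu_plus 1 \<alpha>) {..<0}"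
    using V_plus_marks_rescale[OF V assms(2) s(1,3), unfolded marks_rescale_to_def, rule_format, of "{..<0}"] by simp
  moreover have "emeasure (nu_plus 1 \<alpha>) {..<0} = 0"
  proof -
    have "emeasure (nu_plus 1 \<alpha>) {..<0} = (\<integral>\<^sup>+u. ennreal ((\<alpha> + 1) / 1 powr (\<alpha> + 1) * u powr \<alpha> *
        indicator {0..1} u) * indicator {..<0} u \<partial>lborel)"
      unfolding nu_plus_def by (rule emeasure_density) auto
    also have "\<dots> = (\<integral>\<^sup>+u. 0 \<partial>(lborel :: real measure))"
    proof (rule nn_integral_cong)
      fix u :: real
      show "ennreal ((\<alpha> + 1) / 1 powr (\<alpha> + 1) * u powr \<alpha> * indicator {0..1} u) * indicator {..<0} u = 0"
        by (cases "u < 0") auto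
    qed
    finally show ?thesis by simp
  qed
  ultimately show False by simp
qed

subsection \<open>Critical values\<close>

lemma theta_zero_one:
  assumes "0 < \<rho>" "real_distribution \<nu>" "0 \<le> \<beta>"
  shows "theta TYPE('a::euclidean_space) \<zeta> \<beta> \<rho> \<nu> = 0 \<or> theta TYPE('a) \<zeta> \<beta> \<rho> \<nu> = 1"
  unfolding theta_eq[OF assms(1,2)]
  by (rule percolation_zero_one[OF poisson_law_PPP[OF assms(1,2)] assms(2,3)])

lemma graph_edges_mono_threshold: "\<zeta> \<le> \<zeta>' \<Longrightarrow> graph_edges \<zeta> \<beta> \<omega> \<subseteq> graph_edges \<zeta>' \<beta> \<omega>"
  by (force simp: graph_edges_def)

lemma percolates_mono_threshold:
  assumes "percolates \<zeta> \<beta> \<omega>" "\<zeta> \<le> \<zeta>'"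
  shows "percolates \<zeta>' \<beta> \<omega>"
proof -
  obtain x where x: "x \<in> fst ` \<omega>" "\<not> bounded {y. (x, y) \<in> (graph_edges \<zeta> \<beta> \<omega>)\<^sup>*}"
    using assms(1) by (auto simp: percolates_def)
  have "{y. (x, y) \<in> (graph_edges \<zeta> \<beta> \<omega>)\<^sup>*} \<subseteq> {y. (x, y) \<in> (graph_edges \<zeta>' \<beta> \<omega>)\<^sup>*}"
    using rtrancl_mono[OF graph_edges_mono_threshold[OF assms(2)]] by blast
  then have "\<not> bounded {y. (x, y) \<in> (graph_edges \<zeta>' \<beta> \<omega>)\<^sup>*}" using x(2) bounded_subset by blast
  then show ?thesis using x(1) unfolding percolates_def by blast
qed

lemma theta_mono_threshold:
  assumes "0 < \<rho>" "real_distribution \<nu>" "\<zeta> \<le> \<zeta>'"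
  shows "theta TYPE('a::euclidean_space) \<zeta> \<beta> \<rho> \<nu> \<le> theta TYPE('a) \<zeta>' \<beta> \<rho> \<nu>"
proof -
  note P = poisson_law_PPP[OF assms(1,2), where 'a='a]
  interpret prob_space "PPP \<rho> \<nu> :: ('a \<times> real) set measure" using P by (rule poisson_law_prob_space)
  show ?thesis
    unfolding theta_eq[OF assms(1,2)]
  proof (rule finite_measure_mono)
    show "{\<omega> \<in> configs. percolates \<zeta> \<beta> \<omega>} \<subseteq> {\<omega> \<in> (configs :: ('a \<times> real) set set). percolates \<zeta>' \<beta> \<omega>}"
      using percolates_mono_threshold[OF _ assms(3)] by blast
    show "{\<omega> \<in> configs. percolates \<zeta>' \<beta> \<omega>} \<in> events"
      using percolates_sets poisson_law_sets[OF P] by simp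
  qed
qed

lemma theta_AE:
  assumes "0 < \<rho>" "real_distribution \<nu>"
  shows "(AE \<omega> in (PPP \<rho> \<nu> :: ('a::euclidean_space \<times> real) set measure). percolates \<zeta> \<beta> \<omega>) \<longleftrightarrow>
      theta TYPE('a) \<zeta> \<beta> \<rho> \<nu> = 1"
    and "(AE \<omega> in (PPP \<rho> \<nu> :: ('a::euclidean_space \<times> real) set measure). \<not> percolates \<zeta> \<beta> \<omega>) \<longleftrightarrow>
      theta TYPE('a) \<zeta> \<beta> \<rho> \<nu> = 0"
proof -
  note P = poisson_law_PPP[OF assms(1,2), where 'a='a]
  interpret prob_space "PPP \<rho> \<nu> :: ('a \<times> real) set measure" using P by (rule poisson_law_prob_space)
  have ev: "{\<omega> \<in> space (PPP \<rho> \<nu>). percolates \<zeta> \<beta> \<omega>} \<in> events"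
    using percolates_sets poisson_law_sets[OF P] poisson_law_space[OF P] by simp
  show "(AE \<omega> in (PPP \<rho> \<nu> :: ('a \<times> real) set measure). percolates \<zeta> \<beta> \<omega>) \<longleftrightarrow>
      theta TYPE('a) \<zeta> \<beta> \<rho> \<nu> = 1"
    "(AE \<omega> in (PPP \<rho> \<nu> :: ('a \<times> real) set measure). \<not> percolates \<zeta> \<beta> \<omega>) \<longleftrightarrow>
      theta TYPE('a) \<zeta> \<beta> \<rho> \<nu> = 0"
    unfolding theta_def prob_Collect_eq_1[OF ev] prob_Collect_eq_0[OF ev] by simp_all
qed

text \<open>What the critical values require of the model laws with C = 1: zooming in on small marks
  reproduces the law. \<open>nu_plus 1 \<alpha>\<close> and \<open>nu_sym 1 \<alpha>\<close> are the
  instances.\<close>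

locale self_similar_marks = real_distribution \<nu> for \<nu> :: "real measure" +
  fixes \<alpha> :: real
  assumes \<alpha>: "0 \<le> \<alpha>" and self_similar: "\<And>s. 0 < s \<Longrightarrow> s \<le> 1 \<Longrightarrow> marks_rescale_to \<nu> s (s powr (\<alpha> + 1)) \<nu>"
begin

lemma marks: "real_distribution \<nu>" ..

text \<open>Self-similarity at scale 1/8 gives this mass as
  \<open>(1/8) powr (\<alpha> + 1)\<close>; the high-intensity bound divides by it.\<close>

lemma small_marks_pos: "0 < measure \<nu> {-1/8..1/8}"
proof -
  have "marks_rescale_to \<nu> (1/8) ((1/8) powr (\<alpha> + 1)) \<nu>" by (rule self_similar) auto
  from bspec[OF this[unfolded marks_rescale_to_def], of UNIV]
  have "emeasure \<nu> {e \<in> {-(1/8)..1/8}. e / (1/8) \<in> UNIV} = ennreal ((1/8) powr (\<alpha> + 1)) * emeasure \<nu> UNIV"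
    by simp
  also have "{e \<in> {-(1/8)..1/8}. e / (1/8) \<in> UNIV} = {-1/8..1/8 :: real}" by auto
  finally have "ennreal (measure \<nu> {-1/8..1/8}) = ennreal ((1/8) powr (\<alpha> + 1))"
    using emeasure_space_1 by (simp add: emeasure_eq_measure)
  then have "measure \<nu> {-1/8..1/8} = (1/8) powr (\<alpha> + 1)" by (subst (asm) ennreal_inj) auto
  then show ?thesis by simp
qed

lemma theta_mono_intensity:
  assumes "0 < r" "r \<le> r'"
  shows "theta TYPE('a::euclidean_space) 1 1 r \<nu> \<le> theta TYPE('a) 1 1 r' \<nu>"
proof -
  define e where "e = real DIM('a) + (\<alpha> + 1)"
  have e: "0 < e" using \<alpha> by (simp add: e_def)
  \<comment> \<open>\<open>s\<close> solves \<open>r' * s powr e = r\<close>: threshold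
    \<open>s\<close> at intensity \<open>r'\<close> is equivalent to threshold 1 at intensity
    \<open>r\<close>.\<close>
  define s where "s = (r / r') powr (1 / e)"
  have r': "0 < r'" using assms by linarith
  have s: "0 < s" "s \<le> 1"
    using assms r' e by (auto simp: s_def intro!: powr_le1)
  have "s ^ DIM('a) * s powr (\<alpha> + 1) = s powr e"
    using s by (simp add: e_def powr_add powr_realpow)
  also have "\<dots> = r / r'" using assms r' e by (simp add: s_def powr_powr)
  finally have "r' * s ^ DIM('a) * s powr (\<alpha> + 1) = r" using r' by (simp add: mult.assoc)
  then have "theta TYPE('a) 1 1 r \<nu> = theta TYPE('a) s 1 r' \<nu>"
    using theta_rescale[OF r' marks marks s(1), of 1 "s powr (\<alpha> + 1)", where 'a='a] self_similar[OF s] s by simp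
  also have "\<dots> \<le> theta TYPE('a) 1 1 r' \<nu>"
    by (rule theta_mono_threshold[OF r' marks s(2)])
  finally show ?thesis .
qed

lemma ex_critical_intensity:
  assumes d: "2 \<le> DIM('a::euclidean_space)"
  obtains l where "0 < l" "\<And>r. l < r \<Longrightarrow> theta TYPE('a) 1 1 r \<nu> = 1"
    "\<And>r. 0 < r \<Longrightarrow> r < l \<Longrightarrow> theta TYPE('a) 1 1 r \<nu> = 0"
proof -
  \<comment> \<open>The infimum of \<open>S\<close> is the critical value: \<open>S\<close> is
    upward closed by monotonicity, and off \<open>S\<close> the zero-one law makes
    \<open>theta\<close> vanish.\<close>
  define S where "S = {r. 0 < r \<and> theta TYPE('a) 1 1 r \<nu> = 1}"
  \<comment> \<open>Half of 3^(-d), to satisfy the strict inequality of the path count.\<close>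
  define a where "a = 1 / (2 * 3 ^ DIM('a) :: real)"
  have a: "0 < a" "a * 3 ^ DIM('a) < 1" by (auto simp: a_def)
  have lower: "a \<le> r" if "r \<in> S" for r
  proof (rule ccontr)
    assume "\<not> a \<le> r"
    then have "r * 3 ^ DIM('a) < a * 3 ^ DIM('a)" by (intro mult_strict_right_mono) auto
    then have "r * 3 ^ DIM('a) < 1" using a by linarith
    moreover have "0 < r" using that by (simp add: S_def)
    ultimately have "theta TYPE('a) 1 1 r \<nu> = 0"
      unfolding theta_eq[OF \<open>0 < r\<close> marks]
      by (intro no_percolation_low_intensity[OF poisson_law_PPP[OF _ marks] marks]) auto
    then show False using that by (simp add: S_def)
  qed
  \<comment> \<open>The measure of one tile with small marks; intensity 72 / v just meets the
    hypothesis of the block argument.\<close>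
  define v where "v = (1 / (4 * real DIM('a))) ^ DIM('a) * measure \<nu> {-1/8..1/8}"
  have v: "0 < v" unfolding v_def using small_marks_pos by (intro mult_pos_pos) auto
  have "theta TYPE('a) 1 1 (72 / v) \<nu> = 1"
  proof -
    have "0 < 72 / v" using v by simp
    show ?thesis
      unfolding theta_eq[OF \<open>0 < 72 / v\<close> marks]
    proof (rule percolation_high_intensity[OF d poisson_law_PPP[OF \<open>0 < 72 / v\<close> marks] marks])
      show "72 \<le> 72 / v * ((1 / (4 * real DIM('a))) ^ DIM('a) * measure \<nu> {-1/8..1/8})"
        unfolding v_def[symmetric] using v by simp
    qed
  qed
  then have S: "72 / v \<in> S" using v by (simp add: S_def)
  have bdd: "bdd_below S" using lower by (rule bdd_belowI)
  show ?thesis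
  proof (rule that)
    show "0 < Inf S" using cInf_greatest[of S a] lower S a(1) by force
    show "theta TYPE('a) 1 1 r \<nu> = 1" if "Inf S < r" for r
    proof -
      obtain r' where r': "r' \<in> S" "r' < r" using \<open>Inf S < r\<close> S cInf_lessD by blast
      then have "1 \<le> theta TYPE('a) 1 1 r \<nu>" using theta_mono_intensity[of r' r, where 'a='a] by (simp add: S_def)
      moreover have "0 < r" using r' by (simp add: S_def)
      ultimately show ?thesis using theta_zero_one[OF _ marks, of r 1 1, where 'a='a] by auto
    qed
    show "theta TYPE('a) 1 1 r \<nu> = 0" if "0 < r" "r < Inf S" for r
    proof -
      have "r \<notin> S" using cInf_lower[OF _ bdd, of r] that by auto
      then show ?thesis using theta_zero_one[OF _ marks, of r 1 1, where 'a='a] that by (auto simp: S_def)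
    qed
  qed
qed

text \<open>Unpacks the definite description into usable facts. Strictly between two candidates
  there would be an intensity at which \<open>theta\<close> is both 0 and 1.\<close>

lemma critical_intensity:
  assumes d: "2 \<le> DIM('a::euclidean_space)"
  shows "0 < critical_intensity TYPE('a) \<nu>"
    and "\<And>r. critical_intensity TYPE('a) \<nu> < r \<Longrightarrow> theta TYPE('a) 1 1 r \<nu> = 1"
    and "\<And>r. 0 < r \<Longrightarrow> r < critical_intensity TYPE('a) \<nu> \<Longrightarrow> theta TYPE('a) 1 1 r \<nu> = 0"
proof -
  obtain l where l: "0 < l" "\<And>r. l < r \<Longrightarrow> theta TYPE('a) 1 1 r \<nu> = 1"
    "\<And>r. 0 < r \<Longrightarrow> r < l \<Longrightarrow> theta TYPE('a) 1 1 r \<nu> = 0"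
    using ex_critical_intensity[OF d] by blast
  have "critical_intensity TYPE('a) \<nu> = l"
    unfolding critical_intensity_def
  proof (rule the_equality)
    show "0 < l \<and> (\<forall>r. l < r \<longrightarrow> (AE \<omega> in (PPP r \<nu> :: ('a \<times> real) set measure). percolates 1 1 \<omega>)) \<and>
      (\<forall>r. 0 < r \<and> r < l \<longrightarrow> (AE \<omega> in (PPP r \<nu> :: ('a \<times> real) set measure). \<not> percolates 1 1 \<omega>))"
      using l theta_AE[OF _ marks, where 'a='a] by auto
  next
    fix l' assume l': "0 < l' \<and> (\<forall>r. l' < r \<longrightarrow> (AE \<omega> in (PPP r \<nu> :: ('a \<times> real) set measure). percolates 1 1 \<omega>)) \<and>
      (\<forall>r. 0 < r \<and> r < l' \<longrightarrow> (AE \<omega> in (PPP r \<nu> :: ('a \<times> real) set measure). \<not> percolates 1 1 \<omega>))"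
    have 1: "theta TYPE('a) 1 1 r \<nu> = 1" if "l' < r" for r
      using l' that theta_AE(1)[OF _ marks, of r, where 'a='a] by auto
    have 0: "theta TYPE('a) 1 1 r \<nu> = 0" if "0 < r" "r < l'" for r
      using l' that theta_AE(2)[OF _ marks, of r, where 'a='a] by auto
    show "l' = l"
    proof (rule linorder_cases[of l' l])
      assume "l' < l"
      then obtain r where "l' < r" "r < l" using dense by blast
      then show ?thesis using 1[of r] l(3)[of r] l' by auto
    next
      assume "l < l'"
      then obtain r where "l < r" "r < l'" using dense by blast
      then show ?thesis using 0[of r] l(2)[of r] l(1) by auto
    qed
  qed
  then show "0 < critical_intensity TYPE('a) \<nu>"
    "\<And>r. critical_intensity TYPE('a) \<nu> < r \<Longrightarrow> theta TYPE('a) 1 1 r \<nu> = 1"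
    "\<And>r. 0 < r \<Longrightarrow> r < critical_intensity TYPE('a) \<nu> \<Longrightarrow> theta TYPE('a) 1 1 r \<nu> = 0"
    using l by auto
qed

text \<open>\<open>\<nu>'\<close> is the given mark law and \<open>\<nu>\<close> the model law of
  the locale. They agree after rescaling up to scale \<open>m\<close>, so the identity for
  \<open>theta\<close> is available up to threshold \<open>m * \<beta>\<close>.\<close>

lemma zeta_c_formula:
  assumes d: "2 \<le> DIM('a::euclidean_space)" and \<rho>: "0 < \<rho>" and \<nu>': "real_distribution \<nu>'"
    and C: "0 < C" and \<beta>: "0 < \<beta>"
    and r: "\<And>s. 0 < s \<Longrightarrow> s \<le> m \<Longrightarrow> marks_rescale_to \<nu>' s ((s / C) powr (\<alpha> + 1)) \<nu>"
    and z: "z = (critical_intensity TYPE('a) \<nu> / \<rho>) powr (1 / (\<alpha> + 1 + real DIM('a))) *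
        (\<beta> * C) powr ((\<alpha> + 1) / (\<alpha> + 1 + real DIM('a)))"
    and zm: "z < m * \<beta>"
  shows "zeta_c TYPE('a) \<beta> \<rho> \<nu>' = z"
proof -
  define l where "l = critical_intensity TYPE('a) \<nu>"
  define e where "e = \<alpha> + 1 + real DIM('a)"
  \<comment> \<open>The effective intensity, a constant times \<open>\<zeta> powr e\<close>:
    strictly increasing, with \<open>L z = l\<close>.\<close>
  define L where "L \<zeta> = \<rho> * \<zeta> ^ DIM('a) * (\<zeta> / \<beta> / C) powr (\<alpha> + 1)" for \<zeta>
  have l: "0 < l" unfolding l_def by (rule critical_intensity(1)[OF d])
  have e: "0 < e" using \<alpha> by (simp add: e_def)
  have \<beta>C: "0 < \<beta> * C" using \<beta> C by simp
  have z0: "0 < z" using l \<rho> \<beta> C by (simp add: z l_def[symmetric])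
  have L: "L \<zeta> = \<rho> / (\<beta> * C) powr (\<alpha> + 1) * \<zeta> powr e" if "0 < \<zeta>" for \<zeta>
    using that \<beta> C by (simp add: L_def e_def powr_add powr_realpow powr_divide powr_mult)
  have "z powr e = l / \<rho> * (\<beta> * C) powr (\<alpha> + 1)"
    using l \<rho> \<beta>C e by (simp add: z l_def[symmetric] e_def[symmetric] powr_mult powr_powr)
  then have Lz: "L z = l" unfolding L[OF z0] using \<rho> \<beta> C by simp
  have Lmono: "L \<zeta> < L \<zeta>'" if "0 < \<zeta>" "\<zeta> < \<zeta>'" for \<zeta> \<zeta>'
    using that \<rho> \<beta> C e unfolding L[OF that(1)] L[OF order_less_trans[OF that]]
    by (intro mult_strict_left_mono powr_less_mono2) auto
  have Lpos: "0 < L \<zeta>" if "0 < \<zeta>" for \<zeta> using that \<rho> \<beta> C by (simp add: L_def)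
  have theta: "theta TYPE('a) \<zeta> \<beta> \<rho> \<nu>' = theta TYPE('a) 1 1 (L \<zeta>) \<nu>" if "0 < \<zeta>" "\<zeta> \<le> m * \<beta>" for \<zeta>
    unfolding L_def
  proof (rule theta_rescale[OF \<rho> \<nu>' marks that(1) \<beta>])
    show "0 < (\<zeta> / \<beta> / C) powr (\<alpha> + 1)" using that \<beta> C by simp
    show "marks_rescale_to \<nu>' (\<zeta> / \<beta>) ((\<zeta> / \<beta> / C) powr (\<alpha> + 1)) \<nu>"
      using that \<beta> by (intro r) (auto simp: pos_divide_le_eq)
  qed
  have above: "theta TYPE('a) \<zeta> \<beta> \<rho> \<nu>' = 1" if "z < \<zeta>" for \<zeta>
  proof -
    \<comment> \<open>The strict bound on \<open>z\<close> leaves room for a threshold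
      \<open>\<zeta>'\<close> that is still within the range of the rescaling; monotonicity carries
      percolation from there to all larger thresholds.\<close>
    have "z < min \<zeta> (m * \<beta>)" using that zm by simp
    then obtain \<zeta>' where \<zeta>': "z < \<zeta>'" "\<zeta>' < min \<zeta> (m * \<beta>)" using dense by blast
    have "theta TYPE('a) \<zeta>' \<beta> \<rho> \<nu>' = 1"
      using \<zeta>' z0 Lmono[OF z0 \<zeta>'(1)] by (subst theta) (auto simp: Lz l_def intro!: critical_intensity(2)[OF d])
    then have "1 \<le> theta TYPE('a) \<zeta> \<beta> \<rho> \<nu>'"
      using theta_mono_threshold[OF \<rho> \<nu>', of \<zeta>' \<zeta> \<beta>, where 'a='a] \<zeta>' by simp
    then show ?thesis using theta_zero_one[OF \<rho> \<nu>', of \<beta> \<zeta>, where 'a='a] \<beta> by auto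
  qed
  have below: "theta TYPE('a) \<zeta> \<beta> \<rho> \<nu>' = 0" if "0 < \<zeta>" "\<zeta> < z" for \<zeta>
  proof -
    have "L \<zeta> < critical_intensity TYPE('a) \<nu>" using Lmono[OF that] Lz by (simp add: l_def)
    then show ?thesis
      using that zm Lpos[OF that(1)] by (subst theta) (auto intro: critical_intensity(3)[OF d])
  qed
  show ?thesis
    unfolding zeta_c_def
  proof (rule the_equality)
    show "0 < z \<and> (\<forall>\<zeta>. z < \<zeta> \<longrightarrow> theta TYPE('a) \<zeta> \<beta> \<rho> \<nu>' = 1) \<and>
      (\<forall>\<zeta>. 0 < \<zeta> \<and> \<zeta> < z \<longrightarrow> theta TYPE('a) \<zeta> \<beta> \<rho> \<nu>' = 0)"
      using z0 above below by blast
  next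
    fix y assume y: "0 < y \<and> (\<forall>\<zeta>. y < \<zeta> \<longrightarrow> theta TYPE('a) \<zeta> \<beta> \<rho> \<nu>' = 1) \<and>
      (\<forall>\<zeta>. 0 < \<zeta> \<and> \<zeta> < y \<longrightarrow> theta TYPE('a) \<zeta> \<beta> \<rho> \<nu>' = 0)"
    show "y = z"
    proof (rule linorder_cases[of y z])
      assume "y < z"
      then obtain \<zeta> where "y < \<zeta>" "\<zeta> < z" using dense by blast
      then show ?thesis using y below[of \<zeta>] by auto
    next
      assume "z < y"
      then obtain \<zeta> where "z < \<zeta>" "\<zeta> < y" using dense by blast
      then show ?thesis using y above[of \<zeta>] z0 by auto
    qed
  qed
qed

end

lemma self_similar_nu_plus: "0 \<le> \<alpha> \<Longrightarrow> self_similar_marks (nu_plus 1 \<alpha>) \<alpha>"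
  unfolding self_similar_marks_def self_similar_marks_axioms_def marks_rescale_to_def
  by (intro conjI allI impI ballI real_distribution_nu_plus) (use nu_plus_rescale[where C=1] in simp_all)

lemma self_similar_nu_sym: "0 \<le> \<alpha> \<Longrightarrow> self_similar_marks (nu_sym 1 \<alpha>) \<alpha>"
  unfolding self_similar_marks_def self_similar_marks_axioms_def marks_rescale_to_def
  by (intro conjI allI impI ballI real_distribution_nu_sym) (use nu_sym_rescale[where C=1] in simp_all)

text \<open>With \<gamma> = (\<alpha> + 1)/(\<alpha> + 1 + d) < 1 this shows that all large \<beta>
  meet the explicit condition of the theorem.\<close>

lemma sublinear_eventually_below:
  fixes K m \<gamma> :: real
  assumes "0 \<le> K" "0 < C" "0 < m" "0 < \<gamma>" "\<gamma> < 1"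
  shows "\<exists>\<beta>\<^sub>0>0. \<forall>\<beta>\<ge>\<beta>\<^sub>0. K * (\<beta> * C) powr \<gamma> < m * \<beta>"
proof -
  \<comment> \<open>The threshold for \<beta> solves \<open>\<beta> powr (1 - \<gamma>) = k\<close>;
    the added 1 makes the final inequality strict.\<close>
  define k where "k = (K * C powr \<gamma> + 1) / m"
  have k: "0 < k" using assms by (simp add: k_def add_nonneg_pos)
  have "K * (\<beta> * C) powr \<gamma> < m * \<beta>" if "k powr (1 / (1 - \<gamma>)) \<le> \<beta>" for \<beta>
  proof -
    have "0 < k powr (1 / (1 - \<gamma>))" using k by simp
    then have \<beta>: "0 < \<beta>" using that by linarith
    have "k = (k powr (1 / (1 - \<gamma>))) powr (1 - \<gamma>)" using k assms by (simp add: powr_powr)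
    also have "\<dots> \<le> \<beta> powr (1 - \<gamma>)" using that assms by (intro powr_mono2) auto
    finally have "K * C powr \<gamma> + 1 \<le> m * \<beta> powr (1 - \<gamma>)"
      using assms by (simp add: k_def pos_divide_le_eq mult.commute)
    then have "K * C powr \<gamma> * \<beta> powr \<gamma> < m * \<beta> powr (1 - \<gamma>) * \<beta> powr \<gamma>"
      using \<beta> by (intro mult_strict_right_mono) auto
    also have "\<dots> = m * \<beta>" using \<beta> by (simp add: mult.assoc flip: powr_add)
    finally show ?thesis using \<beta> assms by (simp add: powr_mult mult_ac)
  qed
  moreover have "0 < k powr (1 / (1 - \<gamma>))" using k by simp
  ultimately show ?thesis by blast
qed

theorem theorem7p4:
  fixes \<alpha> \<rho> \<epsilon> C :: real and \<nu> :: "real measure"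
  assumes "2 \<le> DIM('a::euclidean_space)"
    and "0 \<le> \<alpha>" and "0 < \<rho>"
    and "V_plus_with \<alpha> \<nu> \<epsilon> C \<or> V_sym_with \<alpha> \<nu> \<epsilon> C"
  shows
    "(\<exists>\<beta>\<^sub>0>0. \<forall>\<beta>\<ge>\<beta>\<^sub>0.
        zeta_c TYPE('a) \<beta> \<rho> \<nu> =
          (lambda_c_star TYPE('a) \<alpha> \<nu> / \<rho>) powr (1 / (\<alpha> + 1 + real DIM('a))) *
          (\<beta> * C) powr ((\<alpha> + 1) / (\<alpha> + 1 + real DIM('a))) \<and>
        c_c TYPE('a) \<beta> \<rho> \<nu> =
          exp (- ((lambda_c_star TYPE('a) \<alpha> \<nu> / \<rho>) powr (1 / (\<alpha> + 1 + real DIM('a))) *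
                  (\<beta> * C) powr ((\<alpha> + 1) / (\<alpha> + 1 + real DIM('a)))))) \<and>
     (\<forall>\<beta>>0.
        (lambda_c_star TYPE('a) \<alpha> \<nu> / \<rho>) powr (1 / (\<alpha> + 1 + real DIM('a))) *
          (\<beta> * C) powr ((\<alpha> + 1) / (\<alpha> + 1 + real DIM('a))) < min C \<epsilon> * \<beta> \<longrightarrow>
        zeta_c TYPE('a) \<beta> \<rho> \<nu> =
          (lambda_c_star TYPE('a) \<alpha> \<nu> / \<rho>) powr (1 / (\<alpha> + 1 + real DIM('a))) *
          (\<beta> * C) powr ((\<alpha> + 1) / (\<alpha> + 1 + real DIM('a))) \<and>
        c_c TYPE('a) \<beta> \<rho> \<nu> =
          exp (- ((lambda_c_star TYPE('a) \<alpha> \<nu> / \<rho>) powr (1 / (\<alpha> + 1 + real DIM('a))) *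
                  (\<beta> * C) powr ((\<alpha> + 1) / (\<alpha> + 1 + real DIM('a))))))"
proof -
  let ?z = "\<lambda>\<beta>. (lambda_c_star TYPE('a) \<alpha> \<nu> / \<rho>) powr (1 / (\<alpha> + 1 + real DIM('a))) *
      (\<beta> * C) powr ((\<alpha> + 1) / (\<alpha> + 1 + real DIM('a)))"
  have \<nu>: "real_distribution \<nu>" and C: "0 < C" and \<epsilon>: "0 < \<epsilon>"
    using assms(4) by (auto simp: V_plus_with_def V_sym_with_def)
  \<comment> \<open>Up to scale \<open>min C \<epsilon>\<close> the marks follow the power law
    without feeling its cutoff, whence \<open>m = min C \<epsilon>\<close> in both cases.\<close>
  have zeta: "zeta_c TYPE('a) \<beta> \<rho> \<nu> = ?z \<beta>" if \<beta>: "0 < \<beta>" "?z \<beta> < min C \<epsilon> * \<beta>" for \<beta>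
    using assms(4)
  proof
    assume V: "V_plus_with \<alpha> \<nu> \<epsilon> C"
    then have "lambda_c_star TYPE('a) \<alpha> \<nu> = critical_intensity TYPE('a) (nu_plus 1 \<alpha>)"
      by (auto simp: lambda_c_star_def lambda_c_plus_def V_plus_def)
    with \<beta> show ?thesis
      using V_plus_marks_rescale[OF V assms(2)]
      by (intro self_similar_marks.zeta_c_formula[OF self_similar_nu_plus[OF assms(2)] assms(1,3) \<nu> C, where m="min C \<epsilon>"]) auto
  next
    assume V: "V_sym_with \<alpha> \<nu> \<epsilon> C"
    then have "lambda_c_star TYPE('a) \<alpha> \<nu> = critical_intensity TYPE('a) (nu_sym 1 \<alpha>)"
      using V_plus_disjoint_V_sym[OF V assms(2)] by (simp add: lambda_c_star_def lambda_c_def)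
    with \<beta> show ?thesis
      using V_sym_marks_rescale[OF V assms(2)]
      by (intro self_similar_marks.zeta_c_formula[OF self_similar_nu_sym[OF assms(2)] assms(1,3) \<nu> C, where m="min C \<epsilon>"]) auto
  qed
  have "\<exists>\<beta>\<^sub>0>0. \<forall>\<beta>\<ge>\<beta>\<^sub>0. ?z \<beta> < min C \<epsilon> * \<beta>"
    using assms(1,2) C \<epsilon> by (intro sublinear_eventually_below) auto
  then obtain \<beta>\<^sub>0 where \<beta>\<^sub>0: "0 < \<beta>\<^sub>0" "\<And>\<beta>. \<beta>\<^sub>0 \<le> \<beta> \<Longrightarrow> ?z \<beta> < min C \<epsilon> * \<beta>" by blast
  have "zeta_c TYPE('a) \<beta> \<rho> \<nu> = ?z \<beta>" if "\<beta>\<^sub>0 \<le> \<beta>" for \<beta>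
    using that \<beta>\<^sub>0 by (intro zeta) auto
  then show ?thesis
    unfolding c_c_def using \<beta>\<^sub>0(1) zeta by (intro conjI exI[of _ \<beta>\<^sub>0]) auto
qed

end
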